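(* Let $K$ be a field, $n\ge 1$, $S=K[x_1,\ldots,x_n]$, and let $0\le s\le n$. Let $\alpha: a_1<a_2<\cdots<a_s$ and $\beta: b_1<b_2<\cdots<b_s$ be sequences of integers with $1\le a_1$, $b_s\le n$ and $a_i\le b_i$ for all $1\le i\le s$, and let $I_{\alpha,\beta}=(x_{a_1}x_{a_1+1}\cdots x_{b_1},\ldots,x_{a_s}x_{a_s+1}\cdots x_{b_s})\subset S$ (with $I_{\alpha,\beta}=0$ if $s=0$). Assume that $a_{k+2}>b_k+1$ for all $1\le k\le s-2$. Then: (1) $\operatorname{sdepth}(S/I_{\alpha,\beta})=\operatorname{depth}(S/I_{\alpha,\beta})=n-s$. (2) $\operatorname{sdepth}(I_{\alpha,\beta})=n-\left\lfloor\frac{s}{2}\right\rfloor$, for all $s\ge1$. (3) If $b_i\ge a_{i+1}$ for all $1\le i\le s-1$, then $\dim(S/I_{\alpha,\beta})=n-\left\lceil\frac{s}{2}\right\rceil$.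
   Context: Stanley depth: for a finitely generated $\mathbb Z^n$-graded $S$-module $M$, a Stanley decomposition of $M$ is a direct sum $\mathcal D: M=\bigoplus_{i=1}^r m_iK[Z_i]$ as $\mathbb Z^n$-graded $K$-vector spaces, where each $m_i\in M$ is homogeneous for the $\mathbb Z^n$-grading, $Z_i\subset\{x_1,\ldots,x_n\}$, and $m_iK[Z_i]=\{um_i: u\in K[Z_i]\}$ is a free $K[Z_i]$-submodule of $M$. Set $\operatorname{sdepth}(\mathcal D)=\min_i|Z_i|$ and $\operatorname{sdepth}(M)=\max\{\operatorname{sdepth}(\mathcal D):\mathcal D \text{ a Stanley decomposition of } M\}$. Depth is with respect to the graded maximal ideal $(x_1,\ldots,x_n)$. *)

theory Defs
  imports
    "HOL-Algebra.QuotRing"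
    "HOL-Algebra.Module"
    "HOL-Library.Poly_Mapping"
    "HOL-Library.Extended_Nat"
    Complex_Main
begin

text \<open>
  A polynomial in the variables \<open>x\<^sub>0, x\<^sub>1, \<dots>\<close> over a field maps each exponent vector (finitely
  supported, hence a monomial) to its coefficient. The ring \<open>K[x\<^sub>1,\<dots>,x\<^sub>n]\<close> and its subrings
  \<open>K[Z]\<close> are carved out by restricting the variables that may occur.
\<close>

type_synonym 'k mpoly = "(nat \<Rightarrow>\<^sub>0 nat) \<Rightarrow>\<^sub>0 'k"

definition polys :: "nat set \<Rightarrow> 'k::field mpoly set" where
  "polys Z = {p. \<forall>m \<in> Poly_Mapping.keys p. Poly_Mapping.keys m \<subseteq> Z}"

definition var :: "nat \<Rightarrow> 'k::field mpoly" where
  "var i = Poly_Mapping.single (Poly_Mapping.single i 1) 1"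

definition mpoly_ring :: "nat \<Rightarrow> 'k::field mpoly ring" where
  "mpoly_ring n =
    \<lparr>carrier = polys {1..n}, mult = (*), one = 1, zero = 0, add = (+)\<rparr>"

definition graded_max_ideal :: "nat \<Rightarrow> 'k::field mpoly set" where
  "graded_max_ideal n = Idl\<^bsub>mpoly_ring n\<^esub> (var ` {1..n})"

definition interval_ideal ::
    "nat \<Rightarrow> nat \<Rightarrow> (nat \<Rightarrow> nat) \<Rightarrow> (nat \<Rightarrow> nat) \<Rightarrow> 'k::field mpoly set" where
  "interval_ideal n s a b =
    Idl\<^bsub>mpoly_ring n\<^esub> ((\<lambda>i. \<Prod>j\<in>{a i..b i}. var j) ` {1..s})"


text \<open>
  An ideal \<open>I\<close> of \<open>R\<close> and the quotient \<open>R/I\<close> as \<open>R\<close>-modules. Module records extend ring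
  records; the fields \<open>mult\<close> and \<open>one\<close> play no role in the module structure.
\<close>

definition ideal_module :: "'a ring \<Rightarrow> 'a set \<Rightarrow> ('a, 'a) module" where
  "ideal_module R I =
    \<lparr>carrier = I, mult = mult R, one = one R, zero = zero R, add = add R, smult = mult R\<rparr>"

definition quot_module :: "'a ring \<Rightarrow> 'a set \<Rightarrow> ('a, 'a set) module" where
  "quot_module R I =
    \<lparr>carrier = carrier (R Quot I), mult = mult (R Quot I), one = one (R Quot I),
     zero = zero (R Quot I), add = add (R Quot I),
     smult = (\<lambda>r X. (I +>\<^bsub>R\<^esub> r) \<otimes>\<^bsub>R Quot I\<^esub> X)\<rparr>"


text \<open>
  A \<open>\<int>\<^sup>n\<close>-grading of a module is given by its family of homogeneous components, indexed by
  \<open>degrees n\<close>. The grading of the polynomial ring is the one with \<open>deg x\<^sub>i\<close> the \<open>i\<close>-th unit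
  vector, so that a component is zero in every degree with a negative entry.
\<close>

definition degrees :: "nat \<Rightarrow> (nat \<Rightarrow> int) set" where
  "degrees n = {g. \<forall>i. i \<notin> {1..n} \<longrightarrow> g i = 0}"

definition poly_component :: "nat \<Rightarrow> (nat \<Rightarrow> int) \<Rightarrow> 'k::field mpoly set" where
  "poly_component n g =
    {p \<in> polys {1..n}. \<forall>m \<in> Poly_Mapping.keys p. \<forall>i. int (Poly_Mapping.lookup m i) = g i}"

definition ideal_component ::
    "nat \<Rightarrow> 'k::field mpoly set \<Rightarrow> (nat \<Rightarrow> int) \<Rightarrow> 'k mpoly set" where
  "ideal_component n I g = I \<inter> poly_component n g"

definition quot_component ::
    "nat \<Rightarrow> 'k::field mpoly set \<Rightarrow> (nat \<Rightarrow> int) \<Rightarrow> 'k mpoly set set" where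
  "quot_component n I g = (\<lambda>p. I +>\<^bsub>mpoly_ring n\<^esub> p) ` poly_component n g"


text \<open>
  A Stanley decomposition of the module \<open>M\<close> with homogeneous components \<open>gr g\<close> is the list of
  its pairs \<open>(m\<^sub>i, Z\<^sub>i)\<close>. The sum of the \<open>m\<^sub>i K[Z\<^sub>i]\<close> being direct is expressed by existence and
  uniqueness of the representation of each element of \<open>M\<close>. Each summand is generated over
  \<open>K[Z\<^sub>i]\<close> by a homogeneous element, hence is a graded subspace, so that a direct sum of vector
  spaces is automatically one of graded vector spaces.
\<close>

definition stanley_space ::
    "('k::field mpoly, 'm) module \<Rightarrow> 'm \<times> nat set \<Rightarrow> 'm set" where
  "stanley_space M = (\<lambda>(m, Z). (\<lambda>u. u \<odot>\<^bsub>M\<^esub> m) ` polys Z)"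

definition stanley_decomposition ::
    "nat \<Rightarrow> ('k::field mpoly, 'm) module \<Rightarrow> ((nat \<Rightarrow> int) \<Rightarrow> 'm set) \<Rightarrow>
      ('m \<times> nat set) list \<Rightarrow> bool" where
  "stanley_decomposition n M gr D \<longleftrightarrow>
    (\<forall>(m, Z) \<in> set D.
      m \<in> carrier M \<and> (\<exists>g \<in> degrees n. m \<in> gr g) \<and> Z \<subseteq> {1..n} \<and>
      (\<forall>u \<in> polys Z. u \<odot>\<^bsub>M\<^esub> m = \<zero>\<^bsub>M\<^esub> \<longrightarrow> u = 0)) \<and>
    (\<forall>v \<in> carrier M. \<exists>!f.
      f \<in> (\<Pi>\<^sub>E i\<in>{..<length D}. stanley_space M (D ! i)) \<and>
      v = (\<Oplus>\<^bsub>M\<^esub>i\<in>{..<length D}. f i))"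

definition sdepth_of_decomposition :: "('m \<times> nat set) list \<Rightarrow> nat" where
  "sdepth_of_decomposition D = Min ((\<lambda>(m, Z). card Z) ` set D)"

text \<open>
  Only meaningful for \<open>M \<noteq> 0\<close>: the zero module has the empty decomposition only, whose minimum
  is taken over the empty set.
\<close>

definition sdepth ::
    "nat \<Rightarrow> ('k::field mpoly, 'm) module \<Rightarrow> ((nat \<Rightarrow> int) \<Rightarrow> 'm set) \<Rightarrow> nat" where
  "sdepth n M gr =
    Max {sdepth_of_decomposition D | D. stanley_decomposition n M gr D}"


text \<open>
  \<open>seq_submodule M rs\<close> is the submodule \<open>(r\<^sub>1,\<dots>,r\<^sub>k)M\<close>. That \<open>r\<^sub>i\<close> is a nonzerodivisor on
  \<open>M/(r\<^sub>1,\<dots>,r\<^bsub>i-1\<^esub>)M\<close> is spelled out on representatives in \<open>M\<close>. The depth with respect to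
  an ideal \<open>J\<close> is the supremum of the lengths of the \<open>M\<close>-regular sequences in \<open>J\<close>.
\<close>

definition seq_submodule :: "('a, 'm) module \<Rightarrow> 'a list \<Rightarrow> 'm set" where
  "seq_submodule M rs =
    {\<Oplus>\<^bsub>M\<^esub>i\<in>{..<length rs}. (rs ! i) \<odot>\<^bsub>M\<^esub> f i | f. f \<in> {..<length rs} \<rightarrow> carrier M}"

definition regular_sequence :: "('a, 'm) module \<Rightarrow> 'a list \<Rightarrow> bool" where
  "regular_sequence M rs \<longleftrightarrow>
    (\<forall>i < length rs. \<forall>v \<in> carrier M.
      (rs ! i) \<odot>\<^bsub>M\<^esub> v \<in> seq_submodule M (take i rs) \<longrightarrow> v \<in> seq_submodule M (take i rs)) \<and>
    seq_submodule M rs \<noteq> carrier M"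

definition depth :: "'a set \<Rightarrow> ('a, 'm) module \<Rightarrow> enat" where
  "depth J M = Sup {enat (length rs) | rs. set rs \<subseteq> J \<and> regular_sequence M rs}"


definition krull_dim :: "('a, 'b) ring_scheme \<Rightarrow> enat" where
  "krull_dim R =
    Sup {enat k | k. \<exists>P :: nat \<Rightarrow> 'a set.
      (\<forall>i \<le> k. primeideal (P i) R) \<and> (\<forall>i < k. P i \<subset> P (Suc i))}"

end

theory Submission
  imports Defs
begin

text \<open>
  Write \<open>u\<^sub>k = {a\<^sub>k..b\<^sub>k}\<close> for the intervals and \<open>I\<close> for the ideal generated by the products of the
  variables in the \<open>u\<^sub>k\<close>. The gap hypothesis \<open>a\<^bsub>k+2\<^esub> > b\<^sub>k + 1\<close> leaves in every \<open>u\<^sub>k\<close> a private index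
  \<open>c\<^sub>k = max (a\<^sub>k) (b\<^bsub>k-1\<^esub> + 1)\<close>, one that lies in no other interval. Depth and Stanley
  depth are governed by these private variables.

  Both \<open>I\<close> and \<open>S/I\<close> have a basis of monomials, and a Stanley decomposition of such a module is
  the same thing as a partition of its basis into cells, a cell being the set of monomials of
  some \<open>x\<^sup>e K[Z]\<close>. So Stanley depth becomes a question about partitions of sets of monomials.

  Stanley depth of \<open>S/I\<close>. A monomial outside \<open>I\<close> misses a variable in every \<open>u\<^sub>k\<close>; sorting these
  monomials by the first missing variable of each interval gives cells whose \<open>Z\<close> omits at most
  \<open>s\<close> variables. Conversely let \<open>w\<close> be the product of all non-private variables. It is not in \<open>I\<close>,
  but multiplying it by any private variable leads into \<open>I\<close>, so the cell of \<open>w\<close> has \<open>Z\<close> without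
  private variables, that is at most \<open>n - s\<close> elements.

  Stanley depth of \<open>I\<close>. Monomials of \<open>I\<close> are sorted by the nonempty set \<open>X\<close> of those \<open>k\<close> whose
  generator divides them. The nonempty subsets of \<open>{1..s}\<close> can be partitioned into blocks
  \<open>{X. A \<subseteq> X, X \<inter> N = {}}\<close> with \<open>card N \<le> s div 2\<close> (\<open>interval_partition\<close>); within a block the
  generators in \<open>N\<close> are treated as in the case of \<open>S/I\<close>, which costs at most \<open>card N\<close> variables.
  For the upper bound, the monomials \<open>w x\<^bsub>c\<^sub>k\<^esub>\<close> lie in different cells and each
  \<open>w x\<^bsub>c\<^sub>k\<^esub> x\<^bsub>c\<^sub>j\<^esub>\<close> lies in a single one, so counting pairs forces one of the cells to be small.

  Depth of \<open>S/I\<close>. Colour an index \<open>j\<close> covered by the intervals with the largest \<open>k\<close> for which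
  \<open>a\<^sub>k \<le> j\<close>. The \<open>n - s\<close> linear forms \<open>x\<^sub>j - x\<^bsub>c\<^sub>k\<^esub>\<close>, for \<open>j \<noteq> c\<^sub>k\<close> of colour \<open>k\<close>, and \<open>x\<^sub>j\<close>, for \<open>j\<close>
  uncovered, form a regular sequence: exact sequences
  \<open>0 \<rightarrow> S/(I : x) \<rightarrow> S/I \<rightarrow> S/(I, x) \<rightarrow> 0\<close> reduce this to ideals generated by variables of different
  colours, where the forms remain linearly independent (\<open>regular_list_weakly_regular\<close>). In the
  other direction, the Koszul complex of \<open>x\<^sub>1, \<dots>, x\<^sub>n\<close> with coefficients in \<open>S/I\<close> has an explicit
  nonzero class in degree \<open>s\<close>, and every element of a regular sequence in the maximal ideal
  pushes a nonzero class up by one degree, while all degrees are at most \<open>n\<close>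
  (\<open>koszul_length_bound\<close>).

  Dimension of \<open>S/I\<close>. It equals \<open>n\<close> minus the smallest size of a set of indices that meets every
  \<open>u\<^sub>k\<close> (\<open>krull_dim_quotient\<close>). A prime over \<open>I\<close> contains the variables of such a set, and chains of
  primes above these are bounded by the number of remaining variables, because more polynomials
  than variables are algebraically dependent. An index lies in at most two of the intervals, and
  if consecutive intervals overlap, then \<open>b\<^sub>1, b\<^sub>3, b\<^sub>5, \<dots>\<close> meet all of them, so the smallest size is
  \<open>\<lceil>s/2\<rceil>\<close>.
\<close>

section \<open>Polynomials and their monomials\<close>

abbreviation "lookup \<equiv> Poly_Mapping.lookup"
abbreviation "keys \<equiv> Poly_Mapping.keys"
abbreviation "single \<equiv> Poly_Mapping.single"

type_synonym expo = "nat \<Rightarrow>\<^sub>0 nat"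

text \<open>
  The exponent vectors of the monomials in the variables from \<open>Z\<close>.
\<close>

definition mons :: "nat set \<Rightarrow> expo set" where
  "mons Z = {m. keys m \<subseteq> Z}"

text \<open>
  The vector space spanned by a set of monomials. Of this form are \<open>K[Z]\<close>, the cells \<open>x\<^sup>e K[Z]\<close>,
  monomial ideals, and the complements of monomial ideals that represent their quotients.
\<close>

definition mspan :: "expo set \<Rightarrow> 'k::field mpoly set" where
  "mspan U = {p. keys p \<subseteq> U}"

lemma polys_eq_mspan: "polys Z = mspan (mons Z)"
  by (auto simp: polys_def mspan_def mons_def)

lemma mspan_zero [simp]: "0 \<in> mspan U"
  by (simp add: mspan_def)

lemma mspan_add: "p \<in> mspan U \<Longrightarrow> q \<in> mspan U \<Longrightarrow> p + q \<in> mspan U"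
  using keys_add[of p q] by (auto simp: mspan_def)

lemma mspan_uminus: "p \<in> mspan U \<Longrightarrow> - p \<in> mspan U"
  by (auto simp: mspan_def in_keys_iff)

lemma mspan_diff: "p \<in> mspan U \<Longrightarrow> q \<in> mspan U \<Longrightarrow> p - q \<in> mspan U"
  using mspan_add[of p U "- q"] mspan_uminus[of q U] by simp

lemma mspan_sum: "(\<And>i. i \<in> A \<Longrightarrow> f i \<in> mspan U) \<Longrightarrow> sum f A \<in> mspan U"
  by (induction A rule: infinite_finite_induct) (auto intro: mspan_add)

lemma mspan_single: "m \<in> U \<Longrightarrow> single m c \<in> mspan U"
  by (auto simp: mspan_def)

lemma mspan_mono: "U \<subseteq> V \<Longrightarrow> mspan U \<subseteq> mspan V"
  by (auto simp: mspan_def)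

lemma mspan_mult:
  assumes "p \<in> mspan U" "q \<in> mspan V" "\<And>m m'. m \<in> U \<Longrightarrow> m' \<in> V \<Longrightarrow> m + m' \<in> W"
  shows "p * q \<in> mspan W"
  using keys_mult[of p q] assms by (fastforce simp: mspan_def)

lemma poly_eq_sum_monomials: "p = (\<Sum>m\<in>keys p. single m (lookup p m))"
proof (rule poly_mapping_eqI)
  fix m
  have "lookup (\<Sum>m\<in>keys p. single m (lookup p m)) m =
      (\<Sum>m'\<in>keys p. if m' = m then lookup p m' else 0)"
    by (simp add: lookup_sum lookup_single when_def)
  also have "\<dots> = lookup p m"
    by (simp add: in_keys_iff)
  finally show "lookup p m = lookup (\<Sum>m\<in>keys p. single m (lookup p m)) m" ..
qed

lemma lookup_single_times:
  fixes p :: "'k::field mpoly"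
  shows "lookup (single e c * p) (e + m) = c * lookup p m"
proof -
  have "lookup (single e c * p) (e + m) =
     lookup (single e c * (\<Sum>t\<in>keys p. single t (lookup p t))) (e + m)"
    using poly_eq_sum_monomials[of p] by simp
  also have "\<dots> = (\<Sum>t\<in>keys p. if t = m then c * lookup p t else 0)"
    by (simp add: sum_distrib_left lookup_sum mult_single lookup_single when_def)
  also have "\<dots> = c * lookup p m"
    by (simp add: in_keys_iff)
  finally show ?thesis .
qed

lemma keys_single_times:
  fixes p :: "'k::field mpoly"
  assumes "c \<noteq> 0"
  shows "keys (single e c * p) = (+) e ` keys p"
proof
  show "keys (single e c * p) \<subseteq> (+) e ` keys p"
    using keys_mult[of "single e c" p] by (auto split: if_splits)
  show "(+) e ` keys p \<subseteq> keys (single e c * p)"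
    using assms by (auto simp: in_keys_iff lookup_single_times)
qed

text \<open>
  The projection onto the span of \<open>U\<close> that kills all other monomials.
\<close>

definition restr :: "expo set \<Rightarrow> 'k::field mpoly \<Rightarrow> 'k mpoly" where
  "restr U p = (\<Sum>m\<in>keys p \<inter> U. single m (lookup p m))"

lemma lookup_restr: "lookup (restr U p) m = (if m \<in> U then lookup p m else 0)"
proof -
  have "lookup (restr U p) m = (\<Sum>m'\<in>keys p \<inter> U. if m' = m then lookup p m' else 0)"
    by (simp add: restr_def lookup_sum lookup_single when_def)
  also have "\<dots> = (if m \<in> U then lookup p m else 0)"
    by (auto simp: in_keys_iff)
  finally show ?thesis .
qed

lemma keys_restr: "keys (restr U p) = keys p \<inter> U"
  by (auto simp: in_keys_iff lookup_restr split: if_splits)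

lemma restr_in_mspan: "restr U p \<in> mspan U"
  by (simp add: mspan_def keys_restr)

lemma restr_id: "p \<in> mspan U \<Longrightarrow> restr U p = p"
  by (rule poly_mapping_eqI) (auto simp: lookup_restr mspan_def in_keys_iff)

lemma diff_restr: "p \<in> mspan V \<Longrightarrow> p - restr U p \<in> mspan (V - U)"
  by (auto simp: mspan_def in_keys_iff lookup_restr lookup_minus split: if_splits)

lemma restr_zero: "p \<in> mspan V \<Longrightarrow> U \<inter> V = {} \<Longrightarrow> restr U p = 0"
  by (rule poly_mapping_eqI) (auto simp: lookup_restr mspan_def in_keys_iff)

lemma mons_add: "m \<in> mons Z \<Longrightarrow> m' \<in> mons Z \<Longrightarrow> m + m' \<in> mons Z"
  using keys_add[of m m'] by (auto simp: mons_def)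

lemma mons_zero [simp]: "0 \<in> mons Z"
  by (simp add: mons_def)

lemma mons_single [simp]: "single i c \<in> mons Z \<longleftrightarrow> c = 0 \<or> i \<in> Z"
  by (auto simp: mons_def)

lemma mons_iff: "m \<in> mons Z \<longleftrightarrow> (\<forall>i. lookup m i > 0 \<longrightarrow> i \<in> Z)"
  by (auto simp: mons_def in_keys_iff)

lemma polys_mult: "p \<in> polys Z \<Longrightarrow> q \<in> polys Z \<Longrightarrow> p * q \<in> polys Z"
  unfolding polys_eq_mspan by (erule (1) mspan_mult) (rule mons_add)

lemma polys_one [simp]: "1 \<in> polys Z"
  unfolding polys_eq_mspan using mspan_single[of 0 "mons Z" 1] by simp

lemma polys_zero [simp]: "0 \<in> polys Z"
  unfolding polys_eq_mspan by simp

lemma polys_add: "p \<in> polys Z \<Longrightarrow> q \<in> polys Z \<Longrightarrow> p + q \<in> polys Z"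
  unfolding polys_eq_mspan by (rule mspan_add)

lemma polys_uminus: "p \<in> polys Z \<Longrightarrow> - p \<in> polys Z"
  unfolding polys_eq_mspan by (rule mspan_uminus)

lemma polys_diff: "p \<in> polys Z \<Longrightarrow> q \<in> polys Z \<Longrightarrow> p - q \<in> polys Z"
  unfolding polys_eq_mspan by (rule mspan_diff)

lemma polys_sum: "(\<And>i. i \<in> A \<Longrightarrow> f i \<in> polys Z) \<Longrightarrow> sum f A \<in> polys Z"
  unfolding polys_eq_mspan by (rule mspan_sum)

lemma polys_prod: "(\<And>i. i \<in> A \<Longrightarrow> f i \<in> polys Z) \<Longrightarrow> prod f A \<in> polys Z"
  by (induction A rule: infinite_finite_induct) (auto intro: polys_mult)

lemma polys_power: "p \<in> polys Z \<Longrightarrow> p ^ k \<in> polys Z"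
  by (induction k) (auto intro: polys_mult)

lemma polys_const [simp]: "single 0 c \<in> polys Z"
  unfolding polys_eq_mspan by (rule mspan_single) simp

lemma polys_var: "i \<in> Z \<Longrightarrow> var i \<in> polys Z"
  unfolding polys_eq_mspan var_def by (rule mspan_single) simp

lemma polys_mono: "Y \<subseteq> Z \<Longrightarrow> polys Y \<subseteq> polys Z"
  by (auto simp: polys_def)

lemma var_nonzero: "var i \<noteq> (0 :: 'k::field mpoly)"
proof -
  have "lookup (var i :: 'k mpoly) (single i 1) \<noteq> 0"
    by (simp add: var_def)
  then show ?thesis by (metis lookup_zero)
qed

lemma mpoly_ring_simps [simp]:
  "carrier (mpoly_ring n) = polys {1..n}" "mult (mpoly_ring n) = (*)"
  "one (mpoly_ring n) = 1" "zero (mpoly_ring n) = 0" "add (mpoly_ring n) = (+)"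
  by (simp_all add: mpoly_ring_def)

lemma cring_mpoly_ring: "cring (mpoly_ring n :: 'k::field mpoly ring)"
proof (rule cringI)
  show "abelian_group (mpoly_ring n :: 'k mpoly ring)"
  proof (rule abelian_groupI)
    fix p :: "'k mpoly" assume "p \<in> carrier (mpoly_ring n)"
    then show "\<exists>y\<in>carrier (mpoly_ring n). y \<oplus>\<^bsub>mpoly_ring n\<^esub> p = \<zero>\<^bsub>mpoly_ring n\<^esub>"
      by (intro bexI[of _ "- p"]) (auto intro: polys_uminus)
  qed (auto intro: polys_add)
  show "comm_monoid (mpoly_ring n :: 'k mpoly ring)"
    by (rule comm_monoidI) (auto intro: polys_mult)
qed (auto simp: algebra_simps)

lemma a_inv_mpoly_ring:
  assumes "p \<in> polys {1..n}"
  shows "a_inv (mpoly_ring n) p = - p"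
proof -
  interpret cring "mpoly_ring n" by (rule cring_mpoly_ring)
  show ?thesis using assms by (intro minus_equality) (auto intro: polys_uminus)
qed

text \<open>
  Closure under negation comes for free from multiplication by \<open>-1\<close>, which is why only sums and
  multiples have to be checked.
\<close>

lemma ideal_mpoly_ringI:
  assumes "J \<subseteq> polys {1..n}" "0 \<in> J" "\<And>p q. p \<in> J \<Longrightarrow> q \<in> J \<Longrightarrow> p + q \<in> J"
    and "\<And>p q. p \<in> J \<Longrightarrow> q \<in> polys {1..n} \<Longrightarrow> q * p \<in> J"
  shows "ideal J (mpoly_ring n)"
proof -
  interpret cring "mpoly_ring n" by (rule cring_mpoly_ring)
  have neg: "- p \<in> J" if "p \<in> J" for p
    using assms(4)[OF that, of "- 1"] by (simp add: polys_uminus)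
  show ?thesis
  proof (rule idealI)
    show "subgroup J (add_monoid (mpoly_ring n))"
    proof (rule add.subgroupI)
      fix p assume p: "p \<in> J"
      then show "\<ominus>\<^bsub>mpoly_ring n\<^esub> p \<in> J"
        using assms(1) neg by (subst a_inv_mpoly_ring) auto
    qed (use assms in auto)
  qed (use assms ring_axioms in \<open>auto simp: mult.commute\<close>)
qed

lemma ideal_mpoly_ringD:
  assumes "ideal J (mpoly_ring n)"
  shows "J \<subseteq> polys {1..n}" "0 \<in> J" "\<And>p q. p \<in> J \<Longrightarrow> q \<in> J \<Longrightarrow> p + q \<in> J"
    and "\<And>p q. p \<in> J \<Longrightarrow> q \<in> polys {1..n} \<Longrightarrow> q * p \<in> J"
    and "\<And>p q. p \<in> J \<Longrightarrow> q \<in> J \<Longrightarrow> p - q \<in> J"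
proof -
  interpret ideal J "mpoly_ring n" by fact
  show "J \<subseteq> polys {1..n}" "0 \<in> J" "\<And>p q. p \<in> J \<Longrightarrow> q \<in> J \<Longrightarrow> p + q \<in> J"
    and *: "\<And>p q. p \<in> J \<Longrightarrow> q \<in> polys {1..n} \<Longrightarrow> q * p \<in> J"
    using Icarr additive_subgroup.zero_closed[OF additive_subgroup_axioms]
      additive_subgroup.a_closed[OF additive_subgroup_axioms] I_l_closed by auto
  fix p q assume "p \<in> J" "q \<in> J"
  then show "p - q \<in> J"
    using additive_subgroup.a_closed[OF additive_subgroup_axioms, of p "- 1 * q"] *[of q "-1"]
    by (simp add: polys_uminus)
qed

lemma ideal_sum_closed:
  assumes "ideal J (mpoly_ring n)" "\<And>i. i \<in> A \<Longrightarrow> f i \<in> J"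
  shows "sum f A \<in> J"
  using assms(2)
  by (induction A rule: infinite_finite_induct) (auto intro: ideal_mpoly_ringD[OF assms(1)])

lemma ideal_mspan:
  assumes "V \<subseteq> mons {1..n}" "\<And>m t. m \<in> V \<Longrightarrow> t \<in> mons {1..n} \<Longrightarrow> t + m \<in> V"
  shows "ideal (mspan V) (mpoly_ring n)"
proof (rule ideal_mpoly_ringI)
  show "mspan V \<subseteq> polys {1..n}"
    unfolding polys_eq_mspan by (rule mspan_mono[OF assms(1)])
qed (auto simp: polys_eq_mspan intro: mspan_add mspan_mult[of _ "mons {1..n}" _ V] assms(2))

text \<open>
  The exponent vector of the squarefree monomial with support \<open>P\<close>.
\<close>

definition ind :: "nat set \<Rightarrow> expo" where
  "ind P = (\<Sum>j\<in>P. single j 1)"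

lemma lookup_ind: "finite P \<Longrightarrow> lookup (ind P) j = (if j \<in> P then 1 else 0)"
  by (simp add: ind_def lookup_sum lookup_single when_def)

lemma keys_ind: "finite P \<Longrightarrow> keys (ind P) = P"
  by (auto simp: in_keys_iff lookup_ind split: if_splits)

lemma prod_var: "finite P \<Longrightarrow> (\<Prod>j\<in>P. var j) = single (ind P) (1::'k::field)"
  by (induction P rule: finite_induct) (auto simp: ind_def var_def mult_single)

lemma ind_insert: "finite P \<Longrightarrow> j \<notin> P \<Longrightarrow> ind (insert j P) = single j 1 + ind P"
  by (simp add: ind_def)

section \<open>Stanley decompositions as partitions of monomials\<close>

text \<open>
  The monomials of \<open>x\<^sup>e K[Z]\<close>, for the pair \<open>(e, Z)\<close>.
\<close>

definition cell :: "expo \<times> nat set \<Rightarrow> expo set" where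
  "cell x = (+) (fst x) ` mons (snd x)"

definition stanley_partition :: "nat \<Rightarrow> expo set \<Rightarrow> (expo \<times> nat set) list \<Rightarrow> bool" where
  "stanley_partition n U E \<longleftrightarrow>
    (\<forall>x\<in>set E. snd x \<subseteq> {1..n} \<and> cell x \<subseteq> U) \<and> (\<forall>m\<in>U. \<exists>!i. i < length E \<and> m \<in> cell (E ! i))"

lemma ex1_unique: "\<exists>!x. P x \<Longrightarrow> P x \<Longrightarrow> P y \<Longrightarrow> x = y"
  by blast

text \<open>
  The common shape of a monomial ideal and of its quotient: the monomials in \<open>U\<close> give a basis
  via \<open>c\<close>, and a product of monomials that leaves \<open>U\<close> becomes zero. For an ideal nothing is ever
  killed, and for a quotient \<open>c\<close> forms residue classes.
\<close>

locale monomial_module =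
  fixes n :: nat and U :: "expo set" and c :: "'k::field mpoly \<Rightarrow> 'm"
    and M :: "('k mpoly, 'm) module" and gr :: "(nat \<Rightarrow> int) \<Rightarrow> 'm set"
  assumes U_mons: "U \<subseteq> mons {1..n}"
    and inj: "inj_on c (mspan U)"
    and carr: "carrier M = c ` mspan U"
    and zero: "\<zero>\<^bsub>M\<^esub> = c 0"
    and add: "p \<in> mspan U \<Longrightarrow> q \<in> mspan U \<Longrightarrow> c p \<oplus>\<^bsub>M\<^esub> c q = c (p + q)"
    and smult: "p \<in> polys {1..n} \<Longrightarrow> q \<in> mspan U \<Longrightarrow> p \<odot>\<^bsub>M\<^esub> c q = c (restr U (p * q))"
    and comp: "g \<in> degrees n \<Longrightarrow> gr g = c ` (mspan U \<inter> poly_component n g)"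
begin

lemma abelian_monoid_M: "abelian_monoid M"
  by (rule abelian_monoidI) (auto simp: carr zero add ac_simps mspan_add)

lemma finsum_c:
  assumes "finite A" "\<And>i. i \<in> A \<Longrightarrow> f i \<in> mspan U"
  shows "(\<Oplus>\<^bsub>M\<^esub>i\<in>A. c (f i)) = c (sum f A)"
proof -
  interpret abelian_monoid M by (rule abelian_monoid_M)
  show ?thesis
    using assms
  proof (induction A rule: finite_induct)
    case empty
    then show ?case by (simp add: zero)
  next
    case (insert x A)
    then have "(\<Oplus>\<^bsub>M\<^esub>i\<in>insert x A. c (f i)) = c (f x) \<oplus>\<^bsub>M\<^esub> (\<Oplus>\<^bsub>M\<^esub>i\<in>A. c (f i))"
      by (intro finsum_insert) (auto simp: carr)
    then show ?case
      using insert by (simp add: add mspan_sum)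
  qed
qed

lemma finsum_c':
  assumes "finite A" "\<And>i. i \<in> A \<Longrightarrow> h i \<in> mspan U" "\<And>i. i \<in> A \<Longrightarrow> f i = c (h i)"
  shows "(\<Oplus>\<^bsub>M\<^esub>i\<in>A. f i) = c (sum h A)"
proof -
  interpret abelian_monoid M by (rule abelian_monoid_M)
  have "(\<Oplus>\<^bsub>M\<^esub>i\<in>A. f i) = (\<Oplus>\<^bsub>M\<^esub>i\<in>A. c (h i))"
    using assms by (intro finsum_cong') (auto simp: carr)
  then show ?thesis using finsum_c[OF assms(1,2)] by simp
qed

text \<open>
  Comparing coefficients of a single monomial: an \<open>x\<^sup>m\<close> that no \<open>V i\<close> contains has no
  representation, and one that two of them contain has two.
\<close>

lemma direct_sum_iff:
  fixes r :: nat
  assumes V: "\<And>i. i < r \<Longrightarrow> V i \<subseteq> U"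
  shows "(\<forall>v\<in>carrier M. \<exists>!f. f \<in> (\<Pi>\<^sub>E i\<in>{..<r}. c ` mspan (V i)) \<and> v = (\<Oplus>\<^bsub>M\<^esub>i\<in>{..<r}. f i)) \<longleftrightarrow>
    (\<forall>m\<in>U. \<exists>!i. i < r \<and> m \<in> V i)"
proof (intro iffI ballI)
  fix m
  assume *: "\<forall>v\<in>carrier M. \<exists>!f. f \<in> (\<Pi>\<^sub>E i\<in>{..<r}. c ` mspan (V i)) \<and>
      v = (\<Oplus>\<^bsub>M\<^esub>i\<in>{..<r}. f i)" and m: "m \<in> U"
  let ?v = "c (single m 1)"
  have v: "?v \<in> carrier M"
    unfolding carr using m by (intro imageI mspan_single)
  have "\<exists>i<r. m \<in> V i"
  proof -
    obtain f where f: "f \<in> (\<Pi>\<^sub>E i\<in>{..<r}. c ` mspan (V i))" "?v = (\<Oplus>\<^bsub>M\<^esub>i\<in>{..<r}. f i)"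
      using bspec[OF * v] by (elim ex1E conjE)
    have "\<forall>i\<in>{..<r}. \<exists>h. h \<in> mspan (V i) \<and> f i = c h"
      using f(1) by (auto simp: PiE_iff)
    then obtain h where h: "\<And>i. i < r \<Longrightarrow> h i \<in> mspan (V i)" "\<And>i. i < r \<Longrightarrow> f i = c (h i)"
      by (metis lessThan_iff)
    have hU: "h i \<in> mspan U" if "i < r" for i
      using h(1)[OF that] mspan_mono[OF V[OF that]] by auto
    have "?v = c (sum h {..<r})"
      using finsum_c'[OF finite_lessThan, of r h f] hU h(2) f(2) by auto
    then have "single m 1 = sum h {..<r}"
      using inj m hU by (auto simp: inj_on_def intro: mspan_single mspan_sum)
    then have "(\<Sum>i<r. lookup (h i) m) \<noteq> 0"
      using lookup_sum[of h "{..<r}" m] by (metis lookup_single_eq zero_neq_one)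
    then obtain i where "i < r" "lookup (h i) m \<noteq> 0"
      by (meson lessThan_iff sum.neutral)
    then show ?thesis
      using h(1)[of i] by (auto simp: mspan_def in_keys_iff)
  qed
  moreover have "i = j" if ij: "i < r" "m \<in> V i" "j < r" "m \<in> V j" for i j
  proof (rule ccontr)
    assume ne: "i \<noteq> j"
    \<comment> \<open>Two representations of the same element, with the monomial put at \<open>i\<close> or at
      \<open>j\<close>.\<close>
    define h where "h k l = (if l = k then single m 1 else (0 :: 'k mpoly))" for k l :: nat
    define F where "F k = (\<lambda>l\<in>{..<r}. c (h k l))" for k
    have sat: "F k \<in> (\<Pi>\<^sub>E i\<in>{..<r}. c ` mspan (V i)) \<and> ?v = (\<Oplus>\<^bsub>M\<^esub>i\<in>{..<r}. F k i)"
      if k: "k < r" "m \<in> V k" for k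
    proof
      show "F k \<in> (\<Pi>\<^sub>E i\<in>{..<r}. c ` mspan (V i))"
        using k by (auto simp: F_def h_def mspan_single)
      have "(\<Oplus>\<^bsub>M\<^esub>i\<in>{..<r}. F k i) = c (sum (h k) {..<r})"
        by (rule finsum_c') (auto simp: F_def h_def m mspan_single)
      also have "sum (h k) {..<r} = single m 1"
        using k by (simp add: h_def)
      finally show "?v = (\<Oplus>\<^bsub>M\<^esub>i\<in>{..<r}. F k i)" ..
    qed
    have "F i = F j"
      by (rule ex1_unique[OF bspec[OF * v], OF sat[OF ij(1,2)] sat[OF ij(3,4)]])
    then have "F i i = F j i" by simp
    then have "?v = c 0"
      using ij ne by (simp add: F_def h_def)
    then have "single m 1 = (0 :: 'k mpoly)"
      by (rule inj_onD[OF inj]) (use m in \<open>simp_all add: mspan_single\<close>)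
    then show False
      by (metis lookup_single_eq lookup_zero zero_neq_one)
  qed
  ultimately show "\<exists>!i. i < r \<and> m \<in> V i" by blast
next
  fix v
  assume *: "\<forall>m\<in>U. \<exists>!i. i < r \<and> m \<in> V i" and v: "v \<in> carrier M"
  then obtain q where q: "q \<in> mspan U" "v = c q" by (auto simp: carr)
  have other: "m \<notin> V j" if "i < r" "m \<in> V i" "j < r" "j \<noteq> i" for i j m
    using * V that by blast
  show "\<exists>!f. f \<in> (\<Pi>\<^sub>E i\<in>{..<r}. c ` mspan (V i)) \<and> v = (\<Oplus>\<^bsub>M\<^esub>i\<in>{..<r}. f i)"
  proof (rule ex1I[of _ "\<lambda>i\<in>{..<r}. c (restr (V i) q)"], intro conjI)
    show "(\<lambda>i\<in>{..<r}. c (restr (V i) q)) \<in> (\<Pi>\<^sub>E i\<in>{..<r}. c ` mspan (V i))"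
      by (auto simp: restr_in_mspan)
    have "(\<Oplus>\<^bsub>M\<^esub>i\<in>{..<r}. (\<lambda>i\<in>{..<r}. c (restr (V i) q)) i) = c (\<Sum>i<r. restr (V i) q)"
      by (rule finsum_c') (auto intro: subsetD[OF mspan_mono[OF V] restr_in_mspan])
    also have "(\<Sum>i<r. restr (V i) q) = q"
    proof (rule poly_mapping_eqI)
      fix m
      show "lookup (\<Sum>i<r. restr (V i) q) m = lookup q m"
      proof (cases "m \<in> U")
        case True
        then obtain i where i: "i < r" "m \<in> V i" using * by blast
        have "lookup (\<Sum>i<r. restr (V i) q) m = (\<Sum>j<r. if j = i then lookup q m else 0)"
          unfolding lookup_sum lookup_restr
          by (rule sum.cong) (use other[OF i] i in auto)
        then show ?thesis using i by simp
      next
        case False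
        then have "lookup q m = 0" using q(1) by (auto simp: mspan_def in_keys_iff)
        then show ?thesis by (auto simp: lookup_sum lookup_restr intro!: sum.neutral)
      qed
    qed
    finally show "v = (\<Oplus>\<^bsub>M\<^esub>i\<in>{..<r}. (\<lambda>i\<in>{..<r}. c (restr (V i) q)) i)"
      using q by simp
  next
    fix f
    assume f: "f \<in> (\<Pi>\<^sub>E i\<in>{..<r}. c ` mspan (V i)) \<and> v = (\<Oplus>\<^bsub>M\<^esub>i\<in>{..<r}. f i)"
    then have "\<forall>i\<in>{..<r}. \<exists>h. h \<in> mspan (V i) \<and> f i = c h"
      by (auto simp: PiE_iff)
    then obtain h where h: "\<And>i. i < r \<Longrightarrow> h i \<in> mspan (V i)" "\<And>i. i < r \<Longrightarrow> f i = c (h i)"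
      by (metis lessThan_iff)
    have hU: "h i \<in> mspan U" if "i < r" for i
      using h(1)[OF that] mspan_mono[OF V[OF that]] by auto
    have "v = c (sum h {..<r})"
      using finsum_c'[OF finite_lessThan, of r h f] hU h(2) f by auto
    then have qh: "q = sum h {..<r}"
      using inj q hU by (auto simp: inj_on_def intro: mspan_sum)
    have "restr (V i) q = h i" if i: "i < r" for i
    proof (rule poly_mapping_eqI)
      fix m
      show "lookup (restr (V i) q) m = lookup (h i) m"
      proof (cases "m \<in> V i")
        case True
        have "lookup q m = (\<Sum>j<r. if j = i then lookup (h i) m else 0)"
          unfolding qh lookup_sum
        proof (rule sum.cong)
          fix j assume "j \<in> {..<r}"
          then show "lookup (h j) m = (if j = i then lookup (h i) m else 0)"
            using other[OF i True, of j] h(1)[of j] by (auto simp: mspan_def in_keys_iff)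
        qed simp
        then show ?thesis using True i by (simp add: lookup_restr)
      next
        case False
        then show ?thesis
          using h(1)[OF i] by (auto simp: lookup_restr mspan_def in_keys_iff)
      qed
    qed
    then show "f = (\<lambda>i\<in>{..<r}. c (restr (V i) q))"
      using f h(2) by (intro ext) (auto simp: PiE_iff extensional_def)
  qed
qed

text \<open>
  Multiplication by \<open>x\<^sup>e\<close> is a bijection from the monomials of \<open>K[Z]\<close> to the cell, and the cell
  stays inside \<open>U\<close>, so nothing is killed.
\<close>

lemma stanley_space_eq:
  assumes "l \<noteq> 0" "Z \<subseteq> {1..n}" "cell (e, Z) \<subseteq> U"
  shows "stanley_space M (c (single e l), Z) = c ` mspan (cell (e, Z))"
proof -
  have e: "e \<in> U"
    using assms(3) image_eqI[of e "(+) e" 0 "mons Z"] by (auto simp: cell_def)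
  have act: "u \<odot>\<^bsub>M\<^esub> c (single e l) = c (single e l * u)"
    and mem: "single e l * u \<in> mspan (cell (e, Z))" if u: "u \<in> polys Z" for u
  proof -
    show *: "single e l * u \<in> mspan (cell (e, Z))"
      using u assms(1) by (auto simp: mspan_def cell_def keys_single_times polys_eq_mspan)
    have "u \<in> polys {1..n}"
      using u polys_mono[OF assms(2)] by auto
    then have "u \<odot>\<^bsub>M\<^esub> c (single e l) = c (restr U (single e l * u))"
      using smult[of u "single e l"] mspan_single[OF e, of l] by (simp add: mult.commute)
    then show "u \<odot>\<^bsub>M\<^esub> c (single e l) = c (single e l * u)"
      using * mspan_mono[OF assms(3)] restr_id by (metis subsetD)
  qed
  have surj: "\<exists>u\<in>polys Z. q = single e l * u" if q: "q \<in> mspan (cell (e, Z))" for q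
  proof
    let ?u = "\<Sum>m\<in>keys q. single (m - e) (lookup q m / l)"
    have k: "\<exists>t\<in>mons Z. m = e + t" if "m \<in> keys q" for m
      using q that by (auto simp: mspan_def cell_def)
    show "?u \<in> polys Z"
      unfolding polys_eq_mspan
    proof (intro mspan_sum mspan_single)
      fix m assume "m \<in> keys q"
      then obtain t where "t \<in> mons Z" "m = e + t" using k by auto
      then show "m - e \<in> mons Z" by simp
    qed
    have "single e l * ?u = (\<Sum>m\<in>keys q. single m (lookup q m))"
      unfolding sum_distrib_left mult_single
    proof (rule sum.cong)
      fix m assume "m \<in> keys q"
      then obtain t where "m = e + t" using k by auto
      then show "single (e + (m - e)) (l * (lookup q m / l)) = single m (lookup q m)"
        using assms(1) by simp
    qed simp
    then show "q = single e l * ?u"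
      using poly_eq_sum_monomials[of q] by simp
  qed
  show ?thesis
    unfolding stanley_space_def prod.case
  proof (intro equalityI subsetI)
    fix y assume "y \<in> (\<lambda>u. u \<odot>\<^bsub>M\<^esub> c (single e l)) ` polys Z"
    then show "y \<in> c ` mspan (cell (e, Z))" using act mem by auto
  next
    fix y assume "y \<in> c ` mspan (cell (e, Z))"
    then obtain q where "q \<in> mspan (cell (e, Z))" "y = c q" by auto
    then obtain u where "u \<in> polys Z" "y = c (single e l * u)" using surj by blast
    then show "y \<in> (\<lambda>u. u \<odot>\<^bsub>M\<^esub> c (single e l)) ` polys Z"
      using act by (intro image_eqI[of _ _ u]) simp_all
  qed
qed

text \<open>
  A homogeneous element of a degree has only one monomial available. If some \<open>x\<^sup>e x\<^sup>t\<close> with \<open>x\<^sup>t\<close>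
  in \<open>K[Z]\<close> left \<open>U\<close>, then \<open>x\<^sup>t\<close> would annihilate the generator, against freeness.
\<close>

lemma homogeneous_generator:
  assumes "m \<in> carrier M" "g \<in> degrees n" "m \<in> gr g" "Z \<subseteq> {1..n}"
    and free: "\<forall>u\<in>polys Z. u \<odot>\<^bsub>M\<^esub> m = \<zero>\<^bsub>M\<^esub> \<longrightarrow> u = 0"
  shows "\<exists>e l. m = c (single e l) \<and> l \<noteq> 0 \<and> cell (e, Z) \<subseteq> U"
proof -
  obtain q where q: "q \<in> mspan U" "q \<in> poly_component n g" "m = c q"
    using assms(2,3) comp by auto
  have "q \<noteq> 0"
  proof
    assume "q = 0"
    then have "1 \<odot>\<^bsub>M\<^esub> m = \<zero>\<^bsub>M\<^esub>"
      using smult[of 1 0] q(3) by (simp add: zero restr_def)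
    then show False using free by auto
  qed
  then obtain e where e: "e \<in> keys q"
    by (metis keys_eq_empty ex_in_conv)
  have "t = e" if "t \<in> keys q" for t
  proof (rule poly_mapping_eqI)
    fix i
    have "int (lookup t i) = g i" "int (lookup e i) = g i"
      using q(2) e that by (simp_all add: poly_component_def)
    then show "lookup t i = lookup e i" by simp
  qed
  then have "keys q = {e}" using e by blast
  have qs: "q = single e (lookup q e)"
  proof (rule poly_mapping_eqI)
    fix m
    show "lookup q m = lookup (single e (lookup q e)) m"
    proof (cases "m = e")
      case False
      then have "m \<notin> keys q" using \<open>keys q = {e}\<close> by simp
      then show ?thesis using False by (simp add: in_keys_iff lookup_single)
    qed simp
  qed
  have l: "lookup q e \<noteq> 0" using e by (simp add: in_keys_iff)
  have "e + t \<in> U" if t: "t \<in> mons Z" for t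
  proof (rule ccontr)
    assume not: "e + t \<notin> U"
    have u: "single t 1 \<in> polys Z"
      unfolding polys_eq_mspan by (rule mspan_single[OF t])
    then have "single t 1 \<in> polys {1..n}"
      using polys_mono[OF assms(4)] by auto
    then have "single t 1 \<odot>\<^bsub>M\<^esub> m = c (restr U (single t 1 * q))"
      using smult q by blast
    also have "single t 1 * q = single (e + t) (lookup q e)"
      by (subst qs) (simp add: mult_single add.commute)
    also have "restr U \<dots> = 0"
      by (rule restr_zero[of _ "{e + t}"]) (use not in \<open>auto intro: mspan_single\<close>)
    finally have "single t 1 = (0 :: 'k mpoly)"
      using free u zero by metis
    then show False
      by (metis lookup_single_eq lookup_zero zero_neq_one)
  qed
  then have "cell (e, Z) \<subseteq> U" by (auto simp: cell_def)
  then show ?thesis using qs l q(3) by metis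
qed

lemma stanley_decomposition_of_partition:
  assumes "stanley_partition n U E"
  shows "stanley_decomposition n M gr (map (\<lambda>(e, Z). (c (single e 1), Z)) E)"
    (is "stanley_decomposition n M gr ?D")
proof -
  have E: "snd x \<subseteq> {1..n}" "cell x \<subseteq> U" if "x \<in> set E" for x
    using assms that by (auto simp: stanley_partition_def)
  have gen: "c (single e 1) \<in> carrier M \<and> (\<exists>g\<in>degrees n. c (single e 1) \<in> gr g) \<and> Z \<subseteq> {1..n} \<and>
      (\<forall>u\<in>polys Z. u \<odot>\<^bsub>M\<^esub> c (single e 1) = \<zero>\<^bsub>M\<^esub> \<longrightarrow> u = 0)" if x: "(e, Z) \<in> set E" for e Z
  proof (intro conjI ballI impI)
    have e: "e \<in> U"
      using E(2)[OF x] image_eqI[of e "(+) e" 0 "mons Z"] by (auto simp: cell_def)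
    then have es: "single e (1::'k) \<in> mspan U" by (rule mspan_single)
    then show "c (single e 1) \<in> carrier M" unfolding carr by (rule imageI)
    show Z: "Z \<subseteq> {1..n}" using E(1)[OF x] by simp
    have em: "e \<in> mons {1..n}" using e U_mons by auto
    let ?g = "\<lambda>i. int (lookup e i)"
    have g: "?g \<in> degrees n"
      using em by (auto simp: degrees_def mons_def in_keys_iff subset_eq)
    moreover have "single e (1::'k) \<in> poly_component n ?g"
      using em by (auto simp: poly_component_def polys_eq_mspan intro: mspan_single)
    ultimately show "\<exists>g\<in>degrees n. c (single e 1) \<in> gr g"
      using comp es by (intro bexI[of _ ?g]) auto
    fix u assume u: "u \<in> polys Z" and z: "u \<odot>\<^bsub>M\<^esub> c (single e 1) = \<zero>\<^bsub>M\<^esub>"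
    have "u \<in> polys {1..n}" using u polys_mono[OF Z] by auto
    moreover have "u * single e (1::'k) \<in> mspan U"
      using E(2)[OF x] u
      by (auto simp: mult.commute[of u] mspan_def cell_def keys_single_times polys_eq_mspan)
    ultimately have "c (u * single e 1) = c 0"
      using smult[of u "single e 1"] es z by (simp add: restr_id zero)
    then have "u * single e 1 = 0"
      by (rule inj_onD[OF inj]) (use \<open>u * single e 1 \<in> mspan U\<close> in simp_all)
    then have "keys (single e 1 * u) = {}" by (simp add: mult.commute)
    then show "u = 0" by (simp add: keys_single_times)
  qed
  have sp: "stanley_space M (?D ! i) = c ` mspan (cell (E ! i))" if "i < length E" for i
    using that E[of "E ! i"] stanley_space_eq[of 1 "snd (E ! i)" "fst (E ! i)"]
    by (simp add: case_prod_beta)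
  have "(\<forall>v\<in>carrier M. \<exists>!f. f \<in> (\<Pi>\<^sub>E i\<in>{..<length E}. c ` mspan (cell (E ! i))) \<and>
      v = (\<Oplus>\<^bsub>M\<^esub>i\<in>{..<length E}. f i))"
    using assms E(2) by (intro iffD2[OF direct_sum_iff]) (simp_all add: stanley_partition_def)
  moreover have "(\<Pi>\<^sub>E i\<in>{..<length ?D}. stanley_space M (?D ! i)) =
      (\<Pi>\<^sub>E i\<in>{..<length E}. c ` mspan (cell (E ! i)))"
    unfolding length_map by (rule PiE_cong) (use sp in simp)
  moreover have "\<forall>(m, Z)\<in>set ?D. m \<in> carrier M \<and> (\<exists>g\<in>degrees n. m \<in> gr g) \<and> Z \<subseteq> {1..n} \<and>
      (\<forall>u\<in>polys Z. u \<odot>\<^bsub>M\<^esub> m = \<zero>\<^bsub>M\<^esub> \<longrightarrow> u = 0)"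
  proof
    fix y assume "y \<in> set ?D"
    then obtain x where x': "x \<in> set E" "y = (case x of (e, Z) \<Rightarrow> (c (single e 1), Z))"
      unfolding set_map by (rule imageE)
    obtain e Z where "x = (e, Z)" by (cases x)
    with x' have x: "(e, Z) \<in> set E" and y: "y = (c (single e 1), Z)" by simp_all
    show "case y of (m, Z) \<Rightarrow> m \<in> carrier M \<and> (\<exists>g\<in>degrees n. m \<in> gr g) \<and> Z \<subseteq> {1..n} \<and>
        (\<forall>u\<in>polys Z. u \<odot>\<^bsub>M\<^esub> m = \<zero>\<^bsub>M\<^esub> \<longrightarrow> u = 0)"
      unfolding y prod.case by (rule gen[OF x])
  qed
  ultimately show ?thesis
    unfolding stanley_decomposition_def by (simp only: length_map)
qed

lemma partition_of_stanley_decomposition: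
  assumes "stanley_decomposition n M gr D"
  shows "\<exists>E. stanley_partition n U E \<and> map snd E = map snd D"
proof -
  have D: "m \<in> carrier M" "\<exists>g\<in>degrees n. m \<in> gr g" "Z \<subseteq> {1..n}"
      "\<forall>u\<in>polys Z. u \<odot>\<^bsub>M\<^esub> m = \<zero>\<^bsub>M\<^esub> \<longrightarrow> u = 0" if "(m, Z) \<in> set D" for m Z
    using assms that by (auto simp: stanley_decomposition_def)
  have "\<forall>x\<in>set D. \<exists>e l. fst x = c (single e l) \<and> l \<noteq> 0 \<and> cell (e, snd x) \<subseteq> U"
  proof
    fix x assume "x \<in> set D"
    then have x: "(fst x, snd x) \<in> set D" by simp
    obtain g where "g \<in> degrees n" "fst x \<in> gr g" using D(2)[OF x] by auto
    then show "\<exists>e l. fst x = c (single e l) \<and> l \<noteq> 0 \<and> cell (e, snd x) \<subseteq> U"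
      using homogeneous_generator[OF D(1)[OF x] _ _ D(3)[OF x] D(4)[OF x]] by simp
  qed
  then obtain e l where el: "\<And>x. x \<in> set D \<Longrightarrow> fst x = c (single (e x) (l x))"
      "\<And>x. x \<in> set D \<Longrightarrow> l x \<noteq> 0" "\<And>x. x \<in> set D \<Longrightarrow> cell (e x, snd x) \<subseteq> U"
    by metis
  let ?E = "map (\<lambda>x. (e x, snd x)) D"
  have sp: "stanley_space M (D ! i) = c ` mspan (cell (?E ! i))" if "i < length D" for i
  proof -
    have x: "D ! i \<in> set D" using that by simp
    have Z: "snd (D ! i) \<subseteq> {1..n}"
      using D(3)[of "fst (D ! i)" "snd (D ! i)"] x by simp
    have "stanley_space M (D ! i) =
        stanley_space M (c (single (e (D ! i)) (l (D ! i))), snd (D ! i))"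
      using el(1)[OF x] by (metis prod.collapse)
    also have "\<dots> = c ` mspan (cell (e (D ! i), snd (D ! i)))"
      by (rule stanley_space_eq[OF el(2)[OF x] Z el(3)[OF x]])
    finally show ?thesis using that by simp
  qed
  have "(\<Pi>\<^sub>E i\<in>{..<length D}. stanley_space M (D ! i)) =
      (\<Pi>\<^sub>E i\<in>{..<length D}. c ` mspan (cell (?E ! i)))"
    using sp by (intro PiE_cong) auto
  then have "(\<forall>v\<in>carrier M. \<exists>!f. f \<in> (\<Pi>\<^sub>E i\<in>{..<length D}. c ` mspan (cell (?E ! i))) \<and>
      v = (\<Oplus>\<^bsub>M\<^esub>i\<in>{..<length D}. f i))"
    using assms by (simp add: stanley_decomposition_def)
  moreover have "cell (?E ! i) \<subseteq> U" if "i < length D" for i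
    using el(3)[of "D ! i"] that by simp
  ultimately have "\<forall>m\<in>U. \<exists>!i. i < length D \<and> m \<in> cell (?E ! i)"
    by (intro iffD1[OF direct_sum_iff]) simp_all
  then have "stanley_partition n U ?E"
    using el(3) D(3)[of "fst x" "snd x" for x] unfolding stanley_partition_def by force
  then show ?thesis by (intro exI[of _ ?E]) auto
qed

theorem sdepth_eqI:
  assumes "U \<noteq> {}"
    and "\<exists>E. stanley_partition n U E \<and> (\<forall>x\<in>set E. d \<le> card (snd x))"
    and "\<And>E. stanley_partition n U E \<Longrightarrow> \<exists>x\<in>set E. card (snd x) \<le> d"
  shows "sdepth n M gr = d"
proof -
  let ?S = "{sdepth_of_decomposition D | D. stanley_decomposition n M gr D}"
  have le: "sdepth_of_decomposition D \<le> d" if D: "stanley_decomposition n M gr D" for D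
  proof -
    obtain E where E: "stanley_partition n U E" "map snd E = map snd D"
      using partition_of_stanley_decomposition[OF D] by auto
    obtain x where "x \<in> set E" "card (snd x) \<le> d" using assms(3)[OF E(1)] by auto
    moreover have "snd x \<in> snd ` set D"
      using \<open>x \<in> set E\<close> E(2) by (metis imageI set_map)
    ultimately obtain y where y: "y \<in> set D" "card (snd y) \<le> d" by auto
    then have "Min ((\<lambda>(m, Z). card Z) ` set D) \<le> card (snd y)"
      by (intro Min_le) (auto simp: case_prod_beta)
    then show ?thesis
      using y(2) by (simp add: sdepth_of_decomposition_def)
  qed
  obtain E where E: "stanley_partition n U E" "\<And>x. x \<in> set E \<Longrightarrow> d \<le> card (snd x)"
    using assms(2) by auto
  let ?D = "map (\<lambda>(e, Z). (c (single e 1), Z)) E"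
  have D: "stanley_decomposition n M gr ?D"
    by (rule stanley_decomposition_of_partition[OF E(1)])
  have "E \<noteq> []" using assms(1) E(1) by (auto simp: stanley_partition_def)
  then have "d \<le> sdepth_of_decomposition ?D"
    unfolding sdepth_of_decomposition_def
    by (subst Min_ge_iff) (use E(2) in \<open>auto simp: case_prod_beta\<close>)
  then have "sdepth_of_decomposition ?D = d"
    using le[OF D] by simp
  then have "d \<in> ?S" using D by blast
  moreover have "finite ?S"
    by (rule finite_subset[of _ "{..d}"]) (use le in auto)
  ultimately show ?thesis
    unfolding sdepth_def using le by (intro Max_eqI) auto
qed

end

section \<open>Refining a partition of divisibility patterns\<close>

text \<open>
  The divisibility pattern of a monomial: which of the generators \<open>\<Prod>j\<in>u k. x\<^sub>j\<close> divide it.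
\<close>

definition dividing :: "nat \<Rightarrow> (nat \<Rightarrow> nat set) \<Rightarrow> expo \<Rightarrow> nat set" where
  "dividing s u m = {k \<in> {1..s}. \<forall>j\<in>u k. lookup m j > 0}"

lemma mem_cell_ind:
  assumes "finite P" "P \<inter> J = {}" "P \<subseteq> {1..n}"
  shows "m \<in> cell (ind P, {1..n} - J) \<longleftrightarrow>
    m \<in> mons {1..n} \<and> (\<forall>j\<in>P. lookup m j > 0) \<and> (\<forall>j\<in>J. lookup m j = 0)"
proof
  assume "m \<in> cell (ind P, {1..n} - J)"
  then obtain t where t: "t \<in> mons ({1..n} - J)" "m = ind P + t" by (auto simp: cell_def)
  then show "m \<in> mons {1..n} \<and> (\<forall>j\<in>P. lookup m j > 0) \<and> (\<forall>j\<in>J. lookup m j = 0)"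
    using assms by (auto simp: lookup_add lookup_ind mons_iff)
next
  assume m: "m \<in> mons {1..n} \<and> (\<forall>j\<in>P. lookup m j > 0) \<and> (\<forall>j\<in>J. lookup m j = 0)"
  have "m = ind P + (m - ind P)"
    using m assms(1)
    by (intro poly_mapping_eqI) (auto simp: lookup_add lookup_minus lookup_ind Suc_le_eq)
  moreover have "m - ind P \<in> mons ({1..n} - J)"
    using m assms(1) by (auto simp: mons_iff lookup_minus lookup_ind split: if_splits)
  ultimately show "m \<in> cell (ind P, {1..n} - J)"
    unfolding cell_def by auto
qed

lemma partition_of_cell_set:
  assumes "finite C" "\<And>x. x \<in> C \<Longrightarrow> snd x \<subseteq> {1..n} \<and> cell x \<subseteq> U"
    and "\<And>m. m \<in> U \<Longrightarrow> \<exists>!x. x \<in> C \<and> m \<in> cell x"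
  shows "\<exists>E. stanley_partition n U E \<and> set E = C"
proof -
  obtain E where E: "set E = C" "distinct E"
    using finite_distinct_list[OF assms(1)] by auto
  have "\<exists>!i. i < length E \<and> m \<in> cell (E ! i)" if m: "m \<in> U" for m
  proof -
    obtain x where x: "x \<in> C" "m \<in> cell x" and uniq: "\<And>y. y \<in> C \<Longrightarrow> m \<in> cell y \<Longrightarrow> y = x"
      using assms(3)[OF m] by metis
    obtain i where i: "i < length E" "E ! i = x"
      using x(1) E(1) by (metis in_set_conv_nth)
    show ?thesis
    proof (rule ex1I[of _ i])
      show "i < length E \<and> m \<in> cell (E ! i)" using i x by simp
      fix j assume j: "j < length E \<and> m \<in> cell (E ! j)"
      then have "E ! j = x" using uniq[of "E ! j"] E(1) by (metis nth_mem)
      then show "j = i" using i j E(2) by (metis nth_eq_iff_index_eq)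
    qed
  qed
  then have "stanley_partition n U E"
    unfolding stanley_partition_def using assms(2) E(1) by simp
  then show ?thesis using E(1) by auto
qed

text \<open>
  The variables that must occur in a monomial with the data \<open>(A, N, f)\<close>: the generators in \<open>A\<close>
  divide it, and for \<open>k \<in> N\<close> the index \<open>f k\<close> is the first one of \<open>u k\<close> with exponent zero.
\<close>

definition branch_vars :: "(nat \<Rightarrow> nat set) \<Rightarrow> nat set \<times> nat set \<times> (nat \<Rightarrow> nat) \<Rightarrow> nat set" where
  "branch_vars u = (\<lambda>(A, N, f). (\<Union>k\<in>A. u k) \<union> (\<Union>k\<in>N. {j \<in> u k. j < f k}))"

text \<open>
  Only data without contradiction are kept: no variable may be required to occur and to be
  missing at the same time. Each of them then describes a nonempty cell.
\<close>

definition branch_index ::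
    "(nat \<Rightarrow> nat set) \<Rightarrow> (nat set \<times> nat set) set \<Rightarrow> (nat set \<times> nat set \<times> (nat \<Rightarrow> nat)) set" where
  "branch_index u F = {(A, N, f). (A, N) \<in> F \<and> f \<in> (\<Pi>\<^sub>E k\<in>N. u k) \<and>
     branch_vars u (A, N, f) \<inter> f ` N = {}}"

text \<open>
  A block \<open>(A, N)\<close> of divisibility patterns asks that the generators in \<open>A\<close> divide and those in
  \<open>N\<close> do not. Recording for each \<open>k \<in> N\<close> the first variable of \<open>u k\<close> that is missing splits the
  block into cells, and a cell loses only the directions of the recorded variables, at most
  \<open>card N\<close> of them.
\<close>

lemma exists_partition_of_pairs:
  fixes u :: "nat \<Rightarrow> nat set"
  assumes u: "\<And>k. k \<in> {1..s} \<Longrightarrow> u k \<subseteq> {1..n}"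
    and F: "finite F" "\<And>A N. (A, N) \<in> F \<Longrightarrow> A \<subseteq> {1..s} \<and> N \<subseteq> {1..s} \<and> card N \<le> r"
    and cover: "\<And>m. m \<in> U \<longleftrightarrow> m \<in> mons {1..n} \<and>
      (\<exists>(A, N)\<in>F. A \<subseteq> dividing s u m \<and> N \<inter> dividing s u m = {})"
    and disj: "\<And>m A N A' N'. m \<in> U \<Longrightarrow> (A, N) \<in> F \<Longrightarrow> (A', N') \<in> F \<Longrightarrow>
      A \<subseteq> dividing s u m \<Longrightarrow> N \<inter> dividing s u m = {} \<Longrightarrow>
      A' \<subseteq> dividing s u m \<Longrightarrow> N' \<inter> dividing s u m = {} \<Longrightarrow> (A, N) = (A', N')"
  shows "\<exists>E. stanley_partition n U E \<and> (\<forall>x\<in>set E. n - r \<le> card (snd x))"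
proof -
  let ?X = "branch_index u F"
  define g where "g = (\<lambda>(A, N, f :: nat \<Rightarrow> nat). (ind (branch_vars u (A, N, f)), {1..n} - f ` N))"
  have fu: "finite (u k)" if "k \<in> {1..s}" for k
    using u[OF that] finite_subset by blast
  have mem: "m \<in> cell (g (A, N, f)) \<longleftrightarrow> m \<in> mons {1..n} \<and> A \<subseteq> dividing s u m \<and>
      (\<forall>k\<in>N. lookup m (f k) = 0 \<and> (\<forall>j\<in>u k. j < f k \<longrightarrow> lookup m j > 0))"
    if x: "(A, N, f) \<in> ?X" for A N f m
  proof -
    have AN: "A \<subseteq> {1..s}" "N \<subseteq> {1..s}" using F(2) x by (auto simp: branch_index_def)
    have P: "branch_vars u (A, N, f) \<subseteq> {1..n}"
      using AN u unfolding branch_vars_def by blast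
    have "m \<in> cell (g (A, N, f)) \<longleftrightarrow> m \<in> mons {1..n} \<and>
        (\<forall>j\<in>branch_vars u (A, N, f). lookup m j > 0) \<and> (\<forall>j\<in>f ` N. lookup m j = 0)"
      unfolding g_def prod.case
      by (rule mem_cell_ind) (use P x finite_subset[OF P] in \<open>auto simp: branch_index_def\<close>)
    then show ?thesis
      using AN by (auto simp: branch_vars_def dividing_def subset_eq)
  qed
  have N_disj: "N \<inter> dividing s u m = {}" if "(A, N, f) \<in> ?X" "m \<in> cell (g (A, N, f))" for A N f m
  proof -
    have "f k \<in> u k" if "k \<in> N" for k
      using \<open>(A, N, f) \<in> ?X\<close> that by (auto simp: branch_index_def)
    moreover have "lookup m (f k) = 0" if "k \<in> N" for k
      using mem[OF \<open>(A, N, f) \<in> ?X\<close>] \<open>m \<in> cell (g (A, N, f))\<close> that by blast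
    ultimately have "k \<notin> dividing s u m" if "k \<in> N" for k
      using that unfolding dividing_def by fastforce
    then show ?thesis by blast
  qed
  have "finite ?X"
  proof (rule finite_subset)
    show "?X \<subseteq> (\<Union>x\<in>F. (\<lambda>f. (fst x, snd x, f)) ` (\<Pi>\<^sub>E k\<in>snd x. u k))"
      by (force simp: branch_index_def)
    have "finite (\<Pi>\<^sub>E k\<in>snd x. u k)" if "x \<in> F" for x
      using F(2)[of "fst x" "snd x"] that fu finite_subset[of "snd x" "{1..s}"]
      by (intro finite_PiE) auto
    then show "finite (\<Union>x\<in>F. (\<lambda>f. (fst x, snd x, f)) ` (\<Pi>\<^sub>E k\<in>snd x. u k))"
      using F(1) by auto
  qed
  have inU: "cell (g (A, N, f)) \<subseteq> U" if "(A, N, f) \<in> ?X" for A N f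
  proof
    fix m assume m: "m \<in> cell (g (A, N, f))"
    have "(A, N) \<in> F" using that by (simp add: branch_index_def)
    then show "m \<in> U"
      unfolding cover using iffD1[OF mem[OF that] m] N_disj[OF that m] by blast
  qed
  have "\<exists>E. stanley_partition n U E \<and> set E = g ` ?X"
  proof (rule partition_of_cell_set)
    show "finite (g ` ?X)" using \<open>finite ?X\<close> by simp
    show "snd y \<subseteq> {1..n} \<and> cell y \<subseteq> U" if "y \<in> g ` ?X" for y
      using that inU by (auto simp: g_def)
    fix m assume m: "m \<in> U"
    then obtain A N where AN: "m \<in> mons {1..n}" "(A, N) \<in> F" "A \<subseteq> dividing s u m"
        "N \<inter> dividing s u m = {}"
      using cover by blast
    have Ns: "N \<subseteq> {1..s}" using F(2)[OF AN(2)] by simp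
    \<comment> \<open>The only data whose cell can contain the monomial.\<close>
    define f where "f = (\<lambda>k\<in>N. LEAST j. j \<in> u k \<and> lookup m j = 0)"
    have f: "f k \<in> u k \<and> lookup m (f k) = 0" and
      f_least: "\<And>j. j \<in> u k \<Longrightarrow> j < f k \<Longrightarrow> lookup m j > 0" if k: "k \<in> N" for k
    proof -
      have "\<exists>j. j \<in> u k \<and> lookup m j = 0"
      proof -
        have "k \<notin> dividing s u m" "k \<in> {1..s}" using k AN(4) Ns by blast+
        then show ?thesis by (auto simp: dividing_def)
      qed
      from LeastI_ex[OF this] show "f k \<in> u k \<and> lookup m (f k) = 0"
        using k by (simp add: f_def)
      show "lookup m j > 0" if "j \<in> u k" "j < f k" for j
        using not_less_Least[of j "\<lambda>j. j \<in> u k \<and> lookup m j = 0"] that k by (auto simp: f_def)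
    qed
    have "branch_vars u (A, N, f) \<inter> f ` N = {}"
    proof -
      have "lookup m j > 0" if "j \<in> branch_vars u (A, N, f)" for j
        using that AN(3) f_least by (auto simp: branch_vars_def dividing_def)
      moreover have "lookup m j = 0" if "j \<in> f ` N" for j
        using that f by auto
      ultimately show ?thesis by fastforce
    qed
    then have x: "(A, N, f) \<in> ?X"
      using AN(2) f by (auto simp: branch_index_def f_def)
    show "\<exists>!y. y \<in> g ` ?X \<and> m \<in> cell y"
    proof (rule ex1I[of _ "g (A, N, f)"], intro conjI)
      show "g (A, N, f) \<in> g ` ?X" using x by (rule imageI)
      show "m \<in> cell (g (A, N, f))" using mem[OF x] AN f f_least by auto
      fix y assume "y \<in> g ` ?X \<and> m \<in> cell y"
      then obtain A' N' f' where x': "(A', N', f') \<in> ?X" and y: "y = g (A', N', f')"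
        and m': "m \<in> cell (g (A', N', f'))" by auto
      have "(A', N') \<in> F" using x' by (simp add: branch_index_def)
      then have eq: "A' = A" "N' = N"
        using disj[OF m _ AN(2) _ _ AN(3,4), of A' N'] mem[OF x'] m' N_disj[OF x' m'] by auto
      have "f' = f"
      proof
        fix k
        show "f' k = f k"
        proof (cases "k \<in> N")
          case True
          have "f' k \<in> u k" "lookup m (f' k) = 0" "\<And>j. j \<in> u k \<Longrightarrow> j < f' k \<Longrightarrow> lookup m j > 0"
            using x' mem[OF x', of m] m' True eq by (auto simp: branch_index_def)
          then show ?thesis
            using f[OF True] f_least[OF True] by (metis less_irrefl linorder_neqE_nat)
        next
          case False
          then show ?thesis using x x' eq by (auto simp: branch_index_def PiE_iff extensional_def)
        qed
      qed
      then show "y = g (A, N, f)" using y eq by simp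
    qed
  qed
  then obtain E where E: "stanley_partition n U E" "set E = g ` ?X" by auto
  have "n - r \<le> card (snd x)" if xE: "x \<in> set E" for x
  proof -
    obtain y where "y \<in> ?X" "x = g y" using xE unfolding E(2) by (elim imageE)
    then obtain A N f where x: "(A, N, f) \<in> ?X" "x = g (A, N, f)" by (cases y) auto
    have N: "N \<subseteq> {1..s}" "card N \<le> r" using F(2) x(1) by (auto simp: branch_index_def)
    have "finite N" using N(1) finite_subset by blast
    have "card (f ` N) \<le> r"
      using card_image_le[OF \<open>finite N\<close>, of f] N(2) by simp
    moreover have "card {1..n} - card (f ` N) \<le> card ({1..n} - f ` N)"
      using \<open>finite N\<close> by (intro diff_card_le_card_Diff) simp
    ultimately show ?thesis using x(2) by (simp add: g_def)
  qed
  then show ?thesis using E(1) by auto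
qed

section \<open>Interval partitions of the nonempty subsets of a finite set\<close>

text \<open>
  The clockwise successor on the cycle \<open>1, \<dots>, n\<close>.
\<close>

definition nxt :: "nat \<Rightarrow> nat \<Rightarrow> nat" where
  "nxt n p = (if p = n then 1 else Suc p)"

definition cyclic_dist :: "nat \<Rightarrow> nat set \<Rightarrow> nat \<Rightarrow> nat" where
  "cyclic_dist n X p = (LEAST d. (nxt n ^^ d) p \<in> X)"

text \<open>
  A matching of the cycle, encoded by the heads \<open>nxt n p\<close> of its edges \<open>p, nxt n p\<close>: the edges are
  disjoint if no head is the tail of another edge.
\<close>

definition matching :: "nat \<Rightarrow> nat set \<Rightarrow> bool" where
  "matching n R \<longleftrightarrow> R \<subseteq> {1..n} \<and> (\<forall>p\<in>R. nxt n p \<notin> R)"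

definition unmatched :: "nat \<Rightarrow> nat set \<Rightarrow> nat set" where
  "unmatched n R = {p \<in> {1..n}. p \<notin> R \<and> nxt n p \<notin> R}"

lemma nxt_in: "p \<in> {1..n} \<Longrightarrow> nxt n p \<in> {1..n}"
  by (auto simp: nxt_def)

lemma funpow_nxt: "p + d \<le> n \<Longrightarrow> (nxt n ^^ d) p = p + d"
  by (induction d) (auto simp: nxt_def)

lemma reach:
  assumes "x \<in> {1..n}" "p \<in> {1..n}"
  shows "\<exists>d. (nxt n ^^ d) p = x"
proof (cases "p \<le> x")
  case True
  then have "(nxt n ^^ (x - p)) p = x"
    using funpow_nxt[of p "x - p" n] assms by simp
  then show ?thesis ..
next
  case False
  have "(nxt n ^^ (n - p)) p = n"
    using funpow_nxt[of p "n - p" n] assms by simp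
  then have "(nxt n ^^ Suc (n - p)) p = 1"
    by (simp add: nxt_def)
  moreover have "(nxt n ^^ (x - 1)) 1 = x"
    using funpow_nxt[of 1 "x - 1" n] assms by simp
  ultimately have "(nxt n ^^ ((x - 1) + Suc (n - p))) p = x"
    by (simp only: funpow_add o_apply)
  then show ?thesis ..
qed

lemma cyclic_dist_eq:
  assumes "X \<subseteq> {1..n}" "X \<noteq> {}" "p \<in> {1..n}"
  shows "cyclic_dist n X p = (if p \<in> X then 0 else Suc (cyclic_dist n X (nxt n p)))"
proof (cases "p \<in> X")
  case True
  then show ?thesis by (simp add: cyclic_dist_def)
next
  case False
  obtain d where d: "(nxt n ^^ d) p \<in> X"
    using reach[of _ n p] assms by blast
  have "cyclic_dist n X p = Suc (LEAST d. (nxt n ^^ Suc d) p \<in> X)"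
    unfolding cyclic_dist_def
    by (rule Least_Suc[where P = "\<lambda>d. (nxt n ^^ d) p \<in> X", OF d]) (simp add: False)
  then show ?thesis
    using False by (simp add: cyclic_dist_def funpow_Suc_right del: funpow.simps)
qed

text \<open>
  A point outside \<open>X\<close> is not unmatched, hence a head or a tail, and it is a tail exactly if its
  successor is a head. Points of \<open>X\<close> are not heads. So walking clockwise to the next point of
  \<open>X\<close>, heads and tails alternate, and the distance to that point decides by its parity.
\<close>

lemma matching_unique:
  assumes "matching n R" "unmatched n R \<subseteq> X" "R \<inter> X = {}" "X \<subseteq> {1..n}" "X \<noteq> {}"
  shows "R = {p \<in> {1..n}. odd (cyclic_dist n X p)}"
proof -
  have "p \<in> R \<longleftrightarrow> odd (cyclic_dist n X p)" if "p \<in> {1..n}" for p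
    using that
  proof (induction "cyclic_dist n X p" arbitrary: p)
    case 0
    then have "p \<in> X" using cyclic_dist_eq[OF assms(4,5), of p] by (auto split: if_splits)
    then show ?case using assms(3) 0 by auto
  next
    case (Suc d)
    then have p: "p \<notin> X" "d = cyclic_dist n X (nxt n p)"
      using cyclic_dist_eq[OF assms(4,5), of p] by (auto split: if_splits)
    then have "nxt n p \<in> R \<longleftrightarrow> odd d"
      using Suc.hyps(1)[of "nxt n p"] nxt_in[OF Suc.prems] by simp
    moreover have "p \<in> R \<longleftrightarrow> nxt n p \<notin> R"
      using assms(1,2) p(1) Suc.prems unfolding matching_def unmatched_def by blast
    ultimately show ?case using Suc.hyps(2) by (metis even_Suc)
  qed
  then show ?thesis using assms(1) unfolding matching_def by blast
qed

text \<open>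
  The heads prescribed by parity of the distance to \<open>X\<close> do form a matching: a point at odd
  distance is not in \<open>X\<close>, and its successor has even distance.
\<close>

lemma matching_exists:
  assumes "X \<subseteq> {1..n}" "X \<noteq> {}"
  shows "\<exists>R. matching n R \<and> unmatched n R \<subseteq> X \<and> R \<inter> X = {}"
proof -
  let ?D = "cyclic_dist n X"
  let ?R = "{p \<in> {1..n}. odd (?D p)}"
  note D = cyclic_dist_eq[OF assms]
  have "matching n ?R"
    unfolding matching_def using D by (auto split: if_splits)
  moreover have "p \<in> X" if p: "p \<in> unmatched n ?R" for p
  proof (rule ccontr)
    assume "p \<notin> X"
    then show False
      using p D[of p] nxt_in[of p n] unfolding unmatched_def by auto
  qed
  moreover have "?R \<inter> X = {}"
    using D by (auto split: if_splits)
  ultimately show ?thesis by blast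
qed

text \<open>
  Every edge covers two points of the cycle. On a cycle of odd length this leaves at least one
  point unmatched.
\<close>

lemma card_matching:
  assumes "matching n R"
  shows "n = 2 * card R + card (unmatched n R)"
proof -
  let ?L = "{p \<in> {1..n}. nxt n p \<in> R}"
  have R: "R \<subseteq> {1..n}" using assms by (simp add: matching_def)
  have "bij_betw (nxt n) ?L R"
    unfolding bij_betw_def
  proof
    show "inj_on (nxt n) ?L" by (auto simp: inj_on_def nxt_def split: if_splits)
    show "nxt n ` ?L = R"
    proof
      show "R \<subseteq> nxt n ` ?L"
      proof
        fix p assume p: "p \<in> R"
        show "p \<in> nxt n ` ?L"
        proof (cases "p = 1")
          case True
          then show ?thesis using p R by (intro image_eqI[of _ _ n]) (auto simp: nxt_def)
        next
          case False
          then have "p \<in> {2..n}" using p R by (auto dest!: subsetD)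
          then show ?thesis
            using p by (intro image_eqI[of _ _ "p - 1"]) (auto simp: nxt_def)
        qed
      qed
    qed auto
  qed
  then have "card ?L = card R" by (rule bij_betw_same_card)
  moreover have U: "{1..n} = R \<union> ?L \<union> unmatched n R"
    using R by (auto simp: unmatched_def)
  moreover have "card (R \<union> ?L \<union> unmatched n R) = card R + card ?L + card (unmatched n R)"
  proof -
    have "finite R" using finite_subset[OF R] by simp
    moreover have "R \<inter> ?L = {}" using assms by (auto simp: matching_def)
    moreover have "(R \<union> ?L) \<inter> unmatched n R = {}" by (auto simp: unmatched_def)
    moreover have "finite (unmatched n R)" by (simp add: unmatched_def)
    ultimately show ?thesis by (simp add: card_Un_disjoint)
  qed
  moreover have "card {1..n} = card (R \<union> ?L \<union> unmatched n R)" by (rule arg_cong[OF U])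
  ultimately have "card {1..n} = 2 * card R + card (unmatched n R)" by linarith
  then show ?thesis by simp
qed

text \<open>
  On a cycle of odd length \<open>n\<close>, matchings with heads \<open>R\<close> and unmatched points \<open>A\<close> correspond to
  blocks \<open>{X. A \<subseteq> X, X \<inter> R = {}}\<close>, and each nonempty \<open>X\<close> lies in exactly one of them by
  \<open>matching_exists\<close> and \<open>matching_unique\<close>. Since \<open>A\<close> is never empty, the empty set is in none,
  and \<open>card R\<close> is at most \<open>n div 2\<close>. For even \<open>s\<close> a cycle with one additional point is used, and
  \<open>X\<close> ranges over the sets avoiding that point.
\<close>

theorem interval_partition:
  "\<exists>F. finite F \<and>
    (\<forall>(A, N)\<in>F. A \<subseteq> {1..s} \<and> N \<subseteq> {1..s} \<and> A \<noteq> {} \<and> card N \<le> s div 2) \<and>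
    (\<forall>X. X \<subseteq> {1..s} \<longrightarrow> X \<noteq> {} \<longrightarrow> (\<exists>!x. x \<in> F \<and> fst x \<subseteq> X \<and> snd x \<inter> X = {}))"
proof -
  \<comment> \<open>The length of the cycle has to be odd.\<close>
  define n where "n = (if odd s then s else Suc s)"
  have n: "odd n" "s \<le> n" "n div 2 = s div 2" by (auto simp: n_def)
  let ?Rs = "{R. matching n R \<and> unmatched n R \<subseteq> {1..s}}"
  define g where "g R = (unmatched n R, R \<inter> {1..s})" for R
  have fin: "finite ?Rs"
    by (rule finite_subset[of _ "Pow {1..n}"]) (auto simp: matching_def)
  have props: "unmatched n R \<noteq> {} \<and> card (R \<inter> {1..s}) \<le> s div 2" if R: "R \<in> ?Rs" for R
  proof
    have c: "n = 2 * card R + card (unmatched n R)" using card_matching R by simp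
    show "unmatched n R \<noteq> {}"
    proof
      assume "unmatched n R = {}"
      with c n(1) show False by (metis card.empty add_0_right dvd_triv_left)
    qed
    have "finite R"
      using R finite_subset[of R "{1..n}"] by (simp add: matching_def)
    then have "card (R \<inter> {1..s}) \<le> card R"
      by (intro card_mono) auto
    then show "card (R \<inter> {1..s}) \<le> s div 2" using c n(3) by linarith
  qed
  have "\<exists>!x. x \<in> g ` ?Rs \<and> fst x \<subseteq> X \<and> snd x \<inter> X = {}" if X: "X \<subseteq> {1..s}" "X \<noteq> {}" for X
  proof -
    have Xn: "X \<subseteq> {1..n}" using X(1) n(2) by auto
    obtain R where R: "matching n R" "unmatched n R \<subseteq> X" "R \<inter> X = {}"
      using matching_exists[OF Xn X(2)] by auto
    show ?thesis
    proof (rule ex1I[of _ "g R"])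
      show "g R \<in> g ` ?Rs \<and> fst (g R) \<subseteq> X \<and> snd (g R) \<inter> X = {}"
        using R X(1) unfolding g_def by auto
      fix x assume x: "x \<in> g ` ?Rs \<and> fst x \<subseteq> X \<and> snd x \<inter> X = {}"
      then obtain R' where R': "R' \<in> ?Rs" "x = g R'" by auto
      have "R' \<inter> X = {}" using x R'(2) X(1) unfolding g_def by auto
      then have "R' = R"
        using matching_unique[of n R' X] matching_unique[OF R Xn X(2)] R' x Xn X(2)
        by (simp add: g_def)
      then show "x = g R" using R'(2) by simp
    qed
  qed
  moreover have "\<forall>(A, N)\<in>g ` ?Rs. A \<subseteq> {1..s} \<and> N \<subseteq> {1..s} \<and> A \<noteq> {} \<and> card N \<le> s div 2"
    using props by (auto simp: g_def)
  ultimately show ?thesis using fin by (intro exI[of _ "g ` ?Rs"]) blast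
qed

section \<open>Stanley depth when every generator has a private variable\<close>

lemma ring_mpoly_ring: "ring (mpoly_ring n :: 'k::field mpoly ring)"
  using cring_mpoly_ring cring.axioms(1) by blast

lemma coset_eq_iff:
  assumes "ideal I (mpoly_ring n)" "p \<in> polys {1..n}" "q \<in> polys {1..n}"
  shows "I +>\<^bsub>mpoly_ring n\<^esub> p = I +>\<^bsub>mpoly_ring n\<^esub> q \<longleftrightarrow> p - q \<in> I"
proof -
  interpret ring "mpoly_ring n" by (rule ring_mpoly_ring)
  have "p \<ominus>\<^bsub>mpoly_ring n\<^esub> q = p - q"
    using assms by (simp add: a_minus_def a_inv_mpoly_ring)
  then show ?thesis
    using quotient_eq_iff_same_a_r_cos[OF assms(1), of p q] assms(2,3) by simp
qed

lemma quot_module_simps: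
  assumes "ideal I (mpoly_ring n)"
  shows "carrier (quot_module (mpoly_ring n) I) = (\<lambda>p. I +>\<^bsub>mpoly_ring n\<^esub> p) ` polys {1..n}"
    and "\<zero>\<^bsub>quot_module (mpoly_ring n) I\<^esub> = I +>\<^bsub>mpoly_ring n\<^esub> 0"
    and "p \<in> polys {1..n} \<Longrightarrow> q \<in> polys {1..n} \<Longrightarrow>
      (I +>\<^bsub>mpoly_ring n\<^esub> p) \<oplus>\<^bsub>quot_module (mpoly_ring n) I\<^esub> (I +>\<^bsub>mpoly_ring n\<^esub> q) =
      I +>\<^bsub>mpoly_ring n\<^esub> (p + q)"
    and "p \<in> polys {1..n} \<Longrightarrow> q \<in> polys {1..n} \<Longrightarrow>
      p \<odot>\<^bsub>quot_module (mpoly_ring n) I\<^esub> (I +>\<^bsub>mpoly_ring n\<^esub> q) = I +>\<^bsub>mpoly_ring n\<^esub> (p * q)"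
proof -
  interpret ideal I "mpoly_ring n" by fact
  show "carrier (quot_module (mpoly_ring n) I) = (\<lambda>p. I +>\<^bsub>mpoly_ring n\<^esub> p) ` polys {1..n}"
    by (auto simp: quot_module_def FactRing_def A_RCOSETS_def')
  show "\<zero>\<^bsub>quot_module (mpoly_ring n) I\<^esub> = I +>\<^bsub>mpoly_ring n\<^esub> 0"
    using a_rcos_zero[OF is_ideal, of 0] additive_subgroup.zero_closed[OF additive_subgroup_axioms]
    by (simp add: quot_module_def FactRing_def)
  show "p \<in> polys {1..n} \<Longrightarrow> q \<in> polys {1..n} \<Longrightarrow>
      (I +>\<^bsub>mpoly_ring n\<^esub> p) \<oplus>\<^bsub>quot_module (mpoly_ring n) I\<^esub> (I +>\<^bsub>mpoly_ring n\<^esub> q) =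
      I +>\<^bsub>mpoly_ring n\<^esub> (p + q)"
    using ring_hom_add[OF rcos_ring_hom, of p q] by (simp add: quot_module_def)
  show "p \<in> polys {1..n} \<Longrightarrow> q \<in> polys {1..n} \<Longrightarrow>
      p \<odot>\<^bsub>quot_module (mpoly_ring n) I\<^esub> (I +>\<^bsub>mpoly_ring n\<^esub> q) = I +>\<^bsub>mpoly_ring n\<^esub> (p * q)"
    using ring_hom_mult[OF rcos_ring_hom, of p q] by (simp add: quot_module_def)
qed

lemma monomial_module_ideal:
  fixes V :: "expo set"
  assumes V: "V \<subseteq> mons {1..n}" "\<And>m t. m \<in> V \<Longrightarrow> t \<in> mons {1..n} \<Longrightarrow> t + m \<in> V"
  shows "monomial_module n V id (ideal_module (mpoly_ring n) (mspan V :: 'k::field mpoly set))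
    (ideal_component n (mspan V))"
proof
  fix p q :: "'k mpoly" assume p: "p \<in> polys {1..n}" and q: "q \<in> mspan V"
  have "p * q \<in> mspan V"
    by (rule mspan_mult[OF p[unfolded polys_eq_mspan] q]) (use V(2) in auto)
  then show "p \<odot>\<^bsub>ideal_module (mpoly_ring n) (mspan V)\<^esub> id q = id (restr V (p * q))"
    by (simp add: ideal_module_def restr_id)
qed (use V in \<open>auto simp: ideal_module_def ideal_component_def\<close>)

lemma monomial_module_quotient:
  fixes V :: "expo set"
  assumes V: "V \<subseteq> mons {1..n}" "\<And>m t. m \<in> V \<Longrightarrow> t \<in> mons {1..n} \<Longrightarrow> t + m \<in> V"
  defines "I \<equiv> mspan V :: 'k::field mpoly set"
  shows "monomial_module n (mons {1..n} - V) (\<lambda>p. I +>\<^bsub>mpoly_ring n\<^esub> p)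
    (quot_module (mpoly_ring n) I) (quot_component n I)"
proof -
  let ?U = "mons {1..n} - V" and ?c = "\<lambda>p. I +>\<^bsub>mpoly_ring n\<^esub> p"
  have I: "ideal I (mpoly_ring n)"
    unfolding I_def using V by (rule ideal_mspan)
  have US: "p \<in> polys {1..n}" if "p \<in> mspan ?U" for p :: "'k mpoly"
    using that mspan_mono[of ?U "mons {1..n}"] by (auto simp: polys_eq_mspan)
  have restr: "?c (restr ?U p) = ?c p" if p: "p \<in> polys {1..n}" for p :: "'k mpoly"
  proof -
    have "p - restr ?U p \<in> mspan (mons {1..n} - ?U)"
      using p unfolding polys_eq_mspan by (rule diff_restr)
    then have "p - restr ?U p \<in> I"
      unfolding I_def using mspan_mono[of "mons {1..n} - ?U" V] by auto
    then show ?thesis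
      by (rule sym[OF iffD2[OF coset_eq_iff[OF I p US[OF restr_in_mspan]]]])
  qed
  show ?thesis
  proof
    show "?U \<subseteq> mons {1..n}" by simp
    show "inj_on ?c (mspan ?U)"
    proof (rule inj_onI)
      fix p q :: "'k mpoly"
      assume p: "p \<in> mspan ?U" and q: "q \<in> mspan ?U" and eq: "?c p = ?c q"
      then have "p - q \<in> mspan V"
        using coset_eq_iff[OF I US[OF p] US[OF q]] by (simp add: I_def)
      moreover have "p - q \<in> mspan ?U" using p q by (rule mspan_diff)
      ultimately have "keys (p - q) = {}" unfolding mspan_def by blast
      then show "p = q" by simp
    qed
    show "carrier (quot_module (mpoly_ring n) I) = ?c ` mspan ?U"
      unfolding quot_module_simps(1)[OF I]
    proof
      show "?c ` polys {1..n} \<subseteq> ?c ` mspan ?U"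
        using restr restr_in_mspan by (metis image_subsetI imageI)
      show "?c ` mspan ?U \<subseteq> ?c ` polys {1..n}" using US by blast
    qed
    show "\<zero>\<^bsub>quot_module (mpoly_ring n) I\<^esub> = ?c 0" by (rule quot_module_simps(2)[OF I])
    show "?c p \<oplus>\<^bsub>quot_module (mpoly_ring n) I\<^esub> ?c q = ?c (p + q)"
      if "p \<in> mspan ?U" "q \<in> mspan ?U" for p q
      using quot_module_simps(3)[OF I US US] that by blast
    show "p \<odot>\<^bsub>quot_module (mpoly_ring n) I\<^esub> ?c q = ?c (restr ?U (p * q))"
      if "p \<in> polys {1..n}" "q \<in> mspan ?U" for p q
      using quot_module_simps(4)[OF I that(1) US[OF that(2)]]
        restr[OF polys_mult[OF that(1) US[OF that(2)]]] by simp
    fix g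
    show "quot_component n I g = ?c ` (mspan ?U \<inter> poly_component n g)"
      unfolding quot_component_def
    proof
      show "?c ` poly_component n g \<subseteq> ?c ` (mspan ?U \<inter> poly_component n g)"
      proof (rule image_subsetI)
        fix p :: "'k mpoly" assume p: "p \<in> poly_component n g"
        then have "?c (restr ?U p) = ?c p" using restr by (simp add: poly_component_def)
        moreover have "restr ?U p \<in> poly_component n g"
          using p by (auto simp: poly_component_def polys_def keys_restr)
        ultimately show "?c p \<in> ?c ` (mspan ?U \<inter> poly_component n g)"
          using restr_in_mspan by (metis IntI imageI)
      qed
    qed auto
  qed
qed

text \<open>
  The generators \<open>\<Prod>j\<in>u k. x\<^sub>j\<close> of a squarefree monomial ideal each have a variable, \<open>x\<^bsub>c k\<^esub>\<close>, that
  no other generator involves.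
\<close>

locale private_variables =
  fixes n s :: nat and u :: "nat \<Rightarrow> nat set" and c :: "nat \<Rightarrow> nat"
  assumes u_sub: "k \<in> {1..s} \<Longrightarrow> u k \<subseteq> {1..n}"
    and priv: "k \<in> {1..s} \<Longrightarrow> l \<in> {1..s} \<Longrightarrow> c l \<in> u k \<longleftrightarrow> l = k"
begin

text \<open>
  The monomials of the ideal.
\<close>

definition V :: "expo set" where
  "V = {m \<in> mons {1..n}. dividing s u m \<noteq> {}}"

text \<open>
  The product of all non-private variables.
\<close>

definition w :: expo where
  "w = ind ({1..n} - c ` {1..s})"

lemma V_mons: "V \<subseteq> mons {1..n}"
  by (auto simp: V_def)

lemma dividing_mono: "(\<And>j. lookup m j \<le> lookup m' j) \<Longrightarrow> dividing s u m \<subseteq> dividing s u m'"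
  by (fastforce simp: dividing_def intro: less_le_trans)

lemma V_up: "m \<in> V \<Longrightarrow> t \<in> mons {1..n} \<Longrightarrow> t + m \<in> V"
  using dividing_mono[of m "t + m"] by (auto simp: V_def lookup_add intro: mons_add)

lemma c_in: "k \<in> {1..s} \<Longrightarrow> c k \<in> {1..n}"
  using priv[of k k] u_sub[of k] by blast

lemma inj_c: "inj_on c {1..s}"
  using priv by (metis inj_onI)

lemma c_image: "c ` {1..s} \<subseteq> {1..n}"
  using c_in by blast

lemma s_le: "s \<le> n"
  using card_inj_on_le[OF inj_c c_image] by simp

lemma card_non_private: "card ({1..n} - c ` {1..s}) = n - s"
  using c_image inj_c finite_subset[OF c_image] by (simp add: card_Diff_subset card_image)

lemma lookup_w: "lookup w j = (if j \<in> {1..n} - c ` {1..s} then 1 else 0)"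
  by (simp add: w_def lookup_ind)

text \<open>
  Multiplying \<open>w\<close> by private variables switches on exactly the chosen generators, so every
  divisibility pattern is realised by a multiple of \<open>w\<close>.
\<close>

lemma dividing_w:
  assumes "K \<subseteq> {1..s}"
  shows "dividing s u (w + ind (c ` K)) = K"
proof -
  have "finite K" using assms finite_subset by blast
  then have l: "lookup (w + ind (c ` K)) j =
      (if j \<in> {1..n} - c ` {1..s} then 1 else 0) + (if j \<in> c ` K then 1 else 0)" for j
    by (simp add: lookup_add lookup_w lookup_ind)
  have "k \<in> K" if k: "k \<in> dividing s u (w + ind (c ` K))" for k
  proof -
    have ks: "k \<in> {1..s}" "c k \<in> u k" using k priv by (auto simp: dividing_def)
    then have "lookup (w + ind (c ` K)) (c k) > 0" using k by (simp add: dividing_def)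
    moreover have "c k \<notin> {1..n} - c ` {1..s}" using ks by blast
    ultimately have "c k \<in> c ` K" unfolding l by (metis add_0 less_irrefl)
    then show ?thesis using inj_on_image_mem_iff[OF inj_c ks(1) assms] by simp
  qed
  moreover have "k \<in> dividing s u (w + ind (c ` K))" if k: "k \<in> K" for k
  proof -
    have ks: "k \<in> {1..s}" using k \<open>K \<subseteq> {1..s}\<close> by blast
    have "lookup (w + ind (c ` K)) j > 0" if j: "j \<in> u k" for j
    proof (cases "j \<in> c ` {1..s}")
      case True
      then have "j = c k" using priv ks j by blast
      then show ?thesis using k by (simp add: l)
    next
      case False
      then show ?thesis using j u_sub[OF ks] by (auto simp: l)
    qed
    then show ?thesis using ks by (simp add: dividing_def)
  qed
  ultimately show ?thesis by blast
qed

lemma w_mons: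
  assumes "K \<subseteq> {1..s}"
  shows "w + ind (c ` K) \<in> mons {1..n}"
proof -
  have "finite (c ` K)" using assms finite_subset by blast
  then show ?thesis
    using assms c_in by (auto simp: mons_iff lookup_add lookup_w lookup_ind split: if_splits)
qed

lemma cell_add_single: "m \<in> cell x \<Longrightarrow> j \<in> snd x \<Longrightarrow> m + single j 1 \<in> cell x"
  unfolding cell_def by (auto simp: add.assoc intro!: imageI mons_add)

text \<open>
  The cell of \<open>w\<close> must stay outside the ideal, but \<open>w x\<^bsub>c k\<^esub>\<close> is in the ideal for each \<open>k\<close>. So no
  private variable is a direction of that cell.
\<close>

theorem quotient_partition_upper:
  assumes "stanley_partition n (mons {1..n} - V) E"
  shows "\<exists>x\<in>set E. card (snd x) \<le> n - s"
proof -
  have w: "w + ind (c ` {}) \<in> mons {1..n} - V"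
    using dividing_w[of "{}"] w_mons[of "{}"] by (simp add: V_def)
  then obtain i where i: "i < length E" "w + ind (c ` {}) \<in> cell (E ! i)"
    using assms unfolding stanley_partition_def by meson
  let ?x = "E ! i"
  have x: "?x \<in> set E" "snd ?x \<subseteq> {1..n}" "cell ?x \<subseteq> mons {1..n} - V"
    using assms i by (auto simp: stanley_partition_def)
  have "c k \<notin> snd ?x" if k: "k \<in> {1..s}" for k
  proof
    assume "c k \<in> snd ?x"
    then have "w + ind (c ` {}) + single (c k) 1 \<in> cell ?x"
      using i(2) by (intro cell_add_single)
    then have "w + ind (c ` {k}) \<notin> V" using x(3) by (auto simp: ind_def)
    then show False
      using dividing_w[of "{k}"] w_mons[of "{k}"] k by (simp add: V_def)
  qed
  then have "snd ?x \<subseteq> {1..n} - c ` {1..s}" using x(2) by auto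
  then have "card (snd ?x) \<le> card ({1..n} - c ` {1..s})" by (intro card_mono) auto
  also have "\<dots> = n - s" by (rule card_non_private)
  finally show ?thesis using x(1) by blast
qed

text \<open>
  Let \<open>J k\<close> be the set of \<open>j \<noteq> k\<close> for which \<open>x\<^bsub>c j\<^esub>\<close> is a direction of the cell of \<open>w x\<^bsub>c k\<^esub>\<close>.
  If both \<open>j \<in> J k\<close> and \<open>k \<in> J j\<close>, then \<open>w x\<^bsub>c k\<^esub> x\<^bsub>c j\<^esub>\<close> lies in the cells of both \<open>w x\<^bsub>c k\<^esub>\<close> and
  \<open>w x\<^bsub>c j\<^esub>\<close>, so these coincide; but the corner of this cell would be a monomial of the ideal
  dividing both, while their divisibility patterns \<open>{k}\<close> and \<open>{j}\<close> are disjoint. Hence the sets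
  \<open>J k\<close> account for at most half of the ordered pairs, and some \<open>J k\<close> has at most \<open>(s - 1) / 2\<close>
  elements. Apart from these, the cell of \<open>w x\<^bsub>c k\<^esub>\<close> has at most the \<open>n - s\<close> non-private directions
  and the direction of \<open>x\<^bsub>c k\<^esub>\<close>.
\<close>

theorem ideal_partition_upper:
  assumes E: "stanley_partition n V E" and "s \<ge> 1"
  shows "\<exists>x\<in>set E. card (snd x) \<le> n - s div 2"
proof (rule ccontr)
  assume "\<not> ?thesis"
  then have big: "n - s div 2 < card (snd x)" if "x \<in> set E" for x
    using that by force
  let ?w = "\<lambda>K. w + ind (c ` K)"
  have wV: "?w K \<in> V" if "K \<subseteq> {1..s}" "K \<noteq> {}" for K
    using dividing_w[OF that(1)] w_mons[OF that(1)] that(2) by (simp add: V_def)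
  have "\<exists>i. i < length E \<and> ?w {k} \<in> cell (E ! i)" if k: "k \<in> {1..s}" for k
  proof -
    have "?w {k} \<in> V" using wV[of "{k}"] k by simp
    with E have "\<exists>!i. i < length E \<and> ?w {k} \<in> cell (E ! i)"
      unfolding stanley_partition_def by (elim conjE bspec)
    then show ?thesis by (elim ex1_implies_ex)
  qed
  then obtain i where i: "\<And>k. k \<in> {1..s} \<Longrightarrow> i k < length E"
      "\<And>k. k \<in> {1..s} \<Longrightarrow> ?w {k} \<in> cell (E ! i k)"
    by metis
  define J where "J k = {j \<in> {1..s}. j \<noteq> k \<and> c j \<in> snd (E ! i k)}" for k
  have Emem: "E ! i k \<in> set E" "snd (E ! i k) \<subseteq> {1..n}" "cell (E ! i k) \<subseteq> V"
    if "k \<in> {1..s}" for k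
    using E i(1)[OF that] by (auto simp: stanley_partition_def)
  have pair: "?w {k, j} \<in> cell (E ! i k)" if "k \<in> {1..s}" "j \<in> J k" for k j
  proof -
    have j: "j \<in> {1..s}" "j \<noteq> k" "c j \<in> snd (E ! i k)" using that by (auto simp: J_def)
    have "c j \<noteq> c k" using inj_on_eq_iff[OF inj_c j(1) that(1)] j(2) by simp
    then have "ind (c ` {k, j}) = single (c j) 1 + ind (c ` {k})"
      using ind_insert[of "{c k}" "c j"] by (simp add: insert_commute)
    then have "?w {k} + single (c j) 1 = ?w {k, j}" by (simp only: ac_simps)
    moreover have "?w {k} + single (c j) 1 \<in> cell (E ! i k)"
      using i(2)[OF that(1)] j(3) by (rule cell_add_single)
    ultimately show ?thesis by simp
  qed
  have asym: "k \<notin> J j" if k: "k \<in> {1..s}" and j: "j \<in> J k" for k j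
  proof
    assume kj: "k \<in> J j"
    have js: "j \<in> {1..s}" "j \<noteq> k" using j by (auto simp: J_def)
    have "?w {k, j} \<in> cell (E ! i k)" "?w {k, j} \<in> cell (E ! i j)"
      using pair[OF k j] pair[OF js(1) kj] by (simp_all add: insert_commute)
    moreover have "?w {k, j} \<in> V" using wV[of "{k, j}"] k js by simp
    moreover from this E have uniq: "\<exists>!l. l < length E \<and> ?w {k, j} \<in> cell (E ! l)"
      unfolding stanley_partition_def by (elim conjE bspec)
    ultimately have "i k = i j"
      using i(1)[OF k] i(1)[OF js(1)] by (intro ex1_unique[OF uniq]) simp_all
    then have mem: "?w {k} \<in> cell (E ! i k)" "?w {j} \<in> cell (E ! i k)"
      using i(2)[OF k] i(2)[OF js(1)] by simp_all
    let ?e = "fst (E ! i k)"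
    have "?e \<in> cell (E ! i k)"
      unfolding cell_def using image_eqI[of ?e "(+) ?e" 0] by simp
    then have "?e \<in> V" using Emem(3)[OF k] by auto
    then obtain l where l: "l \<in> dividing s u ?e" by (auto simp: V_def)
    have "dividing s u ?e \<subseteq> dividing s u (?w {k})" "dividing s u ?e \<subseteq> dividing s u (?w {j})"
      using mem by (auto simp: cell_def lookup_add intro!: dividing_mono)
    then have "l \<in> {k}" "l \<in> {j}"
      using l dividing_w[of "{k}"] dividing_w[of "{j}"] k js by auto
    then show False using js(2) by simp
  qed
  let ?T = "SIGMA k:{1..s}. J k"
  have fin: "finite ?T" by (auto simp: J_def)
  have T: "?T \<subseteq> {1..s} \<times> {1..s}" "?T\<inverse> \<subseteq> {1..s} \<times> {1..s}" "?T \<inter> ?T\<inverse> = {}"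
      "(?T \<union> ?T\<inverse>) \<inter> Id_on {1..s} = {}"
    using asym by (auto simp: J_def)
  have cardId: "card (Id_on {1..s}) = s"
  proof -
    have "Id_on {1..s} = (\<lambda>k. (k, k)) ` {1..s}" by (auto simp: Id_on_def)
    then show ?thesis by (simp add: card_image inj_on_def)
  qed
  have "card (?T \<union> ?T\<inverse> \<union> Id_on {1..s}) \<le> card ({1..s} \<times> {1..s})"
    by (intro card_mono) (use T in \<open>auto simp: Id_on_def\<close>)
  moreover have "card (?T \<union> ?T\<inverse> \<union> Id_on {1..s}) = card ?T + card ?T + s"
  proof -
    have "finite (Id_on {1..s})"
      by (rule finite_subset[of _ "{1..s} \<times> {1..s}"]) auto
    then show ?thesis
      using fin T(3,4) cardId card_inverse[of ?T]
      by (simp only: card_Un_disjoint finite_Un finite_converse simp_thms)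
  qed
  ultimately have le: "2 * card ?T + s \<le> s * s" by (simp add: card_cartesian_product)
  have "s - s div 2 \<le> card (J k)" if k: "k \<in> {1..s}" for k
  proof -
    let ?Z = "snd (E ! i k)"
    have fZ: "finite ?Z" using Emem(2)[OF k] finite_subset by blast
    have "?Z \<subseteq> ({1..n} - c ` {1..s}) \<union> c ` insert k (J k)"
      using Emem(2)[OF k] by (auto simp: J_def)
    moreover have fJ: "finite (J k)" by (simp add: J_def)
    ultimately have "card ?Z \<le> card (({1..n} - c ` {1..s}) \<union> c ` insert k (J k))"
      by (intro card_mono) auto
    also have "\<dots> \<le> card ({1..n} - c ` {1..s}) + card (c ` insert k (J k))"
      by (rule card_Un_le)
    also have "card ({1..n} - c ` {1..s}) = n - s" by (rule card_non_private)
    also have "card (c ` insert k (J k)) \<le> card (insert k (J k))"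
      using fJ by (intro card_image_le) simp
    also have "card (insert k (J k)) \<le> Suc (card (J k))"
      by (rule card_insert_le_m1) (simp_all)
    finally have "card ?Z \<le> n - s + Suc (card (J k))" by simp
    then show ?thesis using big[OF Emem(1)[OF k]] s_le by linarith
  qed
  then have "s * (s - s div 2) \<le> card ?T"
    using sum_bounded_below[of "{1..s}" "s - s div 2" "\<lambda>k. card (J k)"]
    by (simp add: J_def)
  then have "s * (2 * (s - s div 2)) + s \<le> s * s" using le by (simp add: algebra_simps)
  moreover have "s * s \<le> s * (2 * (s - s div 2))" by (intro mult_le_mono2) linarith
  ultimately show False using \<open>s \<ge> 1\<close> by linarith
qed

text \<open>
  The monomials outside the ideal form the single block in which no generator divides.
\<close>

theorem quotient_partition_lower:
  "\<exists>E. stanley_partition n (mons {1..n} - V) E \<and> (\<forall>x\<in>set E. n - s \<le> card (snd x))"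
proof (rule exists_partition_of_pairs[of s u n "{({}, {1..s})}" s])
  fix m
  have "dividing s u m \<subseteq> {1..s}" by (auto simp: dividing_def)
  then have "{1..s} \<inter> dividing s u m = {} \<longleftrightarrow> dividing s u m = {}" by blast
  then show "m \<in> mons {1..n} - V \<longleftrightarrow> m \<in> mons {1..n} \<and>
      (\<exists>(A, N)\<in>{({}, {1..s})}. A \<subseteq> dividing s u m \<and> N \<inter> dividing s u m = {})"
    by (simp add: V_def) blast
qed (use u_sub in auto)

theorem ideal_partition_lower:
  "\<exists>E. stanley_partition n V E \<and> (\<forall>x\<in>set E. n - s div 2 \<le> card (snd x))"
proof -
  obtain F where F: "finite F"
      "\<forall>(A, N)\<in>F. A \<subseteq> {1..s} \<and> N \<subseteq> {1..s} \<and> A \<noteq> {} \<and> card N \<le> s div 2"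
      "\<And>X. X \<subseteq> {1..s} \<Longrightarrow> X \<noteq> {} \<Longrightarrow> \<exists>!x. x \<in> F \<and> fst x \<subseteq> X \<and> snd x \<inter> X = {}"
    using interval_partition[of s] by auto
  have sub: "dividing s u m \<subseteq> {1..s}" for m by (auto simp: dividing_def)
  show ?thesis
  proof (rule exists_partition_of_pairs[OF u_sub F(1)])
    show "A \<subseteq> {1..s} \<and> N \<subseteq> {1..s} \<and> card N \<le> s div 2" if "(A, N) \<in> F" for A N
      using F(2) that by auto
    show "m \<in> V \<longleftrightarrow> m \<in> mons {1..n} \<and>
      (\<exists>(A, N)\<in>F. A \<subseteq> dividing s u m \<and> N \<inter> dividing s u m = {})" for m
    proof
      assume "m \<in> V"
      then have m: "m \<in> mons {1..n}" "dividing s u m \<noteq> {}" by (simp_all add: V_def)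
      obtain x where "x \<in> F" "fst x \<subseteq> dividing s u m" "snd x \<inter> dividing s u m = {}"
        using ex1_implies_ex[OF F(3)[OF sub m(2)]] by (elim exE conjE)
      then show "m \<in> mons {1..n} \<and>
        (\<exists>(A, N)\<in>F. A \<subseteq> dividing s u m \<and> N \<inter> dividing s u m = {})"
        using m(1) by (intro conjI bexI[of _ x]) (simp_all add: case_prod_beta)
    next
      assume m: "m \<in> mons {1..n} \<and>
        (\<exists>(A, N)\<in>F. A \<subseteq> dividing s u m \<and> N \<inter> dividing s u m = {})"
      then obtain A N where AN: "(A, N) \<in> F" "A \<subseteq> dividing s u m" by auto
      then have "A \<noteq> {}" using F(2) by auto
      then show "m \<in> V" using AN(2) m unfolding V_def by auto
    qed
    show "(A, N) = (A', N')" if "m \<in> V" "(A, N) \<in> F" "(A', N') \<in> F"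
        "A \<subseteq> dividing s u m" "N \<inter> dividing s u m = {}"
        "A' \<subseteq> dividing s u m" "N' \<inter> dividing s u m = {}" for m A N A' N'
    proof -
      have "\<exists>!x. x \<in> F \<and> fst x \<subseteq> dividing s u m \<and> snd x \<inter> dividing s u m = {}"
        using F(3)[OF sub, of m] that(1) by (simp add: V_def)
      from ex1_unique[OF this, of "(A, N)" "(A', N')"] show ?thesis using that by simp
    qed
  qed
qed

lemma quotient_mons_nonempty: "mons {1..n} - V \<noteq> {}"
  using dividing_w[of "{}"] w_mons[of "{}"] by (auto simp: V_def)

theorem sdepth_quotient:
  "sdepth n (quot_module (mpoly_ring n) (mspan V :: 'k::field mpoly set))
    (quot_component n (mspan V)) = n - s"
proof -
  interpret monomial_module n "mons {1..n} - V" "\<lambda>p. (mspan V :: 'k mpoly set) +>\<^bsub>mpoly_ring n\<^esub> p"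
    "quot_module (mpoly_ring n) (mspan V)" "quot_component n (mspan V)"
    by (rule monomial_module_quotient[OF V_mons V_up])
  show ?thesis
    by (rule sdepth_eqI[OF quotient_mons_nonempty quotient_partition_lower
          quotient_partition_upper])
qed

theorem sdepth_ideal:
  assumes "s \<ge> 1"
  shows "sdepth n (ideal_module (mpoly_ring n) (mspan V :: 'k::field mpoly set))
    (ideal_component n (mspan V)) = n - s div 2"
proof -
  interpret monomial_module n V id "ideal_module (mpoly_ring n) (mspan V :: 'k mpoly set)"
    "ideal_component n (mspan V)"
    by (rule monomial_module_ideal[OF V_mons V_up])
  have "V \<noteq> {}"
    using dividing_w[of "{1..s}"] w_mons[of "{1..s}"] assms by (auto simp: V_def)
  then show ?thesis
    by (rule sdepth_eqI[OF _ ideal_partition_lower ideal_partition_upper[OF _ assms]])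
qed

end

section \<open>Substitutions and regular sequences\<close>

definition subst_mon :: "(nat \<Rightarrow> 'k::field mpoly) \<Rightarrow> expo \<Rightarrow> 'k mpoly" where
  "subst_mon q m = (\<Prod>i\<in>keys m. q i ^ lookup m i)"

text \<open>
  The ring endomorphism that sends \<open>x\<^sub>i\<close> to \<open>q i\<close>.
\<close>

definition subst :: "(nat \<Rightarrow> 'k::field mpoly) \<Rightarrow> 'k mpoly \<Rightarrow> 'k mpoly" where
  "subst q p = (\<Sum>m\<in>keys p. single 0 (lookup p m) * subst_mon q m)"

lemma subst_mon_superset:
  "finite F \<Longrightarrow> keys m \<subseteq> F \<Longrightarrow> subst_mon q m = (\<Prod>i\<in>F. q i ^ lookup m i)"
  unfolding subst_mon_def by (rule prod.mono_neutral_left) (auto simp: in_keys_iff)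

lemma subst_mon_add: "subst_mon q (m + m') = subst_mon q m * subst_mon q m'"
proof -
  let ?F = "keys m \<union> keys m'"
  have "subst_mon q (m + m') = (\<Prod>i\<in>?F. q i ^ lookup (m + m') i)"
    by (rule subst_mon_superset) (use keys_add[of m m'] in auto)
  moreover have "subst_mon q m = (\<Prod>i\<in>?F. q i ^ lookup m i)"
    by (rule subst_mon_superset) auto
  moreover have "subst_mon q m' = (\<Prod>i\<in>?F. q i ^ lookup m' i)"
    by (rule subst_mon_superset) auto
  ultimately show ?thesis
    by (simp add: lookup_add power_add prod.distrib)
qed

lemma subst_superset:
  "finite F \<Longrightarrow> keys p \<subseteq> F \<Longrightarrow> subst q p = (\<Sum>m\<in>F. single 0 (lookup p m) * subst_mon q m)"
  unfolding subst_def by (rule sum.mono_neutral_left) (auto simp: in_keys_iff)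

lemma subst_zero [simp]: "subst q 0 = 0"
  by (simp add: subst_def)

lemma subst_add: "subst q (p + p') = subst q p + subst q p'"
proof -
  let ?F = "keys p \<union> keys p'"
  have "subst q (p + p') = (\<Sum>m\<in>?F. single 0 (lookup (p + p') m) * subst_mon q m)"
    by (rule subst_superset) (use keys_add[of p p'] in auto)
  moreover have "subst q p = (\<Sum>m\<in>?F. single 0 (lookup p m) * subst_mon q m)"
    by (rule subst_superset) auto
  moreover have "subst q p' = (\<Sum>m\<in>?F. single 0 (lookup p' m) * subst_mon q m)"
    by (rule subst_superset) auto
  ultimately show ?thesis
    by (simp add: lookup_add single_add distrib_right sum.distrib)
qed

lemma subst_diff: "subst q (p - p') = subst q p - subst q p'"
  using subst_add[of q "p - p'" p'] by simp

lemma subst_sum: "subst q (sum f A) = (\<Sum>i\<in>A. subst q (f i))"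
  by (induction A rule: infinite_finite_induct) (auto simp: subst_add)

lemma subst_single: "subst q (single m x) = single 0 x * subst_mon q m"
  by (cases "x = 0") (simp_all add: subst_def)

lemma subst_mult: "subst q (p * p') = subst q p * subst q p'"
proof -
  have "p * p' = (\<Sum>m\<in>keys p. single m (lookup p m)) * (\<Sum>m'\<in>keys p'. single m' (lookup p' m'))"
    using poly_eq_sum_monomials[of p] poly_eq_sum_monomials[of p'] by (rule arg_cong2)
  also have "\<dots> = (\<Sum>m\<in>keys p. \<Sum>m'\<in>keys p'. single (m + m') (lookup p m * lookup p' m'))"
    by (simp add: sum_product mult_single)
  finally have "subst q (p * p') = (\<Sum>m\<in>keys p. \<Sum>m'\<in>keys p'.
      single 0 (lookup p m * lookup p' m') * (subst_mon q m * subst_mon q m'))"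
    by (simp only: subst_sum subst_single subst_mon_add)
  also have "\<dots> = (\<Sum>m\<in>keys p. \<Sum>m'\<in>keys p'.
      (single 0 (lookup p m) * subst_mon q m) * (single 0 (lookup p' m') * subst_mon q m'))"
  proof -
    have "single 0 (x * y) = single 0 x * (single 0 y :: 'a mpoly)" for x y
      by (simp add: mult_single)
    then show ?thesis by (simp only: ac_simps)
  qed
  also have "\<dots> = subst q p * subst q p'"
    by (simp add: subst_def sum_product)
  finally show ?thesis .
qed

lemma subst_var: "subst q (var i) = q i"
  by (simp add: var_def subst_single subst_mon_def)

lemma subst_mon_var: "subst_mon var m = single m (1::'k::field)"
proof -
  have p: "var i ^ e = single (single i e) (1::'k)" for i e
    by (induction e) (simp_all add: var_def mult_single single_add[symmetric])
  have "(\<Prod>i\<in>F. single (single i (lookup m i)) (1::'k)) = single (\<Sum>i\<in>F. single i (lookup m i)) 1"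
    if "finite F" for F
    using that by (induction F rule: finite_induct) (simp_all add: mult_single)
  then have "subst_mon var m = single (\<Sum>i\<in>keys m. single i (lookup m i)) (1::'k)"
    by (simp add: subst_mon_def p)
  also have "(\<Sum>i\<in>keys m. single i (lookup m i)) = m"
    by (rule poly_mapping_eqI) (simp add: lookup_sum lookup_single when_def in_keys_iff)
  finally show ?thesis .
qed

lemma cong_mult:
  assumes J: "ideal J (mpoly_ring n)" and "p - p' \<in> J" "q - q' \<in> J"
    and "p \<in> polys {1..n}" "q' \<in> polys {1..n}"
  shows "p * q - p' * q' \<in> J"
proof -
  have "p * q - p' * q' = p * (q - q') + q' * (p - p')" by (simp add: algebra_simps)
  moreover have "p * (q - q') \<in> J" "q' * (p - p') \<in> J"
    using assms by (auto intro: ideal_mpoly_ringD(4)[OF J])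
  ultimately show ?thesis using ideal_mpoly_ringD(3)[OF J] by simp
qed

lemma cong_power:
  assumes J: "ideal J (mpoly_ring n)" and "p - p' \<in> J" "p \<in> polys {1..n}" "p' \<in> polys {1..n}"
  shows "p ^ e - p' ^ e \<in> J"
proof (induction e)
  case 0
  then show ?case using ideal_mpoly_ringD(2)[OF J] by simp
next
  case (Suc e)
  then show ?case using cong_mult[OF J assms(2) Suc assms(3) polys_power[OF assms(4)]] by simp
qed

lemma cong_prod:
  assumes J: "ideal J (mpoly_ring n)"
    and "\<And>i. i \<in> A \<Longrightarrow> f i - g i \<in> J \<and> f i \<in> polys {1..n} \<and> g i \<in> polys {1..n}"
  shows "prod f A - prod g A \<in> J"
  using assms(2)
proof (induction A rule: infinite_finite_induct)
  case (insert x A)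
  then have "f x * prod f A - g x * prod g A \<in> J"
    by (intro cong_mult[OF J]) (auto intro: polys_prod)
  then show ?case using insert by simp
qed (use ideal_mpoly_ringD(2)[OF J] in auto)

text \<open>
  A substitution that changes each variable only modulo \<open>J\<close> changes each polynomial only modulo
  \<open>J\<close>. This identifies kernels of substitutions with ideals generated by linear forms.
\<close>

lemma diff_subst_in_ideal:
  assumes J: "ideal J (mpoly_ring n)"
    and q: "\<And>i. i \<in> {1..n} \<Longrightarrow> var i - q i \<in> J" "\<And>i. i \<in> {1..n} \<Longrightarrow> q i \<in> polys {1..n}"
    and f: "f \<in> polys {1..n}"
  shows "f - subst q f \<in> J"
proof -
  have "f = (\<Sum>m\<in>keys f. single m (lookup f m))" by (rule poly_eq_sum_monomials)
  also have "\<dots> = (\<Sum>m\<in>keys f. single 0 (lookup f m) * subst_mon var m)"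
    by (simp add: subst_mon_var mult_single)
  finally have "f - subst q f =
      (\<Sum>m\<in>keys f. single 0 (lookup f m) * (subst_mon var m - subst_mon q m))"
    by (simp add: subst_def sum_subtractf right_diff_distrib)
  also have "\<dots> \<in> J"
  proof (rule ideal_sum_closed[OF J])
    fix m assume "m \<in> keys f"
    then have m: "keys m \<subseteq> {1..n}" using f by (auto simp: polys_def)
    have "subst_mon var m - subst_mon q m \<in> J"
      unfolding subst_mon_def
    proof (rule cong_prod[OF J], intro conjI)
      fix i assume "i \<in> keys m"
      then have i: "i \<in> {1..n}" using m by blast
      show "var i ^ lookup m i - q i ^ lookup m i \<in> J"
        using cong_power[OF J q(1)[OF i] polys_var[OF i] q(2)[OF i]] .
      show "var i ^ lookup m i \<in> polys {1..n}" "q i ^ lookup m i \<in> polys {1..n}"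
        using polys_var[OF i] q(2)[OF i] by (auto intro: polys_power)
    qed
    then show "single 0 (lookup f m) * (subst_mon var m - subst_mon q m) \<in> J"
      by (rule ideal_mpoly_ringD(4)[OF J]) simp
  qed
  finally show ?thesis .
qed

lemma ideal_subst_kernel: "ideal {f \<in> polys {1..n}. subst q f = 0} (mpoly_ring n)"
  by (rule ideal_mpoly_ringI) (auto simp: subst_add subst_mult polys_add polys_mult)

definition kill_vars :: "nat set \<Rightarrow> nat \<Rightarrow> 'k::field mpoly" where
  "kill_vars T j = (if j \<in> T then 0 else var j)"

text \<open>
  The prime ideal generated by the variables from \<open>T\<close>.
\<close>

lemma kernel_kill_vars:
  "{f \<in> polys {1..n}. subst (kill_vars T) f = 0} =
    (mspan {m \<in> mons {1..n}. \<exists>j\<in>T. lookup m j > 0} :: 'k::field mpoly set)"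
proof (intro equalityI subsetI)
  let ?W = "{m \<in> mons {1..n}. \<exists>j\<in>T. lookup m j > 0}"
  have W: "ideal (mspan ?W :: 'k mpoly set) (mpoly_ring n)"
    by (rule ideal_mspan) (auto simp: lookup_add intro: mons_add)
  fix f :: "'k mpoly" assume f: "f \<in> {f \<in> polys {1..n}. subst (kill_vars T) f = 0}"
  have "f - subst (kill_vars T) f \<in> mspan ?W"
  proof (rule diff_subst_in_ideal[OF W])
    fix i assume i: "i \<in> {1..n}"
    show "var i - kill_vars T i \<in> (mspan ?W :: 'k mpoly set)"
    proof (cases "i \<in> T")
      case True
      then have "single i 1 \<in> ?W" using i by (auto intro!: bexI[of _ i])
      then have "var i \<in> (mspan ?W :: 'k mpoly set)" unfolding var_def by (rule mspan_single)
      then show ?thesis using True by (simp add: kill_vars_def)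
    qed (simp add: kill_vars_def)
    show "kill_vars T i \<in> (polys {1..n} :: 'k mpoly set)"
      unfolding kill_vars_def by (cases "i \<in> T") (simp_all only: if_True if_False polys_zero polys_var[OF i])
  qed (use f in simp)
  then show "f \<in> mspan ?W" using f by simp
next
  fix f :: "'k mpoly" assume f: "f \<in> mspan {m \<in> mons {1..n}. \<exists>j\<in>T. lookup m j > 0}"
  have "subst_mon (kill_vars T) m = (0 :: 'k mpoly)" if m: "m \<in> keys f" for m
  proof -
    obtain j where "j \<in> T" "lookup m j > 0" using f m by (auto simp: mspan_def)
    then show ?thesis unfolding subst_mon_def
      by (intro prod_zero) (auto simp: kill_vars_def in_keys_iff intro!: bexI[of _ j])
  qed
  then have "subst (kill_vars T) f = 0" by (simp add: subst_def)
  moreover have "f \<in> polys {1..n}"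
    using f by (auto simp: mspan_def polys_def mons_def)
  ultimately show "f \<in> {f \<in> polys {1..n}. subst (kill_vars T) f = 0}" by simp
qed

text \<open>
  The ideal \<open>J + (r)\<close>.
\<close>

definition adjoin :: "nat \<Rightarrow> 'k::field mpoly set \<Rightarrow> 'k mpoly \<Rightarrow> 'k mpoly set" where
  "adjoin n J r = {p + r * h | p h. p \<in> J \<and> h \<in> polys {1..n}}"

text \<open>
  The recursion replaces \<open>S/J\<close> by \<open>S/(J + (r))\<close> after each element. This is regularity without
  the requirement that the last quotient be nonzero.
\<close>

primrec weakly_regular :: "nat \<Rightarrow> 'k::field mpoly set \<Rightarrow> 'k mpoly list \<Rightarrow> bool" where
  "weakly_regular n J [] = True"
| "weakly_regular n J (r # rs) =
    ((\<forall>f\<in>polys {1..n}. r * f \<in> J \<longrightarrow> f \<in> J) \<and> weakly_regular n (adjoin n J r) rs)"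

lemma ideal_adjoin:
  assumes J: "ideal J (mpoly_ring n)" and r: "r \<in> polys {1..n}"
  shows "ideal (adjoin n J r) (mpoly_ring n)"
proof (rule ideal_mpoly_ringI)
  note Jd = ideal_mpoly_ringD[OF J]
  show "adjoin n J r \<subseteq> polys {1..n}"
    using Jd(1) r by (auto simp: adjoin_def intro!: polys_add polys_mult)
  show "0 \<in> adjoin n J r"
    unfolding adjoin_def using Jd(2) by (intro CollectI exI[of _ 0]) (simp add: exI[of _ 0])
  fix p q assume p: "p \<in> adjoin n J r"
  then obtain p' h where p': "p = p' + r * h" "p' \<in> J" "h \<in> polys {1..n}"
    by (auto simp: adjoin_def)
  show "p + q \<in> adjoin n J r" if q: "q \<in> adjoin n J r"
  proof -
    obtain q' h' where q': "q = q' + r * h'" "q' \<in> J" "h' \<in> polys {1..n}"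
      using q by (auto simp: adjoin_def)
    have "p + q = (p' + q') + r * (h + h')"
      using p' q' by (simp add: algebra_simps)
    then show ?thesis
      unfolding adjoin_def using p' q' Jd(3) polys_add by blast
  qed
  show "q * p \<in> adjoin n J r" if "q \<in> polys {1..n}"
  proof -
    have "q * p = q * p' + r * (q * h)"
      using p' by (simp add: algebra_simps)
    then show ?thesis
      unfolding adjoin_def using p' that Jd(4) polys_mult by blast
  qed
qed

lemma adjoinI: "p \<in> J \<Longrightarrow> h \<in> polys {1..n} \<Longrightarrow> p + r * h \<in> adjoin n J r"
  unfolding adjoin_def by blast

lemma adjoin_superset: "J \<subseteq> adjoin n J r"
proof
  fix p assume "p \<in> J"
  then show "p \<in> adjoin n J r" using adjoinI[of p J 0 n r] by simp
qed

lemma adjoin_mem: "ideal J (mpoly_ring n) \<Longrightarrow> r \<in> adjoin n J r"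
  using adjoinI[OF ideal_mpoly_ringD(2) polys_one, of J n r] by simp

lemma adjoin_minimal:
  assumes "ideal J (mpoly_ring n)" "I \<subseteq> J" "r \<in> J"
  shows "adjoin n I r \<subseteq> J"
proof
  fix f assume "f \<in> adjoin n I r"
  then obtain p h where f: "f = p + r * h" "p \<in> I" "h \<in> polys {1..n}" by (auto simp: adjoin_def)
  have "r * h \<in> J"
    using ideal_mpoly_ringD(4)[OF assms(1) assms(3) f(3)] by (simp add: mult.commute)
  then show "f \<in> J" using f ideal_mpoly_ringD(3)[OF assms(1)] assms(2) by blast
qed

text \<open>
  Over the zero module every sequence qualifies.
\<close>

lemma weakly_regular_improper: "set rs \<subseteq> polys {1..n} \<Longrightarrow> weakly_regular n (polys {1..n}) rs"
proof (induction rs)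
  case (Cons r rs)
  have "adjoin n (polys {1..n}) r = polys {1..n}"
    using Cons.prems adjoin_superset[of "polys {1..n}" n r]
    by (auto simp: adjoin_def intro!: polys_add polys_mult)
  then show ?case using Cons by simp
qed simp

text \<open>
  For \<open>I\<^sub>1 = I : x\<close> and \<open>I\<^sub>2 = I + (x)\<close> there is the exact sequence
  \<open>0 \<rightarrow> S/I\<^sub>1 \<rightarrow> S/I \<rightarrow> S/I\<^sub>2 \<rightarrow> 0\<close>. An element that is regular on both ends is regular in the middle, and
  regularity on the right end keeps the sequence exact modulo that element, so the induction can
  continue.
\<close>

lemma weakly_regular_exact_sequence:
  assumes "ideal I (mpoly_ring n)" "ideal I1 (mpoly_ring n)" "ideal I2 (mpoly_ring n)"
    and x: "x \<in> polys {1..n}"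
    and I1: "\<And>f. f \<in> polys {1..n} \<Longrightarrow> f \<in> I1 \<longleftrightarrow> x * f \<in> I"
    and I2: "I2 = adjoin n I x"
    and rs: "set rs \<subseteq> polys {1..n}"
    and "weakly_regular n I1 rs" "weakly_regular n I2 rs"
  shows "weakly_regular n I rs"
  using assms
proof (induction rs arbitrary: I I1 I2)
  case (Cons r rs)
  note I = ideal_mpoly_ringD[OF Cons.prems(1)]
  have r: "r \<in> polys {1..n}" and rs: "set rs \<subseteq> polys {1..n}" using Cons.prems by auto
  have reg1: "\<And>f. f \<in> polys {1..n} \<Longrightarrow> r * f \<in> I1 \<Longrightarrow> f \<in> I1"
    and reg2: "\<And>f. f \<in> polys {1..n} \<Longrightarrow> r * f \<in> I2 \<Longrightarrow> f \<in> I2"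
    using Cons.prems by auto
  have I_I2: "I \<subseteq> I2" using Cons.prems(6) adjoin_superset by simp
  have "f \<in> I" if f: "f \<in> polys {1..n}" "r * f \<in> I" for f
  proof -
    have "f \<in> I2" using reg2[OF f(1)] f(2) I_I2 by auto
    then obtain p g where pg: "f = p + x * g" "p \<in> I" "g \<in> polys {1..n}"
      using Cons.prems(6) by (auto simp: adjoin_def)
    have "x * (r * g) = r * f - r * p" using pg by (simp add: algebra_simps)
    then have "x * (r * g) \<in> I" using I(5)[OF f(2) I(4)[OF pg(2) r]] by simp
    then have "r * g \<in> I1" using Cons.prems(5) polys_mult[OF r pg(3)] by blast
    then have "x * g \<in> I" using reg1[OF pg(3)] Cons.prems(5)[OF pg(3)] by blast
    then show ?thesis using pg I(3) by simp
  qed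
  moreover have "weakly_regular n (adjoin n I r) rs"
  proof (rule Cons.IH)
    show "ideal (adjoin n I r) (mpoly_ring n)" "ideal (adjoin n I1 r) (mpoly_ring n)"
      "ideal (adjoin n I2 r) (mpoly_ring n)"
      using Cons.prems(1-3) r by (auto intro: ideal_adjoin)
    show "x \<in> polys {1..n}" "set rs \<subseteq> polys {1..n}" by fact+
    show "weakly_regular n (adjoin n I1 r) rs" "weakly_regular n (adjoin n I2 r) rs"
      using Cons.prems by auto
    show "adjoin n I2 r = adjoin n (adjoin n I r) x"
    proof
      show "adjoin n I2 r \<subseteq> adjoin n (adjoin n I r) x"
      proof (rule adjoin_minimal)
        show Jx: "ideal (adjoin n (adjoin n I r) x) (mpoly_ring n)"
          using Cons.prems(1) r x by (intro ideal_adjoin)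
        show "I2 \<subseteq> adjoin n (adjoin n I r) x"
          unfolding Cons.prems(6)
          using Jx adjoin_superset adjoin_mem[OF ideal_adjoin[OF Cons.prems(1) r]]
          by (intro adjoin_minimal) blast+
        show "r \<in> adjoin n (adjoin n I r) x"
          using adjoin_superset adjoin_mem[OF Cons.prems(1)] by blast
      qed
      show "adjoin n (adjoin n I r) x \<subseteq> adjoin n I2 r"
      proof (rule adjoin_minimal)
        show J2: "ideal (adjoin n I2 r) (mpoly_ring n)"
          using Cons.prems(3) r by (rule ideal_adjoin)
        show "adjoin n I r \<subseteq> adjoin n I2 r"
          using J2 adjoin_superset adjoin_mem[OF Cons.prems(3)] I_I2
          by (intro adjoin_minimal) blast+
        show "x \<in> adjoin n I2 r"
          using adjoin_superset adjoin_mem[OF Cons.prems(1)] Cons.prems(6) by blast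
      qed
    qed
    fix f :: "'a mpoly" assume f: "f \<in> polys {1..n}"
    show "f \<in> adjoin n I1 r \<longleftrightarrow> x * f \<in> adjoin n I r"
    proof
      assume "f \<in> adjoin n I1 r"
      then obtain p h where ph: "f = p + r * h" "p \<in> I1" "h \<in> polys {1..n}"
        by (auto simp: adjoin_def)
      have "x * p \<in> I"
        using ph(2) Cons.prems(5) ideal_mpoly_ringD(1)[OF Cons.prems(2)] by blast
      moreover have "x * f = x * p + r * (x * h)" using ph by (simp add: algebra_simps)
      ultimately show "x * f \<in> adjoin n I r"
        unfolding adjoin_def using polys_mult[OF x ph(3)] by blast
    next
      assume "x * f \<in> adjoin n I r"
      then obtain p h where ph: "x * f = p + r * h" "p \<in> I" "h \<in> polys {1..n}"
        by (auto simp: adjoin_def)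
      have "- p \<in> I" using I(5)[OF I(2) ph(2)] by simp
      then have "r * h \<in> adjoin n I x"
        unfolding adjoin_def using ph(1) f
        by (intro CollectI exI[of _ "- p"] exI[of _ f]) (simp add: algebra_simps)
      then have "h \<in> I2" using reg2[OF ph(3)] Cons.prems(6) by simp
      then obtain p' g where pg: "h = p' + x * g" "p' \<in> I" "g \<in> polys {1..n}"
        using Cons.prems(6) by (auto simp: adjoin_def)
      have "x * (f - r * g) = p + r * p'" using ph pg by (simp add: algebra_simps)
      then have "x * (f - r * g) \<in> I" using I(3)[OF ph(2) I(4)[OF pg(2) r]] by simp
      then have "f - r * g \<in> I1"
        using Cons.prems(5)[of "f - r * g"] f polys_mult[OF r pg(3)] polys_diff by blast
      then show "f \<in> adjoin n I1 r"
        unfolding adjoin_def using pg(3)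
        by (intro CollectI exI[of _ "f - r * g"] exI[of _ g]) simp
    qed
  qed
  ultimately show ?case by simp
qed simp

section \<open>A regular sequence of linear forms\<close>

text \<open>
  Every covered index receives the number of one generator containing it as its colour, in a way
  that increases with the index; uncovered indices have colour \<open>0\<close>. The condition
  \<open>color_convex\<close> says that a generator containing an index contains all smaller indices of the
  same colour.
\<close>

locale colored_private_variables = private_variables +
  fixes color :: "nat \<Rightarrow> nat"
  assumes color: "k \<in> {1..s} \<Longrightarrow> j \<in> u k \<Longrightarrow> color j \<in> {1..s} \<and> j \<in> u (color j)"
    and color_mono: "k \<in> {1..s} \<Longrightarrow> l \<in> {1..s} \<Longrightarrow> i \<in> u k \<Longrightarrow> j \<in> u l \<Longrightarrow> i \<le> j \<Longrightarrow>
      color i \<le> color j"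
    and color_convex: "k \<in> {1..s} \<Longrightarrow> l \<in> {1..s} \<Longrightarrow> i \<in> u k \<Longrightarrow> j \<in> u l \<Longrightarrow> i < j \<Longrightarrow>
      color i = color j \<Longrightarrow> i \<in> u l"
    and no_color: "(\<And>k. k \<in> {1..s} \<Longrightarrow> j \<notin> u k) \<Longrightarrow> color j = 0"
begin

text \<open>
  The private indices, which serve as the roots of the colour classes.
\<close>

abbreviation C :: "nat set" where
  "C \<equiv> c ` {1..s}"

text \<open>
  The indices covered by the generators.
\<close>

definition L :: "nat set" where
  "L = (\<Union>k\<in>{1..s}. u k)"

lemma L_sub: "L \<subseteq> {1..n}"
  unfolding L_def by (intro UN_least u_sub)

lemma color_L: "j \<in> L \<Longrightarrow> color j \<in> {1..s} \<and> j \<in> u (color j)"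
  using color by (auto simp: L_def)

lemma color_eq_0_iff: "color j = 0 \<longleftrightarrow> j \<notin> L"
proof (cases "j \<in> L")
  case True
  then show ?thesis using color_L[of j] by simp
next
  case False
  then have "color j = 0" by (intro no_color) (auto simp: L_def)
  then show ?thesis using False by simp
qed

lemma c_L: "k \<in> {1..s} \<Longrightarrow> c k \<in> L"
  unfolding L_def using priv[of k k] by blast

lemma color_c: "k \<in> {1..s} \<Longrightarrow> color (c k) = k"
  using color_L[OF c_L] priv by metis

text \<open>
  The linear form of the regular sequence that identifies \<open>x\<^sub>j\<close> with the root of its colour
  class, or kills it if it has no colour.
\<close>

definition theta :: "nat \<Rightarrow> 'k::field mpoly" where
  "theta j = var j - (if color j = 0 then 0 else var (c (color j)))"

text \<open>
  In the quotient by the variables from \<open>J\<close> and the forms \<open>theta j\<close> with \<open>j \<in> T\<close>, the root of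
  colour \<open>k\<close> is zero if it was identified with a variable from \<open>J\<close>. The fictitious colour \<open>0\<close>
  counts as zero from the start.
\<close>

definition dead :: "nat set \<Rightarrow> nat set \<Rightarrow> nat \<Rightarrow> bool" where
  "dead J T k \<longleftrightarrow> k = 0 \<or> (\<exists>i\<in>J. i \<in> T \<union> C \<and> color i = k)"

definition root_value :: "nat set \<Rightarrow> nat set \<Rightarrow> nat \<Rightarrow> 'k::field mpoly" where
  "root_value J T k = (if dead J T k then 0 else var (c k))"

text \<open>
  The normal form of \<open>x\<^sub>j\<close> in the quotient by the variables from \<open>J\<close> and the forms from \<open>T\<close>.
\<close>

definition merge :: "nat set \<Rightarrow> nat set \<Rightarrow> nat \<Rightarrow> 'k::field mpoly" where
  "merge J T j = (if j \<in> T \<union> C then root_value J T (color j) else if j \<in> J then 0 else var j)"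

definition kern :: "nat set \<Rightarrow> nat set \<Rightarrow> 'k::field mpoly set" where
  "kern J T = {f \<in> polys {1..n}. subst (merge J T) f = 0}"

lemma ideal_kern: "ideal (kern J T) (mpoly_ring n)"
  unfolding kern_def by (rule ideal_subst_kernel)

lemma color_cases: "color j = 0 \<or> color j \<in> {1..s}"
  using color_L color_eq_0_iff by blast

lemma root_value_polys: "root_value J T (color j) \<in> polys {1..n}"
  using color_cases[of j] c_in[of "color j"] by (auto simp: root_value_def dead_def intro!: polys_var)

lemma merge_polys: "j \<in> {1..n} \<Longrightarrow> merge J T j \<in> polys {1..n}"
  using root_value_polys by (auto simp: merge_def intro: polys_var)

lemma theta_polys: "j \<in> {1..n} \<Longrightarrow> theta j \<in> polys {1..n}"
  using color_cases[of j] c_in[of "color j"]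
  by (auto simp: theta_def simp del: One_nat_def intro!: polys_var polys_diff)

lemma subst_merge_root_value:
  "T \<subseteq> T' \<Longrightarrow> subst (merge J T') (root_value J T (color j)) = (root_value J T' (color j) :: 'k::field mpoly)"
proof (cases "dead J T (color j)")
  case True
  moreover assume "T \<subseteq> T'"
  ultimately have "dead J T' (color j)" by (auto simp: dead_def)
  then show ?thesis using True by (simp add: root_value_def)
next
  case False
  then have k: "color j \<in> {1..s}" using color_cases[of j] by (auto simp: dead_def)
  then show ?thesis
    using False color_c[OF k] by (simp add: root_value_def subst_var merge_def)
qed

lemma subst_merge_merge:
  assumes "T \<subseteq> T'" "T' - T \<subseteq> {j}"
  shows "subst (merge J T') (merge J T i) = (merge J T' i :: 'k::field mpoly)"
proof (cases "i \<in> T \<union> C")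
  case True
  then have "i \<in> T' \<union> C" using assms(1) by auto
  then show ?thesis
    using True subst_merge_root_value[OF assms(1)] by (simp add: merge_def)
next
  case False
  show ?thesis
  proof (cases "i \<in> J \<and> i \<in> T'")
    case True
    then have "dead J T' (color i)" by (auto simp: dead_def)
    then show ?thesis using True False by (simp add: merge_def root_value_def)
  next
    case F: False
    show ?thesis
    proof (cases "i \<in> J")
      case True
      then show ?thesis using False F by (simp add: merge_def)
    next
      case i: False
      then have "merge J T i = (var i :: 'k mpoly)" using False by (simp add: merge_def)
      then show ?thesis by (simp add: subst_var)
    qed
  qed
qed

lemma subst_theta:
  "subst (merge J T) (theta j) = merge J T j - (root_value J T (color j) :: 'k::field mpoly)"
proof (cases "color j = 0")
  case True
  then show ?thesis by (simp add: theta_def subst_diff subst_var root_value_def dead_def)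
next
  case False
  then have k: "color j \<in> {1..s}" using color_cases[of j] by auto
  then have "merge J T (c (color j)) = (root_value J T (color j) :: 'k mpoly)"
    using color_c[OF k] by (simp add: merge_def)
  then show ?thesis using False by (simp add: theta_def subst_diff subst_var)
qed

lemma var_minus_merge_in_kern:
  assumes "i \<in> {1..n}" "T \<subseteq> T'" "T' - T \<subseteq> {j}"
  shows "var i - merge J T i \<in> (kern J T' :: 'k::field mpoly set)"
proof -
  have "subst (merge J T') (var i - merge J T i) = (0 :: 'k mpoly)"
    using assms(2,3) by (simp add: subst_diff subst_var subst_merge_merge)
  moreover have "var i - merge J T i \<in> (polys {1..n} :: 'k mpoly set)"
    by (intro polys_diff polys_var merge_polys assms(1))
  ultimately show ?thesis by (simp add: kern_def)
qed

context
  fixes J :: "nat set"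
  assumes J: "J \<subseteq> L" "inj_on color J"
begin

lemma dead_insert:
  assumes "j \<notin> T \<union> C" "j \<in> J"
  shows "\<not> dead J T (color j)"
proof
  assume "dead J T (color j)"
  moreover have "color j \<noteq> 0" using J(1) assms(2) color_eq_0_iff by blast
  ultimately obtain i where "i \<in> J" "i \<in> T \<union> C" "color i = color j" by (auto simp: dead_def)
  then show False using inj_onD[OF J(2), of i j] assms by auto
qed

text \<open>
  Two different variables remain, or one variable and zero: if \<open>x\<^sub>j\<close> itself is killed by \<open>J\<close>,
  then, colours being different on \<open>J\<close>, the root of its class is still alive.
\<close>

lemma subst_theta_nonzero:
  assumes "j \<notin> T \<union> C"
  shows "subst (merge J T) (theta j) \<noteq> (0 :: 'k::field mpoly)"
proof -
  have var_neq: "var i \<noteq> (var l :: 'k mpoly)" if "i \<noteq> l" for i l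
  proof
    assume "var i = (var l :: 'k mpoly)"
    then have "lookup (var i) (single i 1) = lookup (var l :: 'k mpoly) (single i 1)" by simp
    moreover have "single i (1::nat) \<noteq> single l 1"
      using that by (metis keys_single singleton_inject zero_neq_one)
    ultimately show False by (simp add: var_def lookup_single when_def)
  qed
  show ?thesis
  proof (cases "j \<in> J")
    case True
    then show ?thesis
      using dead_insert[OF assms True] assms var_nonzero
      by (simp add: subst_theta merge_def root_value_def)
  next
    case False
    then have "merge J T j = (var j :: 'k mpoly)" using assms by (simp add: merge_def)
    moreover have "var j \<noteq> (root_value J T (color j) :: 'k mpoly)"
    proof (cases "dead J T (color j)")
      case True
      then show ?thesis using var_nonzero by (simp add: root_value_def)
    next
      case F: False
      then have "color j \<in> {1..s}" using color_cases[of j] by (auto simp: dead_def)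
      then have "j \<noteq> c (color j)" using assms by blast
      then show ?thesis using F var_neq by (simp add: root_value_def)
    qed
    ultimately show ?thesis by (simp add: subst_theta)
  qed
qed

text \<open>
  For the second inclusion the normal forms before and after have to agree modulo the new form.
  They differ only for \<open>j\<close> itself, or, if \<open>j \<in> J\<close>, for the class that dies when \<open>j\<close> joins it.
\<close>

lemma adjoin_kern:
  assumes j: "j \<in> {1..n}" "j \<notin> T \<union> C"
  shows "adjoin n (kern J T) (theta j) = (kern J (insert j T) :: 'k::field mpoly set)"
proof
  let ?T' = "insert j T"
  have TT': "T \<subseteq> ?T'" "?T' - T \<subseteq> {j}" by auto
  show "adjoin n (kern J T) (theta j) \<subseteq> (kern J ?T' :: 'k mpoly set)"
  proof (rule adjoin_minimal[OF ideal_kern])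
    show "kern J T \<subseteq> (kern J ?T' :: 'k mpoly set)"
    proof
      fix f :: "'k mpoly" assume f: "f \<in> kern J T"
      have "f - subst (merge J T) f \<in> (kern J ?T' :: 'k mpoly set)"
      proof (rule diff_subst_in_ideal[OF ideal_kern])
        fix i assume i: "i \<in> {1..n}"
        show "var i - merge J T i \<in> (kern J ?T' :: 'k mpoly set)"
          by (rule var_minus_merge_in_kern[OF i TT'])
      qed (use f merge_polys in \<open>auto simp: kern_def\<close>)
      then show "f \<in> kern J ?T'" using f by (simp add: kern_def)
    qed
    have "merge J ?T' j = (root_value J ?T' (color j) :: 'k mpoly)" by (simp add: merge_def)
    then show "theta j \<in> (kern J ?T' :: 'k mpoly set)"
      unfolding kern_def using theta_polys[OF j(1)] by (simp add: subst_theta)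
  qed
  let ?A = "adjoin n (kern J T) (theta j) :: 'k mpoly set"
  have A: "ideal ?A (mpoly_ring n)"
    by (rule ideal_adjoin[OF ideal_kern theta_polys[OF j(1)]])
  note Ad = ideal_mpoly_ringD[OF A]
  have theta_red: "merge J T j - root_value J T (color j) \<in> ?A"
  proof -
    have "theta j - subst (merge J T) (theta j) \<in> (kern J T :: 'k mpoly set)"
      by (rule diff_subst_in_ideal[OF ideal_kern var_minus_merge_in_kern merge_polys
            theta_polys[OF j(1)]]) auto
    then have "theta j - (theta j - subst (merge J T) (theta j)) \<in> ?A"
      using Ad(5)[OF adjoin_mem[OF ideal_kern]] adjoin_superset by blast
    then show ?thesis by (simp add: subst_theta)
  qed
  have diff: "merge J T i - merge J ?T' i \<in> ?A" for i
  proof (cases "i \<in> T \<union> C")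
    case True
    then have m: "merge J T i - merge J ?T' i =
        (root_value J T (color i) - root_value J ?T' (color i) :: 'k mpoly)"
      by (simp add: merge_def)
    show ?thesis
    proof (cases "dead J T (color i) = dead J ?T' (color i)")
      case True
      then show ?thesis using m Ad(2) by (simp add: root_value_def)
    next
      case False
      then have d: "j \<in> J" "color j = color i" "\<not> dead J T (color i)" "dead J ?T' (color i)"
        by (auto simp: dead_def)
      then have "merge J T j = (0 :: 'k mpoly)" using j(2) by (simp add: merge_def)
      then have "0 - (0 - root_value J T (color i)) \<in> ?A"
        using Ad(5)[OF Ad(2) theta_red] d(2) by simp
      then show ?thesis using m d(4) by (simp add: root_value_def)
    qed
  next
    case False
    show ?thesis
    proof (cases "i = j")
      case True
      show ?thesis
      proof (cases "j \<in> J")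
        case jJ: True
        then have "merge J T j = (0 :: 'k mpoly)" "merge J ?T' j = (0 :: 'k mpoly)"
          using j(2) by (auto simp: merge_def root_value_def dead_def)
        then show ?thesis using True Ad(2) by simp
      next
        case jJ: False
        then have "dead J ?T' (color j) = dead J T (color j)" by (auto simp: dead_def)
        then have "merge J ?T' j = (root_value J T (color j) :: 'k mpoly)"
          by (simp add: merge_def root_value_def)
        then show ?thesis using True theta_red by simp
      qed
    next
      case i: False
      then have "merge J ?T' i = (merge J T i :: 'k mpoly)" using False by (simp add: merge_def)
      then show ?thesis using Ad(2) by simp
    qed
  qed
  show "kern J ?T' \<subseteq> ?A"
  proof
    fix f :: "'k mpoly" assume f: "f \<in> kern J ?T'"
    have "f - subst (merge J ?T') f \<in> ?A"
    proof (rule diff_subst_in_ideal[OF A])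
      fix i assume i: "i \<in> {1..n}"
      have "var i - merge J T i \<in> ?A"
        using var_minus_merge_in_kern[OF i, of T T] adjoin_superset by blast
      from Ad(3)[OF this diff[of i]] show "var i - merge J ?T' i \<in> ?A" by simp
    qed (use f merge_polys in \<open>auto simp: kern_def\<close>)
    then show "f \<in> ?A" using f by (simp add: kern_def)
  qed
qed

text \<open>
  The kernels are kernels of homomorphisms into a domain, so a form whose image is nonzero is
  regular modulo the kernel.
\<close>

lemma weakly_regular_kern:
  "set js \<subseteq> {1..n} - (T \<union> C) \<Longrightarrow> distinct js \<Longrightarrow>
    weakly_regular n (kern J T :: 'k::field mpoly set) (map theta js)"
proof (induction js arbitrary: T)
  case (Cons j js)
  have j: "j \<in> {1..n}" "j \<notin> T \<union> C" using Cons.prems by auto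
  have "f \<in> kern J T" if "f \<in> polys {1..n}" "theta j * f \<in> kern J T" for f :: "'k mpoly"
  proof -
    have "subst (merge J T) (theta j) * subst (merge J T) f = 0"
      using that(2) by (simp add: kern_def subst_mult)
    moreover have "subst (merge J T) (theta j) \<noteq> (0 :: 'k mpoly)"
      by (rule subst_theta_nonzero[OF j(2)])
    ultimately show ?thesis using that(1) by (simp add: kern_def)
  qed
  moreover have "weakly_regular n (adjoin n (kern J T) (theta j) :: 'k mpoly set) (map theta js)"
    unfolding adjoin_kern[OF j] using Cons.prems by (intro Cons.IH) auto
  ultimately show ?case by simp
qed simp

lemma kern_empty: "kern J {} = (mspan {m \<in> mons {1..n}. \<exists>j\<in>J. lookup m j > 0} :: 'k::field mpoly set)"
proof -
  have "merge J {} j = (kill_vars J j :: 'k mpoly)" for j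
  proof (cases "j \<in> C")
    case True
    then obtain k where k: "k \<in> {1..s}" "j = c k" by auto
    have "dead J {} k \<longleftrightarrow> j \<in> J"
    proof
      assume "dead J {} k"
      then obtain l where "l \<in> {1..s}" "c l \<in> J" "color (c l) = k" using k(1) by (auto simp: dead_def)
      then show "j \<in> J" using k(2) color_c by auto
    qed (use k color_c in \<open>auto simp: dead_def intro!: bexI[of _ "c k"]\<close>)
    then show ?thesis using True k color_c[OF k(1)] by (simp add: merge_def root_value_def kill_vars_def)
  qed (simp add: merge_def kill_vars_def)
  then have "merge J {} = (kill_vars J :: nat \<Rightarrow> 'k mpoly)" by (rule ext)
  then show ?thesis unfolding kern_def by (simp only: kernel_kill_vars)
qed

end

text \<open>
  The monomials of the ideal generated by the variables from \<open>J\<close> and by the generators of the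
  original ideal with all variables from \<open>A\<close> deleted. Taking the colon by \<open>x\<^sub>j\<close> moves \<open>j\<close> into
  \<open>A\<close>, and adding \<open>x\<^sub>j\<close> moves it into \<open>J\<close>.
\<close>

definition W :: "nat set \<Rightarrow> nat set \<Rightarrow> expo set" where
  "W A J = {m \<in> mons {1..n}. (\<exists>j\<in>J. lookup m j > 0) \<or> (\<exists>k\<in>{1..s}. \<forall>j\<in>u k - A. lookup m j > 0)}"

definition regular_list :: "'k::field mpoly list" where
  "regular_list = map theta (sorted_list_of_set ({1..n} - C))"

lemma W_ideal: "ideal (mspan (W A J) :: 'k::field mpoly set) (mpoly_ring n)"
proof (rule ideal_mspan)
  fix m t assume m: "m \<in> W A J" and t: "t \<in> mons {1..n}"
  have "lookup (t + m) j > 0" if "lookup m j > 0" for j using that by (simp add: lookup_add)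
  then show "t + m \<in> W A J"
    using m mons_add[OF t, of m] unfolding W_def by blast
qed (auto simp: W_def)

lemma regular_list_polys: "set regular_list \<subseteq> polys {1..n}"
proof
  fix f :: "'a mpoly" assume "f \<in> set regular_list"
  then obtain j where "j \<in> {1..n}" "f = theta j" by (auto simp: regular_list_def)
  then show "f \<in> polys {1..n}" using theta_polys by blast
qed

lemma weakly_regular_W_split:
  assumes j: "j \<in> {1..n}" "j \<notin> J"
    and reg: "weakly_regular n (mspan (W (insert j A) J) :: 'k::field mpoly set) rs"
      "weakly_regular n (mspan (W A (insert j J)) :: 'k mpoly set) rs"
    and rs: "set rs \<subseteq> polys {1..n}"
  shows "weakly_regular n (mspan (W A J) :: 'k mpoly set) rs"
proof (rule weakly_regular_exact_sequence[OF W_ideal W_ideal W_ideal polys_var[OF j(1)] _ _ rs reg])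
  have mW: "single j 1 + m \<in> W A J \<longleftrightarrow> m \<in> W (insert j A) J" if m: "m \<in> mons {1..n}" for m
  proof -
    have l: "lookup (single j 1 + m) i > 0 \<longleftrightarrow> i = j \<or> lookup m i > 0" for i
      by (auto simp: lookup_add lookup_single when_def)
    have "single j 1 + m \<in> mons {1..n}" using m j(1) by (intro mons_add) simp_all
    moreover have "(\<exists>i\<in>J. lookup (single j 1 + m) i > 0) \<longleftrightarrow> (\<exists>i\<in>J. lookup m i > 0)"
      unfolding l using j(2) by blast
    moreover have "(\<forall>i\<in>u k - A. lookup (single j 1 + m) i > 0) \<longleftrightarrow>
        (\<forall>i\<in>u k - insert j A. lookup m i > 0)" for k
      unfolding l Ball_def Diff_iff insert_iff by meson
    ultimately show ?thesis using m by (simp only: W_def mem_Collect_eq)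
  qed
  fix f :: "'k mpoly" assume f: "f \<in> polys {1..n}"
  have k: "keys (var j * f) = (+) (single j 1) ` keys f"
    unfolding var_def by (rule keys_single_times) simp
  have "m \<in> mons {1..n}" if "m \<in> keys f" for m using f that by (auto simp: polys_def mons_def)
  then have "keys f \<subseteq> W (insert j A) J \<longleftrightarrow> (+) (single j 1) ` keys f \<subseteq> W A J"
    using mW by blast
  then show "f \<in> mspan (W (insert j A) J) \<longleftrightarrow> var j * f \<in> mspan (W A J)"
    by (simp only: mspan_def mem_Collect_eq k)
next
  show "mspan (W A (insert j J)) = adjoin n (mspan (W A J)) (var j :: 'k mpoly)"
  proof
    show "adjoin n (mspan (W A J)) (var j) \<subseteq> (mspan (W A (insert j J)) :: 'k mpoly set)"
    proof (rule adjoin_minimal[OF W_ideal])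
      show "mspan (W A J) \<subseteq> mspan (W A (insert j J))"
        by (rule mspan_mono) (auto simp: W_def)
      show "var j \<in> (mspan (W A (insert j J)) :: 'k mpoly set)"
        unfolding var_def using j(1) by (intro mspan_single) (simp add: W_def)
    qed
    show "mspan (W A (insert j J)) \<subseteq> adjoin n (mspan (W A J)) (var j :: 'k mpoly)"
    proof
      fix f :: "'k mpoly" assume f: "f \<in> mspan (W A (insert j J))"
      let ?g = "f - restr (W A J) f"
      let ?h = "\<Sum>m\<in>keys ?g. single (m - single j 1) (lookup ?g m)"
      have "?g \<in> mspan (W A (insert j J) - W A J)" using f by (rule diff_restr)
      then have k: "m \<in> mons {1..n} \<and> lookup m j > 0" if "m \<in> keys ?g" for m
        using that by (auto simp: mspan_def W_def)
      have e: "m = single j 1 + (m - single j 1)" if "m \<in> keys ?g" for m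
        using k[OF that]
        by (intro poly_mapping_eqI) (auto simp: lookup_add lookup_minus lookup_single when_def)
      have "?h \<in> polys {1..n}"
        unfolding polys_eq_mspan
      proof (intro mspan_sum mspan_single)
        fix m assume "m \<in> keys ?g"
        then show "m - single j 1 \<in> mons {1..n}"
          using k by (auto simp: mons_iff lookup_minus)
      qed
      moreover have "var j * ?h = (\<Sum>m\<in>keys ?g. single m (lookup ?g m))"
        unfolding sum_distrib_left var_def mult_single
      proof (rule sum.cong)
        fix m assume "m \<in> keys ?g"
        from e[OF this] show "single (single j 1 + (m - single j 1)) (1 * lookup ?g m) = single m (lookup ?g m)"
          by simp
      qed simp
      then have "var j * ?h = ?g" using poly_eq_sum_monomials[of ?g] by (rule trans[OF _ sym])
      then have "f = restr (W A J) f + var j * ?h" by simp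
      ultimately show "f \<in> adjoin n (mspan (W A J)) (var j)"
        using adjoinI[OF restr_in_mspan, of ?h n "W A J" f "var j"] by argo
    qed
  qed
qed

text \<open>
  Splitting is repeated until some generator is trivial or all of them contain a variable of \<open>J\<close>.
  Always splitting at the first remaining variable of a generator maintains that all indices
  before \<open>j \<in> J\<close> of the same colour are in \<open>A\<close>; hence the elements of \<open>J\<close> have different colours,
  as required in the end.
\<close>

lemma weakly_regular_W:
  assumes "A \<inter> J = {}" "J \<subseteq> L"
    and "\<And>i j. j \<in> J \<Longrightarrow> i \<in> L \<Longrightarrow> color i = color j \<Longrightarrow> i < j \<Longrightarrow> i \<in> A"
  shows "weakly_regular n (mspan (W A J) :: 'k::field mpoly set) regular_list"
  using assms
proof (induction "card (L - A - J)" arbitrary: A J rule: less_induct)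
  case less
  have finL: "finite L" using L_sub finite_subset by blast
  consider (unit) "\<exists>k\<in>{1..s}. u k \<subseteq> A" | (prime) "\<forall>k\<in>{1..s}. u k \<inter> J \<noteq> {}"
    | (split) k where "k \<in> {1..s}" "\<not> u k \<subseteq> A" "u k \<inter> J = {}"
    by blast
  then show ?case
  proof cases
    case unit
    then have "W A J = mons {1..n}" by (auto simp: W_def)
    then show ?thesis
      using weakly_regular_improper[OF regular_list_polys] by (simp add: polys_eq_mspan)
  next
    case prime
    have "W A J = {m \<in> mons {1..n}. \<exists>j\<in>J. lookup m j > 0}"
      using prime less.prems(1) unfolding W_def by blast
    moreover have inj: "inj_on color J"
    proof (rule inj_onI)
      fix i j assume "i \<in> J" "j \<in> J" "color i = color j"
      then show "i = j"
        using less.prems by (metis disjoint_iff linorder_neqE_nat subsetD)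
    qed
    moreover have "weakly_regular n (kern J {} :: 'k mpoly set)
        (map theta (sorted_list_of_set ({1..n} - C)))"
      by (rule weakly_regular_kern[OF less.prems(2) inj]) simp_all
    ultimately show ?thesis
      by (simp add: regular_list_def kern_empty[OF less.prems(2) inj])
  next
    case split
    \<comment> \<open>Splitting at the first remaining variable keeps the colours in \<open>J\<close>
      different.\<close>
    define j where "j = (LEAST j. j \<in> u k - A)"
    have j: "j \<in> u k" "j \<notin> A" using LeastI_ex[of "\<lambda>j. j \<in> u k - A"] split(2) by (auto simp: j_def)
    have least: "i \<in> A" if "i \<in> u k" "i < j" for i
      using not_less_Least[of i "\<lambda>j. j \<in> u k - A"] that by (auto simp: j_def)
    have jL: "j \<in> L" using j(1) split(1) by (auto simp: L_def)
    have jJ: "j \<notin> J" using j(1) split(3) by blast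
    have smaller: "card (L - insert j A - J) < card (L - A - J)"
      "card (L - A - insert j J) < card (L - A - J)"
      by (rule psubset_card_mono; use jL jJ j(2) finL in blast)+
    show ?thesis
    proof (rule weakly_regular_W_split[OF _ jJ _ _ regular_list_polys])
      show "j \<in> {1..n}" using jL L_sub by blast
      show "weakly_regular n (mspan (W (insert j A) J) :: 'k mpoly set) regular_list"
        using less.prems jJ by (intro less.hyps[OF smaller(1)]) blast+
      show "weakly_regular n (mspan (W A (insert j J)) :: 'k mpoly set) regular_list"
      proof (rule less.hyps[OF smaller(2)])
        show "A \<inter> insert j J = {}" "insert j J \<subseteq> L" using less.prems j jL by auto
        fix i l assume l: "l \<in> insert j J" and i: "i \<in> L" "color i = color l" "i < l"
        show "i \<in> A"
        proof (cases "l = j")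
          case True
          obtain k' where k': "k' \<in> {1..s}" "i \<in> u k'" using i(1) by (auto simp: L_def)
          have "i \<in> u k" using color_convex[OF k'(1) split(1) k'(2) j(1)] i True by simp
          then show ?thesis using least i True by simp
        next
          case False
          then show ?thesis using l i less.prems(3) by blast
        qed
      qed
    qed
  qed
qed

theorem regular_list_weakly_regular:
  "weakly_regular n (mspan V :: 'k::field mpoly set) regular_list"
proof -
  have "W {} {} = V" by (auto simp: W_def V_def dividing_def)
  then show ?thesis using weakly_regular_W[of "{}" "{}"] by simp
qed

lemma length_regular_list: "length regular_list = n - s"
  by (simp add: regular_list_def card_non_private[simplified])

end

section \<open>Koszul chains and the length of regular sequences\<close>

text \<open>
  A chain of the Koszul complex is given by its coefficients at the basis elements \<open>e\<^sub>A\<close>, for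
  finite sets \<open>A\<close>. The sign is the one of moving \<open>e\<^sub>i\<close> to its place in \<open>A\<close>.
\<close>

definition koszul_sign :: "nat \<Rightarrow> nat set \<Rightarrow> 'k::field mpoly" where
  "koszul_sign i A = (- 1) ^ card {j \<in> A. j < i}"

text \<open>
  The interior product with the \<open>i\<close>-th coordinate form.
\<close>

definition contract :: "nat \<Rightarrow> (nat set \<Rightarrow> 'k::field mpoly) \<Rightarrow> nat set \<Rightarrow> 'k mpoly" where
  "contract i z A = (if i \<in> A then 0 else koszul_sign i A * z (insert i A))"

text \<open>
  The exterior product with \<open>e\<^sub>i\<close>.
\<close>

definition wedge :: "nat \<Rightarrow> (nat set \<Rightarrow> 'k::field mpoly) \<Rightarrow> nat set \<Rightarrow> 'k mpoly" where
  "wedge i z A = (if i \<in> A then koszul_sign i A * z (A - {i}) else 0)"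

definition koszul_boundary :: "nat \<Rightarrow> (nat set \<Rightarrow> 'k::field mpoly) \<Rightarrow> nat set \<Rightarrow> 'k mpoly" where
  "koszul_boundary n z A = (\<Sum>i=1..n. var i * contract i z A)"

text \<open>
  The exterior product with \<open>\<Sum>i. h i e\<^sub>i\<close>, a homotopy between zero and multiplication by
  \<open>\<Sum>i. x\<^sub>i h i\<close>.
\<close>

definition koszul_wedge ::
    "nat \<Rightarrow> (nat \<Rightarrow> 'k::field mpoly) \<Rightarrow> (nat set \<Rightarrow> 'k mpoly) \<Rightarrow> nat set \<Rightarrow> 'k mpoly" where
  "koszul_wedge n h z A = (\<Sum>i=1..n. h i * wedge i z A)"

text \<open>
  A chain has polynomial coefficients, supported on the subsets of \<open>{1..n}\<close>.
\<close>

definition koszul_chain :: "nat \<Rightarrow> (nat set \<Rightarrow> 'k::field mpoly) \<Rightarrow> bool" where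
  "koszul_chain n z \<longleftrightarrow> (\<forall>A. z A \<in> polys {1..n}) \<and> (\<forall>A. \<not> A \<subseteq> {1..n} \<longrightarrow> z A = 0)"

lemma koszul_chain_zero: "koszul_chain n z \<Longrightarrow> \<not> A \<subseteq> {1..n} \<Longrightarrow> z A = 0"
  by (simp add: koszul_chain_def)

lemma koszul_sign_square: "koszul_sign i A * koszul_sign i A = 1"
  by (simp add: koszul_sign_def flip: power_mult_distrib)

lemma koszul_sign_polys: "koszul_sign i A \<in> polys Z"
  unfolding koszul_sign_def by (intro polys_power polys_uminus polys_one)

lemma koszul_sign_self:
  "koszul_sign i (insert i A) = koszul_sign i A" "koszul_sign i (A - {i}) = koszul_sign i A"
proof -
  have "{j \<in> insert i A. j < i} = {j \<in> A. j < i}" "{j \<in> A - {i}. j < i} = {j \<in> A. j < i}" by auto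
  then show "koszul_sign i (insert i A) = koszul_sign i A" "koszul_sign i (A - {i}) = koszul_sign i A"
    by (simp_all add: koszul_sign_def)
qed

lemma koszul_sign_insert:
  assumes "j \<notin> A"
  shows "koszul_sign i (insert j A) = (if j < i then - koszul_sign i A else koszul_sign i A)"
proof (cases "j < i")
  case True
  have "finite {l \<in> A. l < i}" by (rule finite_subset[of _ "{..<i}"]) auto
  moreover have "{l \<in> insert j A. l < i} = insert j {l \<in> A. l < i}" using True by auto
  ultimately show ?thesis using True assms by (simp add: koszul_sign_def)
next
  case False
  then have "{l \<in> insert j A. l < i} = {l \<in> A. l < i}" by auto
  then show ?thesis using False by (simp add: koszul_sign_def)
qed

lemma koszul_sign_remove:
  assumes "j \<in> A"
  shows "koszul_sign i (A - {j}) =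
    (if j < i then - koszul_sign i A else koszul_sign i A :: 'k::field mpoly)"
proof -
  have "koszul_sign i (insert j (A - {j})) =
      (if j < i then - koszul_sign i (A - {j}) else koszul_sign i (A - {j}) :: 'k mpoly)"
    by (rule koszul_sign_insert) simp
  then show ?thesis using assms by (cases "j < i") (simp_all add: insert_absorb)
qed

lemma contract_wedge:
  "contract i (wedge j z) A = (if i = j then z A else 0) - wedge j (contract i z) A"
proof (cases "i = j")
  case True
  show ?thesis
  proof (cases "i \<in> A")
    case i: True
    then have "wedge j (contract i z) A = (koszul_sign i A * koszul_sign i A) * z A"
      using True by (simp add: wedge_def contract_def koszul_sign_self insert_absorb mult.assoc)
    then show ?thesis using True i by (simp add: contract_def koszul_sign_square)
  next
    case i: False
    then have "contract i (wedge j z) A = (koszul_sign i A * koszul_sign i A) * z A"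
      using True by (simp add: wedge_def contract_def koszul_sign_self mult.assoc)
    then show ?thesis using True i by (simp add: wedge_def koszul_sign_square)
  qed
next
  case False
  show ?thesis
  proof (cases "i \<notin> A \<and> j \<in> A")
    case True
    then have "insert i A - {j} = insert i (A - {j})" using False by auto
    then show ?thesis
      using True False
      by (simp add: contract_def wedge_def koszul_sign_insert koszul_sign_remove mult.left_commute)
  next
    case F: False
    then show ?thesis using False by (auto simp: contract_def wedge_def)
  qed
qed

lemma contract_contract: "contract i (contract j z) A = - contract j (contract i z) A"
proof (cases "i = j \<or> i \<in> A \<or> j \<in> A")
  case True
  then show ?thesis by (auto simp: contract_def)
next
  case False
  then show ?thesis
    by (simp add: contract_def koszul_sign_insert insert_commute[of i j] mult.left_commute)
qed

lemma contract_twice: "contract i (contract i z) A = 0"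
  by (simp add: contract_def)

text \<open>
  The characteristic may be two, so it is not enough that the sum equals its own negative; the
  terms have to be cancelled in pairs.
\<close>

lemma sum_antisymmetric:
  fixes g :: "nat \<Rightarrow> nat \<Rightarrow> 'a::ab_group_add"
  assumes "\<And>i j. g i j = - g j i" "\<And>i. g i i = 0"
  shows "(\<Sum>i=1..n. \<Sum>j=1..n. g i j) = 0"
proof (induction n)
  case (Suc n)
  have "(\<Sum>i=1..Suc n. \<Sum>j=1..Suc n. g i j) =
      (\<Sum>i=1..n. \<Sum>j=1..n. g i j) + ((\<Sum>i=1..n. g i (Suc n)) + (\<Sum>j=1..n. g (Suc n) j)) +
      g (Suc n) (Suc n)"
    by (simp add: sum.distrib algebra_simps)
  also have "(\<Sum>i=1..n. g i (Suc n)) + (\<Sum>j=1..n. g (Suc n) j) = 0"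
    unfolding sum.distrib[symmetric] by (rule sum.neutral) (simp add: assms(1)[of _ "Suc n"])
  finally show ?case using Suc assms(2) by simp
qed simp

lemma contract_sum: "contract i (\<lambda>A. \<Sum>j\<in>S. f j A) A = (\<Sum>j\<in>S. contract i (f j) A)"
  by (simp add: contract_def sum_distrib_left)

lemma contract_scale: "contract i (\<lambda>A. p * z A) A = p * contract i z A"
  by (simp add: contract_def mult.left_commute)

lemma wedge_sum: "wedge i (\<lambda>A. \<Sum>j\<in>S. f j A) A = (\<Sum>j\<in>S. wedge i (f j) A)"
  by (simp add: wedge_def sum_distrib_left)

lemma wedge_scale: "wedge i (\<lambda>A. p * z A) A = p * wedge i z A"
  by (simp add: wedge_def mult.left_commute)

lemma koszul_boundary_diff:
  "koszul_boundary n (\<lambda>A. y A - z A) A = koszul_boundary n y A - koszul_boundary n z A"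
  by (simp add: koszul_boundary_def contract_def right_diff_distrib if_distrib sum_subtractf[symmetric]
      cong: if_cong)

lemma koszul_boundary_scale:
  "koszul_boundary n (\<lambda>A. p * z A) A = p * koszul_boundary n z A"
  by (simp add: koszul_boundary_def contract_scale sum_distrib_left mult.left_commute)

lemma koszul_boundary_boundary: "koszul_boundary n (koszul_boundary n z) A = 0"
proof -
  have "koszul_boundary n (koszul_boundary n z) A =
      (\<Sum>i=1..n. var i * contract i (\<lambda>A. \<Sum>j=1..n. var j * contract j z A) A)"
    by (simp only: koszul_boundary_def[abs_def])
  also have "\<dots> = (\<Sum>i=1..n. \<Sum>j=1..n. (var i * var j) * contract i (contract j z) A)"
    by (simp add: contract_sum contract_scale sum_distrib_left mult.assoc)
  also have "\<dots> = 0"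
  proof (rule sum_antisymmetric)
    fix i j
    show "(var i * var j) * contract i (contract j z) A =
        - ((var j * var i) * contract j (contract i z) A)"
      unfolding contract_contract[of i j z A] by (simp add: mult.commute)
  qed (simp add: contract_twice)
  finally show ?thesis .
qed

lemma koszul_homotopy:
  "koszul_boundary n (koszul_wedge n h z) A =
    (\<Sum>i=1..n. var i * h i) * z A - koszul_wedge n h (koszul_boundary n z) A"
proof -
  have "koszul_boundary n (koszul_wedge n h z) A =
      (\<Sum>i=1..n. var i * contract i (\<lambda>A. \<Sum>j=1..n. h j * wedge j z A) A)"
    by (simp only: koszul_boundary_def[abs_def] koszul_wedge_def[abs_def])
  also have "\<dots> = (\<Sum>i=1..n. \<Sum>j=1..n. var i * (h j * contract i (wedge j z) A))"
    by (simp add: contract_sum contract_scale sum_distrib_left)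
  also have "\<dots> = (\<Sum>i=1..n. \<Sum>j=1..n. (if i = j then var i * h j * z A else 0)) -
      (\<Sum>i=1..n. \<Sum>j=1..n. var i * (h j * wedge j (contract i z) A))"
    unfolding sum_subtractf[symmetric]
    by (intro sum.cong refl) (simp add: contract_wedge right_diff_distrib mult.assoc)
  also have "(\<Sum>i=1..n. \<Sum>j=1..n. (if i = j then var i * h j * z A else 0)) =
      (\<Sum>i=1..n. var i * h i) * z A"
    by (simp add: sum_distrib_right)
  also have "(\<Sum>i=1..n. \<Sum>j=1..n. var i * (h j * wedge j (contract i z) A)) =
      (\<Sum>j=1..n. h j * wedge j (\<lambda>A. \<Sum>i=1..n. var i * contract i z A) A)"
    by (subst sum.swap) (simp add: wedge_sum wedge_scale sum_distrib_left mult.left_commute)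
  also have "\<dots> = koszul_wedge n h (koszul_boundary n z) A"
    by (simp only: koszul_wedge_def[abs_def] koszul_boundary_def[abs_def])
  finally show ?thesis .
qed

lemma koszul_boundary_in_ideal:
  assumes J: "ideal J (mpoly_ring n)" and "\<And>A. z A \<in> J"
  shows "koszul_boundary n z A \<in> J"
  unfolding koszul_boundary_def
proof (rule ideal_sum_closed[OF J])
  fix i assume i: "i \<in> {1..n}"
  have "contract i z A \<in> J"
    using ideal_mpoly_ringD(2)[OF J] ideal_mpoly_ringD(4)[OF J assms(2) koszul_sign_polys]
    by (simp add: contract_def)
  then show "var i * contract i z A \<in> J"
    using ideal_mpoly_ringD(4)[OF J _ polys_var[OF i]] by simp
qed

lemma koszul_wedge_in_ideal:
  assumes J: "ideal J (mpoly_ring n)" and "\<And>A. z A \<in> J" "\<And>i. i \<in> {1..n} \<Longrightarrow> h i \<in> polys {1..n}"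
  shows "koszul_wedge n h z A \<in> J"
  unfolding koszul_wedge_def
proof (rule ideal_sum_closed[OF J])
  fix i assume i: "i \<in> {1..n}"
  have "wedge i z A \<in> J"
    using ideal_mpoly_ringD(2)[OF J] ideal_mpoly_ringD(4)[OF J assms(2) koszul_sign_polys]
    by (simp add: wedge_def)
  then show "h i * wedge i z A \<in> J"
    using ideal_mpoly_ringD(4)[OF J _ assms(3)[OF i]] by simp
qed

lemma ideal_polys: "ideal (polys {1..n} :: 'k::field mpoly set) (mpoly_ring n)"
  by (rule ideal_mpoly_ringI) (auto intro: polys_add polys_mult)

lemma koszul_chain_boundary:
  assumes "koszul_chain n z"
  shows "koszul_boundary n z A \<in> polys {1..n}" "\<not> A \<subseteq> {1..n} \<Longrightarrow> koszul_boundary n z A = 0"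
proof -
  show "koszul_boundary n z A \<in> polys {1..n}"
    by (rule koszul_boundary_in_ideal[OF ideal_polys]) (use assms in \<open>simp add: koszul_chain_def\<close>)
  assume "\<not> A \<subseteq> {1..n}"
  then have "z (insert i A) = 0" for i
    using koszul_chain_zero[OF assms, of "insert i A"] by auto
  then show "koszul_boundary n z A = 0"
    by (simp add: koszul_boundary_def contract_def cong: if_cong)
qed

lemma koszul_chain_wedge:
  assumes "koszul_chain n z" "\<And>i. i \<in> {1..n} \<Longrightarrow> h i \<in> polys {1..n}"
  shows "koszul_chain n (koszul_wedge n h z)"
  unfolding koszul_chain_def
proof (intro conjI allI impI)
  fix A
  show "koszul_wedge n h z A \<in> polys {1..n}"
    by (rule koszul_wedge_in_ideal[OF ideal_polys _ assms(2)])
      (use assms in \<open>simp_all add: koszul_chain_def\<close>)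
  assume A: "\<not> A \<subseteq> {1..n}"
  have "wedge i z A = 0" if i: "i \<in> {1..n}" for i
  proof -
    have "\<not> A - {i} \<subseteq> {1..n}" using A i by blast
    then have "z (A - {i}) = 0" using koszul_chain_zero[OF assms(1)] by simp
    then show ?thesis by (simp add: wedge_def)
  qed
  then show "koszul_wedge n h z A = 0"
    unfolding koszul_wedge_def by (intro sum.neutral) simp
qed

text \<open>
  Let \<open>z\<close> be a cycle modulo \<open>J\<close> that is not a boundary, and let \<open>r = \<Sum>i. x\<^sub>i h i\<close> be regular on
  \<open>S/J\<close>. By the homotopy formula the product \<open>z'\<close> of \<open>\<Sum>i. h i e\<^sub>i\<close> with \<open>z\<close> has boundary \<open>r z\<close>
  modulo \<open>J\<close>, so it is a cycle modulo \<open>J + (r)\<close>. If it were a boundary there, say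
  \<open>z' = d y + r g\<close> modulo \<open>J\<close>, applying \<open>d\<close> would give \<open>r z = r d g\<close>, and cancelling \<open>r\<close> would make
  \<open>z\<close> a boundary. So each element of the sequence moves a nonzero class up by one degree.
\<close>

theorem koszul_length_bound:
  fixes z :: "nat set \<Rightarrow> 'k::field mpoly"
  assumes "ideal J (mpoly_ring n)" "weakly_regular n J rs"
    and "\<And>r. r \<in> set rs \<Longrightarrow> \<exists>h. (\<forall>i\<in>{1..n}. h i \<in> polys {1..n}) \<and> r = (\<Sum>i=1..n. var i * h i)"
    and "koszul_chain n z" "\<And>A. z A \<noteq> 0 \<Longrightarrow> card A = p"
    and "\<And>A. koszul_boundary n z A \<in> J"
    and "\<not> (\<exists>y. koszul_chain n y \<and> (\<forall>A. z A - koszul_boundary n y A \<in> J))"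
  shows "p + length rs \<le> n"
  using assms
proof (induction rs arbitrary: J z p)
  case Nil
  have "\<exists>A. z A \<noteq> 0"
  proof (rule ccontr)
    assume "\<not> ?thesis"
    then have "koszul_chain n (\<lambda>A. 0 :: 'k mpoly) \<and>
        (\<forall>A. z A - koszul_boundary n (\<lambda>A. 0) A \<in> J)"
      using ideal_mpoly_ringD(2)[OF Nil.prems(1)]
      by (simp add: koszul_chain_def koszul_boundary_def contract_def cong: if_cong)
    then show False using Nil.prems(7) by blast
  qed
  then obtain A where A: "z A \<noteq> 0" by auto
  then have "A \<subseteq> {1..n}" using koszul_chain_zero[OF Nil.prems(4), of A] by argo
  then have "card A \<le> n" using card_mono[of "{1..n}" A] by simp
  then show ?case using Nil.prems(5)[OF A] by simp
next
  case (Cons r rs)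
  note J = ideal_mpoly_ringD[OF Cons.prems(1)]
  obtain h where h': "(\<forall>i\<in>{1..n}. h i \<in> polys {1..n}) \<and> r = (\<Sum>i=1..n. var i * h i)"
    using Cons.prems(3)[OF list.set_intros(1)] by (elim exE)
  then have h: "\<And>i. i \<in> {1..n} \<Longrightarrow> h i \<in> polys {1..n}" "r = (\<Sum>i=1..n. var i * h i)"
    by blast+
  have r: "r \<in> polys {1..n}"
    unfolding h(2) by (intro polys_sum polys_mult polys_var h(1))
  have reg: "\<And>f. f \<in> polys {1..n} \<Longrightarrow> r * f \<in> J \<Longrightarrow> f \<in> J"
    and reg': "weakly_regular n (adjoin n J r) rs"
    using Cons.prems(2) by auto
  let ?z = "koszul_wedge n h z"
  have zp: "z A \<in> polys {1..n}" for A using Cons.prems(4) by (simp add: koszul_chain_def)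
  have H: "koszul_wedge n h (koszul_boundary n z) A \<in> J" for A
    by (rule koszul_wedge_in_ideal[OF Cons.prems(1) Cons.prems(6) h(1)])
  have bz: "koszul_boundary n ?z A = r * z A - koszul_wedge n h (koszul_boundary n z) A" for A
    unfolding koszul_homotopy h(2) ..
  have "Suc p + length rs \<le> n"
  proof (rule Cons.IH[OF ideal_adjoin[OF Cons.prems(1) r] reg'])
    show "\<exists>h. (\<forall>i\<in>{1..n}. h i \<in> polys {1..n}) \<and> r' = (\<Sum>i=1..n. var i * h i)"
      if "r' \<in> set rs" for r' using Cons.prems(3)[of r'] that by simp
    show "koszul_chain n ?z" by (rule koszul_chain_wedge[OF Cons.prems(4) h(1)])
    show "card A = Suc p" if "?z A \<noteq> 0" for A
    proof -
      have "\<exists>i\<in>{1..n}. h i * wedge i z A \<noteq> 0"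
        using that unfolding koszul_wedge_def by (meson sum.neutral)
      then obtain i where i: "i \<in> A" "z (A - {i}) \<noteq> 0" by (auto simp: wedge_def split: if_splits)
      then have c: "card (A - {i}) = p" using Cons.prems(5) by blast
      have "A - {i} \<subseteq> {1..n}" using i(2) koszul_chain_zero[OF Cons.prems(4), of "A - {i}"] by argo
      then have "finite A" using finite_subset[of "A - {i}" "{1..n}"] by simp
      then show ?thesis using c card_Suc_Diff1[OF _ i(1)] by simp
    qed
    show "koszul_boundary n ?z A \<in> adjoin n J r" for A
    proof -
      have "- koszul_wedge n h (koszul_boundary n z) A \<in> J" using J(5)[OF J(2) H] by simp
      from adjoinI[OF this zp[of A], of r] show ?thesis unfolding bz by simp
    qed
    show "\<not> (\<exists>y. koszul_chain n y \<and> (\<forall>A. ?z A - koszul_boundary n y A \<in> adjoin n J r))"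
    proof
      assume "\<exists>y. koszul_chain n y \<and> (\<forall>A. ?z A - koszul_boundary n y A \<in> adjoin n J r)"
      then obtain y where y: "koszul_chain n y"
        "\<And>A. ?z A - koszul_boundary n y A \<in> adjoin n J r" by blast
      have "\<forall>A. \<exists>q g. q \<in> J \<and> g \<in> polys {1..n} \<and> (\<not> A \<subseteq> {1..n} \<longrightarrow> g = 0) \<and>
          ?z A - koszul_boundary n y A = q + r * g"
      proof
        fix A
        show "\<exists>q g. q \<in> J \<and> g \<in> polys {1..n} \<and> (\<not> A \<subseteq> {1..n} \<longrightarrow> g = 0) \<and>
            ?z A - koszul_boundary n y A = q + r * g"
        proof (cases "A \<subseteq> {1..n}")
          case True
          then show ?thesis using y(2)[of A] unfolding adjoin_def by blast
        next
          case False
          then have "?z A = 0" "koszul_boundary n y A = 0"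
            using koszul_chain_boundary(2)[OF y(1)]
              koszul_chain_zero[OF koszul_chain_wedge[OF Cons.prems(4) h(1)]] by simp_all
          then show ?thesis using J(2) by (intro exI[of _ 0]) simp
        qed
      qed
      then obtain q g where qg: "\<And>A. q A \<in> J" "\<And>A. g A \<in> polys {1..n}"
          "\<And>A. \<not> A \<subseteq> {1..n} \<Longrightarrow> g A = 0"
          "\<And>A. ?z A - koszul_boundary n y A = q A + r * g A"
        by metis
      have g: "koszul_chain n g" using qg by (simp add: koszul_chain_def)
      have "z A - koszul_boundary n g A \<in> J" for A
      proof (rule reg)
        show "z A - koszul_boundary n g A \<in> polys {1..n}"
          using polys_diff[OF zp koszul_chain_boundary(1)[OF g]] .
        have "q = (\<lambda>A. (?z A - koszul_boundary n y A) - r * g A)"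
          using qg(4) by (intro ext) simp
        then have "koszul_boundary n q A =
            koszul_boundary n ?z A - 0 - r * koszul_boundary n g A"
          by (simp only: koszul_boundary_diff koszul_boundary_scale koszul_boundary_boundary)
        then have "r * (z A - koszul_boundary n g A) =
            koszul_boundary n q A + koszul_wedge n h (koszul_boundary n z) A"
          unfolding bz by (simp add: algebra_simps)
        then show "r * (z A - koszul_boundary n g A) \<in> J"
          using J(3)[OF koszul_boundary_in_ideal[OF Cons.prems(1) qg(1)] H] by simp
      qed
      then show False using Cons.prems(7) g by blast
    qed
  qed
  then show ?case by simp
qed

section \<open>Depth of the quotient\<close>

lemma abelian_monoid_quot:
  assumes I: "ideal I (mpoly_ring n)"
  shows "abelian_monoid (quot_module (mpoly_ring n) I)"
  by (rule abelian_monoidI)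
    (auto simp: quot_module_simps[OF I] ac_simps polys_add simp del: One_nat_def)

lemma finsum_quot:
  assumes I: "ideal I (mpoly_ring n)" and "finite A" "\<And>i. i \<in> A \<Longrightarrow> g i \<in> polys {1..n}"
    and "\<And>i. i \<in> A \<Longrightarrow> F i = I +>\<^bsub>mpoly_ring n\<^esub> g i"
  shows "(\<Oplus>\<^bsub>quot_module (mpoly_ring n) I\<^esub>i\<in>A. F i) = I +>\<^bsub>mpoly_ring n\<^esub> sum g A"
proof -
  interpret abelian_monoid "quot_module (mpoly_ring n) I" by (rule abelian_monoid_quot[OF I])
  show ?thesis
    using assms(2-)
  proof (induction A rule: finite_induct)
    case empty
    then show ?case by (simp add: quot_module_simps(2)[OF I])
  next
    case (insert x A)
    then have "(\<Oplus>\<^bsub>quot_module (mpoly_ring n) I\<^esub>i\<in>insert x A. F i) =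
        F x \<oplus>\<^bsub>quot_module (mpoly_ring n) I\<^esub> (\<Oplus>\<^bsub>quot_module (mpoly_ring n) I\<^esub>i\<in>A. F i)"
      by (intro finsum_insert) (auto simp: quot_module_simps(1)[OF I])
    also have "(\<Oplus>\<^bsub>quot_module (mpoly_ring n) I\<^esub>i\<in>A. F i) = I +>\<^bsub>mpoly_ring n\<^esub> sum g A"
      using insert by simp
    finally show ?case
      using insert quot_module_simps(3)[OF I insert.prems(1)[of x] polys_sum[of A g]] by simp
  qed
qed

lemma ideal_foldl_adjoin:
  "ideal I (mpoly_ring n) \<Longrightarrow> set rs \<subseteq> polys {1..n} \<Longrightarrow> ideal (foldl (adjoin n) I rs) (mpoly_ring n)"
proof (induction rs arbitrary: I)
  case (Cons r rs)
  have "ideal (adjoin n I r) (mpoly_ring n)"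
    by (rule ideal_adjoin) (use Cons.prems in auto)
  then show ?case using Cons by simp
qed simp

lemma foldl_adjoin_superset: "I \<subseteq> foldl (adjoin n) I rs"
  by (induction rs arbitrary: I) (use adjoin_superset in fastforce)+

text \<open>
  This is the submodule \<open>(r\<^sub>1, \<dots>, r\<^sub>k) (S/I)\<close> pulled back to \<open>S\<close>.
\<close>

lemma foldl_adjoin_eq:
  assumes I: "ideal I (mpoly_ring n)"
  shows "foldl (adjoin n) I rs =
    {p + (\<Sum>i<length rs. rs ! i * h i) | p h. p \<in> I \<and> (\<forall>i. h i \<in> polys {1..n})}"
proof (induction rs rule: rev_induct)
  case Nil
  show ?case using polys_zero by (auto intro!: exI[of _ "\<lambda>_. 0"])
next
  case (snoc r rs)
  have sums: "(\<Sum>i<length (rs @ [r]). (rs @ [r]) ! i * h i) =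
      (\<Sum>i<length rs. rs ! i * h i) + r * h (length rs)" for h
    by (simp add: nth_append)
  show ?case
    unfolding sums foldl_append foldl_Cons foldl_Nil
  proof (intro equalityI subsetI)
    fix f assume "f \<in> adjoin n (foldl (adjoin n) I rs) r"
    then obtain g h' where f: "f = g + r * h'" "g \<in> foldl (adjoin n) I rs" "h' \<in> polys {1..n}"
      by (auto simp: adjoin_def)
    obtain p h where g: "g = p + (\<Sum>i<length rs. rs ! i * h i)" "p \<in> I" "\<And>i. h i \<in> polys {1..n}"
      using f(2) unfolding snoc by auto
    show "f \<in> {p + ((\<Sum>i<length rs. rs ! i * h i) + r * h (length rs)) | p h.
        p \<in> I \<and> (\<forall>i. h i \<in> polys {1..n})}"
      using f g by (intro CollectI exI[of _ p] exI[of _ "h(length rs := h')"])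
        (simp add: add.assoc)
  next
    fix f assume "f \<in> {p + ((\<Sum>i<length rs. rs ! i * h i) + r * h (length rs)) | p h.
        p \<in> I \<and> (\<forall>i. h i \<in> polys {1..n})}"
    then obtain p h where f: "f = p + ((\<Sum>i<length rs. rs ! i * h i) + r * h (length rs))"
        "p \<in> I" "\<And>i. h i \<in> polys {1..n}" by auto
    have "p + (\<Sum>i<length rs. rs ! i * h i) \<in> foldl (adjoin n) I rs"
      unfolding snoc using f by blast
    from adjoinI[OF this f(3)[of "length rs"], of r]
    show "f \<in> adjoin n (foldl (adjoin n) I rs) r" using f(1) by (simp add: add.assoc)
  qed
qed

lemma seq_submodule_quot:
  assumes I: "ideal I (mpoly_ring n)" and rs: "set rs \<subseteq> polys {1..n}"
  shows "seq_submodule (quot_module (mpoly_ring n) I) rs =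
    (\<lambda>f. I +>\<^bsub>mpoly_ring n\<^esub> f) ` foldl (adjoin n) I rs"
proof (intro equalityI subsetI)
  let ?M = "quot_module (mpoly_ring n) I" and ?c = "\<lambda>f. I +>\<^bsub>mpoly_ring n\<^esub> f"
  have rsp: "rs ! i \<in> polys {1..n}" if "i < length rs" for i using rs that by auto
  have sum: "(\<Oplus>\<^bsub>?M\<^esub>i\<in>{..<length rs}. rs ! i \<odot>\<^bsub>?M\<^esub> f i) = ?c (\<Sum>i<length rs. rs ! i * h i)"
    if "\<And>i. h i \<in> polys {1..n}" "\<And>i. i < length rs \<Longrightarrow> f i = ?c (h i)" for f h
    using that rsp by (intro finsum_quot[OF I]) (auto simp: quot_module_simps(4)[OF I] polys_mult)
  {
    fix X assume "X \<in> seq_submodule ?M rs"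
    then obtain f where f: "X = (\<Oplus>\<^bsub>?M\<^esub>i\<in>{..<length rs}. rs ! i \<odot>\<^bsub>?M\<^esub> f i)"
        "f \<in> {..<length rs} \<rightarrow> ?c ` polys {1..n}"
      unfolding seq_submodule_def quot_module_simps(1)[OF I] by auto
    have "\<forall>i. \<exists>h. h \<in> polys {1..n} \<and> (i < length rs \<longrightarrow> f i = ?c h)"
    proof
      fix i
      show "\<exists>h. h \<in> polys {1..n} \<and> (i < length rs \<longrightarrow> f i = ?c h)"
      proof (cases "i < length rs")
        case True
        then have "f i \<in> ?c ` polys {1..n}" using f(2) by auto
        then show ?thesis by auto
      qed (use polys_zero in blast)
    qed
    then obtain h where h: "\<And>i. h i \<in> polys {1..n}" "\<And>i. i < length rs \<Longrightarrow> f i = ?c (h i)"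
      by metis
    have "0 + (\<Sum>i<length rs. rs ! i * h i) \<in> foldl (adjoin n) I rs"
      unfolding foldl_adjoin_eq[OF I] using h(1) ideal_mpoly_ringD(2)[OF I] by blast
    then show "X \<in> ?c ` foldl (adjoin n) I rs"
      using sum[OF h] f(1) by auto
  }
  fix X assume "X \<in> ?c ` foldl (adjoin n) I rs"
  then obtain p h where X: "X = ?c (p + (\<Sum>i<length rs. rs ! i * h i))" and p: "p \<in> I"
      and h: "\<And>i. h i \<in> polys {1..n}"
    unfolding foldl_adjoin_eq[OF I] by auto
  have S: "(\<Sum>i<length rs. rs ! i * h i) \<in> polys {1..n}"
    using rsp h by (intro polys_sum polys_mult) auto
  have "X = ?c (\<Sum>i<length rs. rs ! i * h i)"
    unfolding X using p S ideal_mpoly_ringD(1)[OF I]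
    by (subst coset_eq_iff[OF I]) (auto intro: polys_add)
  also have "\<dots> = (\<Oplus>\<^bsub>?M\<^esub>i\<in>{..<length rs}. rs ! i \<odot>\<^bsub>?M\<^esub> ?c (h i))"
    using sum[of h "\<lambda>i. ?c (h i)"] h by simp
  finally show "X \<in> seq_submodule ?M rs"
    unfolding seq_submodule_def using h quot_module_simps(1)[OF I]
    by (intro CollectI exI[of _ "\<lambda>i. ?c (h i)"]) auto
qed

lemma weakly_regular_iff_nth:
  "weakly_regular n I rs \<longleftrightarrow> (\<forall>i<length rs. \<forall>f\<in>polys {1..n}.
    rs ! i * f \<in> foldl (adjoin n) I (take i rs) \<longrightarrow> f \<in> foldl (adjoin n) I (take i rs))"
proof (induction rs arbitrary: I)
  case (Cons r rs)
  show ?case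
    unfolding weakly_regular.simps Cons.IH[of "adjoin n I r"]
    by (simp only: length_Cons All_less_Suc2)
      (simp only: nth_Cons_0 nth_Cons_Suc take_0 take_Suc_Cons foldl_Cons foldl_Nil)
qed (simp only: weakly_regular.simps list.size not_less0 simp_thms)

lemma regular_sequence_quot:
  assumes I: "ideal I (mpoly_ring n)" and rs: "set rs \<subseteq> polys {1..n}"
  shows "regular_sequence (quot_module (mpoly_ring n) I) rs \<longleftrightarrow>
    weakly_regular n I rs \<and> foldl (adjoin n) I rs \<noteq> polys {1..n}"
proof -
  let ?M = "quot_module (mpoly_ring n) I" and ?c = "\<lambda>f. I +>\<^bsub>mpoly_ring n\<^esub> f"
  have take: "set (take i rs) \<subseteq> polys {1..n}" for i by (rule subset_trans[OF set_take_subset rs])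
  have mem: "?c f \<in> seq_submodule ?M (take i rs) \<longleftrightarrow> f \<in> foldl (adjoin n) I (take i rs)"
    if f: "f \<in> polys {1..n}" for f i
  proof
    let ?J = "foldl (adjoin n) I (take i rs)"
    note J = ideal_mpoly_ringD[OF ideal_foldl_adjoin[OF I take[of i]]]
    show "f \<in> ?J \<Longrightarrow> ?c f \<in> seq_submodule ?M (take i rs)"
      unfolding seq_submodule_quot[OF I take] by blast
    assume "?c f \<in> seq_submodule ?M (take i rs)"
    then obtain g where g: "g \<in> ?J" "?c f = ?c g"
      unfolding seq_submodule_quot[OF I take] by blast
    have "f - g \<in> I"
      using iffD1[OF coset_eq_iff[OF I f subsetD[OF J(1) g(1)]] g(2)] .
    then have "f - g \<in> ?J" by (rule subsetD[OF foldl_adjoin_superset])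
    from J(3)[OF this g(1)] show "f \<in> ?J" by simp
  qed
  have "(\<forall>i<length rs. \<forall>v\<in>carrier ?M. rs ! i \<odot>\<^bsub>?M\<^esub> v \<in> seq_submodule ?M (take i rs) \<longrightarrow>
      v \<in> seq_submodule ?M (take i rs)) \<longleftrightarrow> weakly_regular n I rs"
  proof -
    have "rs ! i \<odot>\<^bsub>?M\<^esub> ?c f \<in> seq_submodule ?M (take i rs) \<longleftrightarrow>
        rs ! i * f \<in> foldl (adjoin n) I (take i rs)"
      if "i < length rs" "f \<in> polys {1..n}" for i f
    proof -
      have r: "rs ! i \<in> polys {1..n}" using rs that(1) by auto
      show ?thesis
        unfolding quot_module_simps(4)[OF I r that(2)] by (rule mem[OF polys_mult[OF r that(2)]])
    qed
    then show ?thesis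
      unfolding weakly_regular_iff_nth quot_module_simps(1)[OF I] using mem by simp
  qed
  moreover have "seq_submodule ?M rs \<noteq> carrier ?M \<longleftrightarrow> foldl (adjoin n) I rs \<noteq> polys {1..n}"
  proof -
    have sub: "foldl (adjoin n) I rs \<subseteq> polys {1..n}"
      by (rule ideal_mpoly_ringD(1)[OF ideal_foldl_adjoin[OF I rs]])
    have "seq_submodule ?M rs = carrier ?M \<longleftrightarrow> (\<forall>f\<in>polys {1..n}. ?c f \<in> seq_submodule ?M rs)"
      unfolding quot_module_simps(1)[OF I] seq_submodule_quot[OF I rs] using sub by blast
    also have "\<dots> \<longleftrightarrow> foldl (adjoin n) I rs = polys {1..n}"
      using mem[of _ "length rs"] sub by auto
    finally show ?thesis by simp
  qed
  ultimately show ?thesis by (simp add: regular_sequence_def)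
qed

lemma graded_max_ideal_ideal: "ideal (graded_max_ideal n :: 'k::field mpoly set) (mpoly_ring n)"
  unfolding graded_max_ideal_def
  by (rule ring.genideal_ideal[OF ring_mpoly_ring]) (auto intro: polys_var simp del: One_nat_def)

lemma var_in_graded_max_ideal: "i \<in> {1..n} \<Longrightarrow> var i \<in> graded_max_ideal n"
  unfolding graded_max_ideal_def
  by (rule subsetD[OF ring.genideal_self[OF ring_mpoly_ring]]) (auto intro: polys_var simp del: One_nat_def)

lemma graded_max_ideal_minimal:
  assumes "ideal J (mpoly_ring n)" "\<And>i. i \<in> {1..n} \<Longrightarrow> var i \<in> J"
  shows "graded_max_ideal n \<subseteq> J"
  unfolding graded_max_ideal_def
  by (rule ring.genideal_minimal[OF ring_mpoly_ring assms(1)]) (use assms(2) in blast)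

lemma graded_max_ideal_combination:
  fixes r :: "'k::field mpoly"
  assumes "r \<in> graded_max_ideal n"
  shows "\<exists>h. (\<forall>i\<in>{1..n}. h i \<in> polys {1..n}) \<and> r = (\<Sum>i=1..n. var i * h i)"
proof -
  let ?J = "{\<Sum>i=1..n. var i * h i | h. \<forall>i\<in>{1..n}. h i \<in> (polys {1..n} :: 'k mpoly set)}"
  have "graded_max_ideal n \<subseteq> ?J"
  proof (rule graded_max_ideal_minimal)
    show "ideal ?J (mpoly_ring n)"
    proof (rule ideal_mpoly_ringI)
      show "?J \<subseteq> polys {1..n}"
        by (auto intro!: polys_sum polys_mult polys_var simp del: One_nat_def)
      show "0 \<in> ?J" by (intro CollectI exI[of _ "\<lambda>_. 0"]) simp
      fix p q :: "'k mpoly" assume "p \<in> ?J"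
      then obtain h where h: "p = (\<Sum>i=1..n. var i * h i)" "\<forall>i\<in>{1..n}. h i \<in> polys {1..n}"
        by auto
      show "p + q \<in> ?J" if q: "q \<in> ?J"
      proof -
        obtain h' where h': "q = (\<Sum>i=1..n. var i * h' i)" "\<forall>i\<in>{1..n}. h' i \<in> polys {1..n}"
          using q by auto
        have "p + q = (\<Sum>i=1..n. var i * (h i + h' i))"
          unfolding h(1) h'(1) by (simp add: sum.distrib distrib_left)
        moreover have "\<forall>i\<in>{1..n}. h i + h' i \<in> polys {1..n}" using h(2) h'(2) polys_add by blast
        ultimately show ?thesis by (intro CollectI exI[of _ "\<lambda>i. h i + h' i"] conjI)
      qed
      show "q * p \<in> ?J" if q: "q \<in> polys {1..n}"
      proof -
        have "q * p = (\<Sum>i=1..n. var i * (q * h i))"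
          unfolding h(1) by (simp add: sum_distrib_left mult.left_commute)
        moreover have "\<forall>i\<in>{1..n}. q * h i \<in> polys {1..n}" using h(2) q polys_mult by blast
        ultimately show ?thesis by (intro CollectI exI[of _ "\<lambda>i. q * h i"] conjI)
      qed
    qed
    fix i assume i: "i \<in> {1..n}"
    have "var i = (\<Sum>l=1..n. var l * (if l = i then 1 else 0) :: 'k mpoly)"
      using i by (simp add: if_distrib cong: if_cong)
    moreover have "\<forall>l\<in>{1..n}. (if l = i then 1 else 0) \<in> (polys {1..n} :: 'k mpoly set)" by simp
    ultimately show "var i \<in> ?J"
      by (intro CollectI exI[of _ "\<lambda>l. if l = i then 1 else 0"] conjI)
  qed
  then show ?thesis using assms by blast
qed

context colored_private_variables
begin

text \<open>
  The sets that contain each colour exactly once.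
\<close>

definition transversals :: "nat set set" where
  "transversals = {A. A \<subseteq> L \<and> bij_betw color A {1..s}}"

text \<open>
  A linear form on chains that vanishes on boundaries and on chains with coefficients in the
  ideal, but not on \<open>socle_chain\<close>. It lives in the multidegree of the product of all covered
  variables, in which the coefficient of \<open>e\<^sub>A\<close> is a multiple of \<open>x\<^bsub>L - A\<^esub>\<close>.
\<close>

definition transversal_form :: "(nat set \<Rightarrow> 'k::field mpoly) \<Rightarrow> 'k" where
  "transversal_form z = (\<Sum>A\<in>transversals. lookup (z A) (ind (L - A)))"

text \<open>
  The chain \<open>x\<^bsub>L - C\<^esub> e\<^sub>C\<close>, which represents a nonzero class of degree \<open>s\<close>: multiplying its
  coefficient by a private variable gives a multiple of a generator.
\<close>

definition socle_chain :: "nat set \<Rightarrow> 'k::field mpoly" where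
  "socle_chain A = (if A = C then single (ind (L - C)) 1 else 0)"

lemma finite_L: "finite L"
  using L_sub finite_subset by blast

lemma finite_transversals: "finite transversals"
  by (rule finite_subset[of _ "Pow L"]) (auto simp: transversals_def finite_L)

lemma color_mono_L: "i \<in> L \<Longrightarrow> j \<in> L \<Longrightarrow> i \<le> j \<Longrightarrow> color i \<le> color j"
  unfolding L_def using color_mono by blast

lemma mspan_V_ideal: "ideal (mspan V :: 'k::field mpoly set) (mpoly_ring n)"
  by (rule ideal_mspan[OF V_mons V_up])

lemma C_subset_L: "C \<subseteq> L"
  using c_L by blast

lemma koszul_chain_socle: "koszul_chain n (socle_chain :: nat set \<Rightarrow> 'k::field mpoly)"
proof -
  have "keys (ind (L - C)) \<subseteq> {1..n}"
    using keys_ind[of "L - C"] finite_L L_sub by auto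
  then have "single (ind (L - C)) 1 \<in> (polys {1..n} :: 'k mpoly set)"
    unfolding polys_eq_mspan by (intro mspan_single) (simp add: mons_def)
  then show ?thesis
    using c_image by (simp add: koszul_chain_def socle_chain_def)
qed

lemma socle_chain_cycle: "koszul_boundary n socle_chain A \<in> (mspan V :: 'k::field mpoly set)"
  unfolding koszul_boundary_def
proof (rule ideal_sum_closed[OF mspan_V_ideal])
  fix i
  show "var i * contract i socle_chain A \<in> (mspan V :: 'k mpoly set)"
  proof (cases "i \<notin> A \<and> insert i A = C")
    case True
    then obtain k where k: "k \<in> {1..s}" "i = c k" by blast
    let ?m = "single i 1 + ind (L - C)"
    have l: "lookup ?m j > 0" if "j \<in> L - C \<or> j = i" for j
      using that finite_L by (auto simp: lookup_add lookup_ind lookup_single)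
    have "lookup ?m j > 0" if j: "j \<in> u k" for j
    proof (cases "j \<in> C")
      case True
      then have "j = i" using j k priv by blast
      then show ?thesis using l by blast
    next
      case False
      then have "j \<in> L - C" using j k(1) unfolding L_def by blast
      then show ?thesis using l by blast
    qed
    then have "k \<in> dividing s u ?m" using k(1) by (simp add: dividing_def)
    moreover have "?m \<in> mons {1..n}"
    proof -
      have "ind (L - C) \<in> mons {1..n}" using keys_ind[of "L - C"] finite_L L_sub by (auto simp: mons_def)
      then show ?thesis using c_in[OF k(1)] k(2) by (intro mons_add) simp_all
    qed
    ultimately have "?m \<in> V" by (auto simp: V_def)
    then have "single ?m 1 \<in> (mspan V :: 'k mpoly set)" by (rule mspan_single)
    then have "koszul_sign i A * single ?m 1 \<in> (mspan V :: 'k mpoly set)"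
      using koszul_sign_polys by (rule ideal_mpoly_ringD(4)[OF mspan_V_ideal])
    moreover have "var i * contract i socle_chain A = (koszul_sign i A * single ?m 1 :: 'k mpoly)"
      using True by (simp add: contract_def socle_chain_def var_def mult_single mult.left_commute)
    ultimately show ?thesis by (simp only:)
  next
    case False
    then have "contract i socle_chain A = (0 :: 'k mpoly)"
      by (auto simp: contract_def socle_chain_def)
    then show ?thesis by simp
  qed
qed

text \<open>
  A transversal meets every generator, as a colour class lies in the generator of its number.
  Therefore the complementary product of variables is not in the ideal.
\<close>

lemma transversal_form_ideal:
  assumes "\<And>A. z A \<in> mspan V"
  shows "transversal_form z = 0"
  unfolding transversal_form_def
proof (rule sum.neutral, rule ballI)
  fix A assume A: "A \<in> transversals"
  have "ind (L - A) \<notin> V"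
  proof
    assume "ind (L - A) \<in> V"
    then obtain k where k: "k \<in> {1..s}" "\<And>j. j \<in> u k \<Longrightarrow> lookup (ind (L - A)) j > 0"
      by (auto simp: V_def dividing_def)
    have "k \<in> color ` A" using A k(1) by (simp add: transversals_def bij_betw_def)
    then obtain j where j: "j \<in> A" "k = color j" by auto
    then have "j \<in> u k" using A color_L[of j] by (auto simp: transversals_def)
    then show False using k(2)[of j] j(1) finite_L by (simp add: lookup_ind)
  qed
  then show "lookup (z A) (ind (L - A)) = 0"
    using assms[of A] by (auto simp: mspan_def in_keys_iff)
qed

lemma transversal_form_socle: "transversal_form socle_chain = (1 :: 'k::field)"
proof -
  have "bij_betw color C {1..s}"
    unfolding bij_betw_def using color_c by (auto simp: inj_on_def image_image)
  then have C: "C \<in> transversals" using C_subset_L by (simp add: transversals_def)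
  have "transversal_form socle_chain = (\<Sum>A\<in>transversals. if A = C then 1 else (0 :: 'k))"
    unfolding transversal_form_def by (rule sum.cong) (auto simp: socle_chain_def)
  also have "\<dots> = 1" using C finite_transversals by simp
  finally show ?thesis .
qed

lemma lookup_koszul_sign_times:
  "lookup (koszul_sign i A * p) m = (- 1) ^ card {j \<in> A. j < i} * lookup p m"
  by (cases "even (card {j \<in> A. j < i})") (simp_all add: koszul_sign_def)

lemma lookup_boundary:
  assumes "A \<subseteq> L"
  shows "lookup (koszul_boundary n y A) (ind (L - A)) =
    (\<Sum>i\<in>L - A. (- 1) ^ card {j \<in> A. j < i} * lookup (y (insert i A)) (ind (L - insert i A)))"
proof -
  have "lookup (koszul_boundary n y A) (ind (L - A)) =
      (\<Sum>i=1..n. lookup (var i * contract i y A) (ind (L - A)))"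
    by (simp add: koszul_boundary_def lookup_sum)
  also have "\<dots> = (\<Sum>i\<in>L - A. lookup (var i * contract i y A) (ind (L - A)))"
  proof (rule sum.mono_neutral_right)
    show "L - A \<subseteq> {1..n}" using L_sub by blast
    show "\<forall>i\<in>{1..n} - (L - A). lookup (var i * contract i y A) (ind (L - A)) = 0"
    proof
      fix i assume i: "i \<in> {1..n} - (L - A)"
      have "ind (L - A) \<notin> keys (var i * contract i y A)"
      proof
        assume "ind (L - A) \<in> keys (var i * contract i y A)"
        then obtain t where "ind (L - A) = single i 1 + t"
          unfolding var_def by (auto simp: keys_single_times)
        then have "lookup (ind (L - A)) i > 0" by (simp add: lookup_add)
        then show False using i finite_L by (simp add: lookup_ind split: if_splits)
      qed
      then show "lookup (var i * contract i y A) (ind (L - A)) = 0" by (simp add: in_keys_iff)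
    qed
  qed simp
  also have "\<dots> = (\<Sum>i\<in>L - A. (- 1) ^ card {j \<in> A. j < i} * lookup (y (insert i A)) (ind (L - insert i A)))"
  proof (rule sum.cong[OF refl])
    fix i assume i: "i \<in> L - A"
    then have "L - A = insert i (L - insert i A)" by blast
    then have "ind (L - A) = ind (insert i (L - insert i A))" by (rule arg_cong)
    also have "\<dots> = single i 1 + ind (L - insert i A)"
      by (rule ind_insert) (simp_all add: finite_L)
    finally have e: "ind (L - A) = single i 1 + ind (L - insert i A)" .
    have "lookup (var i * contract i y A) (ind (L - A)) =
        lookup (contract i y A) (ind (L - insert i A))"
      by (simp only: e var_def lookup_single_times mult_1_left)
    also have "\<dots> = (- 1) ^ card {j \<in> A. j < i} * lookup (y (insert i A)) (ind (L - insert i A))"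
      using i by (simp add: contract_def lookup_koszul_sign_times)
    finally show "lookup (var i * contract i y A) (ind (L - A)) =
      (- 1) ^ card {j \<in> A. j < i} * lookup (y (insert i A)) (ind (L - insert i A))" .
  qed
  finally show ?thesis .
qed

text \<open>
  For \<open>(A, i)\<close>, the element of the transversal \<open>A\<close> that has the colour of \<open>i\<close>.
\<close>

definition partner :: "nat set \<times> nat \<Rightarrow> nat" where
  "partner x = inv_into (fst x) color (color (snd x))"

definition swap_partner :: "nat set \<times> nat \<Rightarrow> nat set \<times> nat" where
  "swap_partner x = (insert (snd x) (fst x - {partner x}), partner x)"

context
  fixes A :: "nat set" and i :: nat
  assumes A: "A \<in> transversals" and i: "i \<in> L - A"
begin

lemma partner_mem: "partner (A, i) \<in> A" "color (partner (A, i)) = color i"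
proof -
  have "color i \<in> color ` A"
    using A i color_L[of i] by (auto simp: transversals_def bij_betw_def)
  then show "partner (A, i) \<in> A" "color (partner (A, i)) = color i"
    by (auto simp: partner_def intro: inv_into_into f_inv_into_f)
qed

lemma swap_partner_in:
  "fst (swap_partner (A, i)) \<in> transversals" "snd (swap_partner (A, i)) \<in> L - fst (swap_partner (A, i))"
proof -
  let ?p = "partner (A, i)"
  have AL: "A \<subseteq> L" "inj_on color A" "color ` A = {1..s}"
    using A by (auto simp: transversals_def bij_betw_def)
  have ne: "i \<noteq> ?p" using i partner_mem(1) by (metis DiffD2)
  have other: "color j \<noteq> color i" if "j \<in> A - {?p}" for j
    using inj_onD[OF AL(2), of j ?p] partner_mem that by auto
  have "inj_on color (insert i (A - {?p}))"
  proof -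
    have "inj_on color (A - {?p})" by (rule inj_on_subset[OF AL(2)]) auto
    moreover have "color i \<notin> color ` (A - {?p} - {i})"
    proof
      assume "color i \<in> color ` (A - {?p} - {i})"
      then obtain j where "color i = color j" "j \<in> A - {?p} - {i}" by (rule imageE)
      then show False using other[of j] by simp
    qed
    ultimately show ?thesis by simp
  qed
  moreover have "color ` insert i (A - {?p}) = {1..s}"
  proof -
    have "A = insert ?p (A - {?p})" using partner_mem(1) by blast
    then have "color ` A = insert (color ?p) (color ` (A - {?p}))" by (metis image_insert)
    then show ?thesis using AL(3) partner_mem(2) by simp
  qed
  moreover have "insert i (A - {?p}) \<subseteq> L" using AL(1) i by blast
  ultimately show "fst (swap_partner (A, i)) \<in> transversals"
    by (simp add: transversals_def bij_betw_def swap_partner_def)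
  show "snd (swap_partner (A, i)) \<in> L - fst (swap_partner (A, i))"
    using partner_mem(1) AL(1) ne by (auto simp: swap_partner_def)
qed

lemma swap_swap: "swap_partner (swap_partner (A, i)) = (A, i)"
proof -
  let ?p = "partner (A, i)" and ?A = "insert i (A - {partner (A, i)})"
  have "inj_on color ?A"
    using swap_partner_in(1) by (simp add: swap_partner_def transversals_def bij_betw_def)
  then have "partner (?A, ?p) = i"
    unfolding partner_def[of "(?A, ?p)"] fst_conv snd_conv partner_mem(2) by (rule inv_into_f_f) simp
  moreover have "insert ?p (?A - {i}) = A" using partner_mem(1) i by auto
  ultimately show ?thesis by (simp add: swap_partner_def)
qed

text \<open>
  As colours increase, no element of \<open>insert i A\<close> lies between \<open>i\<close> and its partner.
\<close>

lemma swap_sign: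
  "(- 1) ^ card {j \<in> fst (swap_partner (A, i)). j < snd (swap_partner (A, i))} =
    - ((- 1) ^ card {j \<in> A. j < i} :: 'k::field)"
proof -
  let ?p = "partner (A, i)" and ?B = "insert i A"
  have AL: "A \<subseteq> L" "inj_on color A" using A by (auto simp: transversals_def bij_betw_def)
  have ne: "i \<noteq> ?p" using i partner_mem(1) by (metis DiffD2)
  \<comment> \<open>An element in between would have the same colour by monotonicity, and \<open>A\<close> has
    only one element of that colour.\<close>
  have between: "j = i \<or> j = ?p" if j: "j \<in> ?B" "min i ?p \<le> j" "j \<le> max i ?p" for j
  proof (rule ccontr)
    assume no: "\<not> (j = i \<or> j = ?p)"
    then have jA: "j \<in> A" using j(1) by blast
    have "color j = color ?p"
    proof (cases "i < ?p")
      case True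
      then have "color i \<le> color j" "color j \<le> color ?p"
        using j color_mono_L[of i j] color_mono_L[of j ?p] AL(1) jA i partner_mem(1) by auto
      then show ?thesis using partner_mem(2) by simp
    next
      case False
      then have "color ?p \<le> color j" "color j \<le> color i"
        using j color_mono_L[of ?p j] color_mono_L[of j i] AL(1) jA i partner_mem(1) by auto
      then show ?thesis using partner_mem(2) by simp
    qed
    then show False using inj_onD[OF AL(2) _ jA partner_mem(1)] no by simp
  qed
  have B1: "{j \<in> A. j < i} = {j \<in> ?B. j < i}" by auto
  have B2: "{j \<in> insert i (A - {?p}). j < ?p} = {j \<in> ?B. j < ?p}" by auto
  have fin: "finite {j \<in> ?B. j < l}" for l by (rule finite_subset[of _ "{..<l}"]) auto
  consider "i < ?p" | "?p < i" using ne by linarith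
  then have "card {j \<in> ?B. j < ?p} = Suc (card {j \<in> ?B. j < i}) \<or>
      card {j \<in> ?B. j < i} = Suc (card {j \<in> ?B. j < ?p})"
  proof cases
    case 1
    have "{j \<in> ?B. j < ?p} = insert i {j \<in> ?B. j < i}"
    proof (intro equalityI subsetI)
      fix j assume j: "j \<in> {j \<in> ?B. j < ?p}"
      then show "j \<in> insert i {j \<in> ?B. j < i}"
        using between[of j] 1 by (cases "j < i") auto
    qed (use 1 in auto)
    then show ?thesis using fin by simp
  next
    case 2
    have "{j \<in> ?B. j < i} = insert ?p {j \<in> ?B. j < ?p}"
    proof (intro equalityI subsetI)
      fix j assume j: "j \<in> {j \<in> ?B. j < i}"
      then show "j \<in> insert ?p {j \<in> ?B. j < ?p}"
        using between[of j] 2 by (cases "j < ?p") auto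
    qed (use 2 partner_mem(1) in auto)
    then show ?thesis using fin by simp
  qed
  then show ?thesis unfolding swap_partner_def fst_conv snd_conv B1 B2 by auto
qed

end

text \<open>
  A term belongs to a transversal \<open>A\<close> with an additional index \<open>i\<close>. The set \<open>insert i A\<close> has
  exactly one repeated colour and arises twice, with the two elements of that colour in the role
  of \<open>i\<close>; the signs are opposite because these elements are neighbours.
\<close>

lemma transversal_form_boundary:
  fixes y :: "nat set \<Rightarrow> 'k::field mpoly"
  shows "transversal_form (koszul_boundary n y) = 0"
proof -
  let ?P = "SIGMA A:transversals. L - A"
  let ?G = "\<lambda>x. (- 1) ^ card {j \<in> fst x. j < snd x} *
      lookup (y (insert (snd x) (fst x))) (ind (L - insert (snd x) (fst x)))"
  let ?lt = "{x \<in> ?P. snd x < partner x}" and ?gt = "{x \<in> ?P. partner x < snd x}"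
  have "transversal_form (koszul_boundary n y) = (\<Sum>A\<in>transversals. \<Sum>i\<in>L - A. ?G (A, i))"
    unfolding transversal_form_def
    by (rule sum.cong) (simp_all add: lookup_boundary transversals_def)
  also have "\<dots> = sum ?G ?P"
    using finite_transversals finite_L by (subst sum.Sigma) (auto simp: case_prod_beta)
  also have "?P = ?lt \<union> ?gt"
  proof -
    have "snd x \<noteq> partner x" if xP: "x \<in> ?P" for x
    proof -
      obtain A i where x: "x = (A, i)" "A \<in> transversals" "i \<in> L - A" using xP by (elim SigmaE)
      then show ?thesis using partner_mem(1)[OF x(2,3)] by (metis DiffD2 snd_conv)
    qed
    then show ?thesis using linorder_neqE_nat by blast
  qed
  also have "sum ?G (?lt \<union> ?gt) = sum ?G ?lt + sum ?G ?gt"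
    using finite_transversals finite_L by (intro sum.union_disjoint) auto
  also have "sum ?G ?gt = (\<Sum>x\<in>?lt. - ?G x)"
  proof (rule sum.reindex_bij_witness[of _ swap_partner swap_partner])
    have P: "swap_partner x \<in> ?P" "swap_partner (swap_partner x) = x"
        "partner (swap_partner x) = snd x" "snd (swap_partner x) = partner x" if xP: "x \<in> ?P" for x
    proof -
      obtain A i where x: "x = (A, i)" "A \<in> transversals" "i \<in> L - A" using xP by (elim SigmaE)
      show "swap_partner x \<in> ?P"
        using SigmaI[of _ transversals _ "(-) L", OF swap_partner_in[OF x(2,3)]] x(1) by simp
      show s: "swap_partner (swap_partner x) = x" using swap_swap[OF x(2,3)] x(1) by simp
      show "partner (swap_partner x) = snd x" using arg_cong[OF s, of snd] by (simp add: swap_partner_def)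
      show "snd (swap_partner x) = partner x" by (simp add: swap_partner_def)
    qed
    show "swap_partner (swap_partner x) = x" if "x \<in> ?gt" for x using P that by blast
    show "swap_partner (swap_partner x) = x" if "x \<in> ?lt" for x using P that by blast
    show "swap_partner x \<in> ?lt" if "x \<in> ?gt" for x using P[of x] that by simp
    show "swap_partner x \<in> ?gt" if "x \<in> ?lt" for x using P[of x] that by simp
    show "- ?G (swap_partner x) = ?G x" if xP: "x \<in> ?gt" for x
    proof -
      have "x \<in> ?P" using xP by simp
      then obtain A i where x: "x = (A, i)" "A \<in> transversals" "i \<in> L - A" by (elim SigmaE)
      have "insert (snd (swap_partner x)) (fst (swap_partner x)) = insert i A"
        using partner_mem(1)[OF x(2,3)] x(1) by (auto simp: swap_partner_def)
      then show ?thesis using swap_sign[OF x(2,3), where ?'k = 'k] x(1) by simp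
    qed
  qed
  finally show ?thesis by (simp add: sum_negf)
qed

lemma socle_chain_not_boundary:
  "\<not> (\<exists>y. koszul_chain n y \<and> (\<forall>A. socle_chain A - koszul_boundary n y A \<in> (mspan V :: 'k::field mpoly set)))"
proof
  assume "\<exists>y. koszul_chain n y \<and> (\<forall>A. socle_chain A - koszul_boundary n y A \<in> (mspan V :: 'k mpoly set))"
  then obtain y where "\<And>A. socle_chain A - koszul_boundary n y A \<in> (mspan V :: 'k mpoly set)" by blast
  then have "transversal_form (\<lambda>A. socle_chain A - koszul_boundary n y A) = (0 :: 'k)"
    by (rule transversal_form_ideal)
  moreover have "transversal_form (\<lambda>A. socle_chain A - koszul_boundary n y A) =
      transversal_form socle_chain - transversal_form (koszul_boundary n y)"
    by (simp add: transversal_form_def lookup_minus sum_subtractf)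
  ultimately show False by (simp add: transversal_form_socle transversal_form_boundary)
qed

theorem depth_quotient:
  "depth (graded_max_ideal n) (quot_module (mpoly_ring n) (mspan V :: 'k::field mpoly set)) = enat (n - s)"
proof -
  let ?I = "mspan V :: 'k mpoly set" and ?m = "graded_max_ideal n :: 'k mpoly set"
  note I = mspan_V_ideal[where ?'k = 'k] and m = ideal_mpoly_ringD[OF graded_max_ideal_ideal[of n, where ?'k = 'k]]
  have upper: "length rs \<le> n - s"
    if rs: "set rs \<subseteq> ?m" "regular_sequence (quot_module (mpoly_ring n) ?I) rs" for rs
  proof -
    have "weakly_regular n ?I rs"
      using rs regular_sequence_quot[OF I, of rs] m(1) by blast
    then have "s + length rs \<le> n"
    proof (rule koszul_length_bound[OF I])
      show "\<exists>h. (\<forall>i\<in>{1..n}. h i \<in> polys {1..n}) \<and> r = (\<Sum>i = 1..n. var i * h i)"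
        if "r \<in> set rs" for r
        using graded_max_ideal_combination that rs(1) by blast
      show "card A = s" if "socle_chain A \<noteq> (0 :: 'k mpoly)" for A
        using that inj_c by (auto simp: socle_chain_def card_image split: if_splits)
    qed (rule koszul_chain_socle socle_chain_cycle socle_chain_not_boundary)+
    then show ?thesis by linarith
  qed
  let ?rs = "regular_list :: 'k mpoly list"
  have sub: "set ?rs \<subseteq> ?m"
  proof
    fix f assume "f \<in> set ?rs"
    then obtain j where j: "j \<in> {1..n}" "f = theta j" by (auto simp: regular_list_def)
    have "(if color j = 0 then 0 else var (c (color j))) \<in> ?m"
      using m(2) var_in_graded_max_ideal[of "c (color j)"] color_cases[of j] c_in[of "color j"] by auto
    then show "f \<in> ?m"
      unfolding j(2) theta_def using m(5) var_in_graded_max_ideal[OF j(1)] by blast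
  qed
  have "foldl (adjoin n) ?I ?rs \<noteq> polys {1..n}"
  proof
    \<comment> \<open>The polynomials without constant term, an ideal that contains everything adjoined.\<close>
    let ?P = "mspan (mons {1..n} - {0}) :: 'k mpoly set"
    assume eq: "foldl (adjoin n) ?I ?rs = polys {1..n}"
    have P: "ideal ?P (mpoly_ring n)"
      by (rule ideal_mspan) (auto intro: mons_add simp: poly_mapping_eq_iff fun_eq_iff lookup_add)
    have "V \<subseteq> mons {1..n} - {0}"
    proof -
      have "dividing s u 0 = {}" using priv by (auto simp: dividing_def)
      then show ?thesis by (auto simp: V_def)
    qed
    then have IP: "?I \<subseteq> ?P" by (rule mspan_mono)
    have mP: "?m \<subseteq> ?P"
    proof (rule graded_max_ideal_minimal[OF P])
      fix i assume "i \<in> {1..n}"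
      then have "single i (1::nat) \<in> mons {1..n} - {0}"
        by (auto simp: poly_mapping_eq_iff fun_eq_iff lookup_single when_def)
      then show "var i \<in> ?P" unfolding var_def by (rule mspan_single)
    qed
    have fold: "foldl (adjoin n) J rs \<subseteq> ?P" if "J \<subseteq> ?P" "set rs \<subseteq> ?P" for J rs
      using that
    proof (induction rs arbitrary: J)
      case (Cons r rs)
      then show ?case using adjoin_minimal[OF P, of J r] by simp
    qed simp
    have "1 \<in> ?P" using fold[OF IP, of ?rs] sub mP eq polys_one by blast
    then show False by (simp add: mspan_def)
  qed
  then have "regular_sequence (quot_module (mpoly_ring n) ?I) ?rs"
    using regular_sequence_quot[OF I regular_list_polys] regular_list_weakly_regular by blast
  then have "enat (n - s) \<in> {enat (length rs) | rs. set rs \<subseteq> ?m \<and>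
      regular_sequence (quot_module (mpoly_ring n) ?I) rs}"
    using sub by (intro CollectI exI[of _ ?rs] conjI) (simp_all add: length_regular_list)
  then show ?thesis
    unfolding depth_def using upper by (intro antisym Sup_least Sup_upper) auto
qed

end

section \<open>Krull dimension of the quotient\<close>

lemma lookup_const_times: "lookup (single 0 x * p) m = x * lookup (p :: 'k::field mpoly) m"
  using lookup_single_times[of 0 x p m] by simp

text \<open>
  Gaussian elimination of one coordinate \<open>b\<close> at a time.
\<close>

lemma linear_dependence:
  fixes G :: "'e \<Rightarrow> 'k::field mpoly"
  assumes "finite B" "finite X" "card B < card X" "\<And>e. e \<in> X \<Longrightarrow> G e \<in> mspan B"
  shows "\<exists>a. (\<exists>e\<in>X. a e \<noteq> 0) \<and> (\<Sum>e\<in>X. single 0 (a e) * G e) = 0"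
  using assms
proof (induction B arbitrary: X G rule: finite_induct)
  case empty
  then obtain e where "e \<in> X" by fastforce
  moreover have "G e = 0" if "e \<in> X" for e using empty.prems(3)[OF that] by (simp add: mspan_def)
  ultimately show ?case by (intro exI[of _ "\<lambda>_. 1"]) auto
next
  case (insert b B)
  show ?case
  proof (cases "\<forall>e\<in>X. lookup (G e) b = 0")
    case True
    have "G e \<in> mspan B" if "e \<in> X" for e
      using insert.prems(3)[OF that] True that by (auto simp: mspan_def in_keys_iff)
    then show ?thesis using insert.IH[of X G] insert.prems insert.hyps by simp
  next
    case False
    then obtain e0 where e0: "e0 \<in> X" "lookup (G e0) b \<noteq> 0" by auto
    let ?X = "X - {e0}" and ?l = "\<lambda>e. lookup (G e) b / lookup (G e0) b"
    let ?G = "\<lambda>e. G e - single 0 (?l e) * G e0"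
    have "?G e \<in> mspan B" if e: "e \<in> ?X" for e
    proof -
      have "lookup (?G e) b = 0" using e0(2) by (simp add: lookup_minus lookup_const_times)
      moreover have "?G e \<in> mspan (insert b B)"
      proof (rule mspan_diff)
        show "G e \<in> mspan (insert b B)" using insert.prems(3) e by blast
        have "keys (single 0 (?l e) * G e0) \<subseteq> keys (G e0)"
          by (auto simp: in_keys_iff lookup_const_times)
        also have "\<dots> \<subseteq> insert b B" using insert.prems(3)[OF e0(1)] by (simp add: mspan_def)
        finally show "single 0 (?l e) * G e0 \<in> mspan (insert b B)" by (simp add: mspan_def)
      qed
      ultimately show ?thesis by (auto simp: mspan_def in_keys_iff)
    qed
    moreover have "finite ?X" "card B < card ?X"
      using insert.prems insert.hyps e0(1) by simp_all
    ultimately obtain a where a: "\<exists>e\<in>?X. a e \<noteq> 0" "(\<Sum>e\<in>?X. single 0 (a e) * ?G e) = 0"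
      using insert.IH[of ?X ?G] by blast
    let ?a = "a(e0 := - (\<Sum>e\<in>?X. a e * ?l e))"
    have single_sum: "single 0 (\<Sum>e\<in>Y. f e) = (\<Sum>e\<in>Y. single 0 (f e) :: 'k mpoly)" for f Y
      by (induction Y rule: infinite_finite_induct) (simp_all add: single_add)
    have "(\<Sum>e\<in>X. single 0 (?a e) * G e) =
        single 0 (?a e0) * G e0 + (\<Sum>e\<in>?X. single 0 (?a e) * G e)"
      using insert.prems(1) e0(1) by (rule sum.remove)
    also have "(\<Sum>e\<in>?X. single 0 (?a e) * G e) = (\<Sum>e\<in>?X. single 0 (a e) * G e)"
      by (rule sum.cong) auto
    also have "single 0 (?a e0) * G e0 = - (\<Sum>e\<in>?X. single 0 (a e) * (single 0 (?l e) * G e0))"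
      by (simp add: single_uminus single_sum sum_distrib_right mult_single flip: mult.assoc)
    also have "\<dots> + (\<Sum>e\<in>?X. single 0 (a e) * G e) = (\<Sum>e\<in>?X. single 0 (a e) * ?G e)"
      by (simp add: right_diff_distrib sum_subtractf)
    finally have "(\<Sum>e\<in>X. single 0 (?a e) * G e) = 0" using a(2) by simp
    moreover have "\<exists>e\<in>X. ?a e \<noteq> 0" using a(1) by auto
    ultimately show ?thesis by blast
  qed
qed

text \<open>
  The monomials in the variables from \<open>Z\<close> with all exponents at most \<open>d\<close>.
\<close>

definition box :: "nat set \<Rightarrow> nat \<Rightarrow> expo set" where
  "box Z d = {m \<in> mons Z. \<forall>j. lookup m j \<le> d}"

lemma card_box:
  assumes "finite Z"
  shows "finite (box Z d)" "card (box Z d) \<le> (d + 1) ^ card Z"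
proof -
  let ?f = "\<lambda>m. restrict (lookup m) Z"
  have inj: "inj_on ?f (box Z d)"
  proof (rule inj_onI, rule poly_mapping_eqI)
    fix m m' j assume m: "m \<in> box Z d" "m' \<in> box Z d" and eq: "?f m = ?f m'"
    show "lookup m j = lookup m' j"
    proof (cases "j \<in> Z")
      case True
      then show ?thesis using fun_cong[OF eq, of j] by simp
    next
      case False
      then have "j \<notin> keys m" "j \<notin> keys m'" using m by (auto simp: box_def mons_def)
      then show ?thesis by (simp add: in_keys_iff)
    qed
  qed
  have sub: "?f ` box Z d \<subseteq> (\<Pi>\<^sub>E j\<in>Z. {..d})" by (auto simp: box_def)
  have fin: "finite (\<Pi>\<^sub>E j\<in>Z. {..d})" using assms by (intro finite_PiE) auto
  show "finite (box Z d)" using inj_on_finite[OF inj sub fin] .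
  have "card (box Z d) \<le> card (\<Pi>\<^sub>E j\<in>Z. {..d})" by (rule card_inj_on_le[OF inj sub fin])
  also have "\<dots> = (d + 1) ^ card Z" using assms by (simp add: card_PiE)
  finally show "card (box Z d) \<le> (d + 1) ^ card Z" .
qed

lemma mspan_box_mult:
  assumes "p \<in> mspan (box Z d)" "q \<in> mspan (box Z d')"
  shows "p * q \<in> mspan (box Z (d + d'))"
  by (rule mspan_mult[OF assms]) (auto simp: box_def lookup_add intro: mons_add add_mono)

lemma mspan_box_one: "1 \<in> mspan (box Z d)"
  using mspan_single[of 0 "box Z d" 1] by (simp add: box_def)

lemma mspan_box_power: "p \<in> mspan (box Z d) \<Longrightarrow> p ^ e \<in> mspan (box Z (d * e))"
  by (induction e) (simp_all add: mspan_box_one mspan_box_mult)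

lemma mspan_box_prod:
  "(\<And>i. i \<in> A \<Longrightarrow> f i \<in> mspan (box Z (d i))) \<Longrightarrow> prod f A \<in> mspan (box Z (sum d A))"
  by (induction A rule: infinite_finite_induct) (simp_all add: mspan_box_one mspan_box_mult)

lemma mspan_box_mono: "d \<le> d' \<Longrightarrow> mspan (box Z d) \<subseteq> mspan (box Z d')"
  by (rule mspan_mono) (auto simp: box_def intro: order_trans)

lemma exists_box:
  assumes "p \<in> polys Z"
  shows "\<exists>d. p \<in> mspan (box Z d)"
proof
  let ?d = "\<Sum>m\<in>keys p. \<Sum>j\<in>keys m. lookup m j"
  have "lookup m j \<le> ?d" if m: "m \<in> keys p" for m j
  proof (cases "j \<in> keys m")
    case True
    then have "lookup m j \<le> (\<Sum>j\<in>keys m. lookup m j)" by (intro member_le_sum) auto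
    also have "\<dots> \<le> ?d" using m by (intro member_le_sum) auto
    finally show ?thesis .
  qed (simp add: in_keys_iff)
  then show "p \<in> mspan (box Z ?d)"
    using assms by (auto simp: mspan_def box_def polys_def mons_def)
qed

text \<open>
  Counting: the monomials of degree at most \<open>N\<close> in each of the \<open>k\<close> polynomials are about \<open>N ^ k\<close>
  in number and lie in a space of dimension of order \<open>N ^ card Z\<close>.
\<close>

lemma algebraic_dependence:
  fixes f :: "nat \<Rightarrow> 'k::field mpoly"
  assumes Z: "finite Z" "card Z < k" and f: "\<And>i. i \<in> {1..k} \<Longrightarrow> f i \<in> polys Z"
  shows "\<exists>X a. finite X \<and> X \<subseteq> ({1..k} \<rightarrow>\<^sub>E UNIV) \<and> (\<exists>e\<in>X. a e \<noteq> (0 :: 'k)) \<and>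
    (\<Sum>e\<in>X. single 0 (a e) * (\<Prod>i=1..k. f i ^ e i)) = 0"
proof -
  obtain d where d: "\<And>i. i \<in> {1..k} \<Longrightarrow> f i \<in> mspan (box Z (d i))"
    using exists_box[OF f] by metis
  define D where "D = (\<Sum>i=1..k. d i)"
  have D: "f i \<in> mspan (box Z D)" if "i \<in> {1..k}" for i
    using d[OF that] mspan_box_mono[of "d i" D] member_le_sum[of i "{1..k}" d] that
    by (auto simp: D_def)
  \<comment> \<open>With \<open>q (N + 1)\<close> bounding the number of values of an exponent, it is enough
    that \<open>q ^ card Z < N + 1\<close>.\<close>
  define q where "q = k * D + 1"
  define N where "N = q ^ card Z"
  let ?X = "{1..k} \<rightarrow>\<^sub>E {..N}"
  have finX: "finite ?X" by (intro finite_PiE) auto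
  have G: "(\<Prod>i=1..k. f i ^ e i) \<in> mspan (box Z (k * D * N))" if e: "e \<in> ?X" for e
  proof -
    have "(\<Prod>i=1..k. f i ^ e i) \<in> mspan (box Z (\<Sum>i=1..k. D * e i))"
      by (rule mspan_box_prod) (rule mspan_box_power[OF D])
    moreover have "(\<Sum>i=1..k. D * e i) \<le> (\<Sum>i=1..k. D * N)"
      using e by (intro sum_mono mult_le_mono2) auto
    ultimately show ?thesis
      using mspan_box_mono[of "\<Sum>i=1..k. D * e i" "k * D * N" Z] by (auto simp: mult.assoc)
  qed
  have "card (box Z (k * D * N)) < card ?X"
  proof -
    have "card (box Z (k * D * N)) \<le> (k * D * N + 1) ^ card Z" by (rule card_box(2)[OF Z(1)])
    also have "\<dots> \<le> (q * (N + 1)) ^ card Z"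
      by (intro power_mono) (simp_all add: q_def algebra_simps)
    also have "\<dots> = N * (N + 1) ^ card Z" by (simp only: power_mult_distrib N_def)
    also have "\<dots> < (N + 1) ^ Suc (card Z)" by simp
    also have "\<dots> \<le> (N + 1) ^ k" using Z(2) by (intro power_increasing) auto
    also have "\<dots> = card ?X" by (simp add: card_PiE)
    finally show ?thesis .
  qed
  from linear_dependence[where G = "\<lambda>e. \<Prod>i=1..k. f i ^ e i", OF card_box(1)[OF Z(1)] finX this G]
  obtain a where "\<exists>e\<in>?X. a e \<noteq> 0" "(\<Sum>e\<in>?X. single 0 (a e) * (\<Prod>i=1..k. f i ^ e i)) = 0"
    by blast
  then show ?thesis
    using finX by (intro exI[of _ ?X] exI[of _ a]) auto
qed

lemma primeidealD:
  assumes "primeideal P (mpoly_ring n)"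
  shows "ideal P (mpoly_ring n)" "1 \<notin> P"
    "\<And>f g. f \<in> polys {1..n} \<Longrightarrow> g \<in> polys {1..n} \<Longrightarrow> f * g \<in> P \<Longrightarrow> f \<in> P \<or> g \<in> P"
proof -
  interpret primeideal P "mpoly_ring n" by fact
  show "ideal P (mpoly_ring n)" by (rule is_ideal)
  show "1 \<notin> P" using one_imp_carrier I_notcarr by auto
  show "\<And>f g. f \<in> polys {1..n} \<Longrightarrow> g \<in> polys {1..n} \<Longrightarrow> f * g \<in> P \<Longrightarrow> f \<in> P \<or> g \<in> P"
    using I_prime by simp
qed

lemma prime_power_cancel:
  assumes "primeideal P (mpoly_ring n)" "f \<in> polys {1..n}" "g \<in> polys {1..n}" "f \<notin> P"
    "f ^ e * g \<in> P"
  shows "g \<in> P"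
  using assms(5)
proof (induction e)
  case (Suc e)
  then have "f * (f ^ e * g) \<in> P" by (simp add: mult.assoc)
  then have "f ^ e * g \<in> P"
    using primeidealD(3)[OF assms(1,2)] polys_mult[OF polys_power[OF assms(2)] assms(3)] assms(4)
    by blast
  then show ?case by (rule Suc.IH)
qed simp

text \<open>
  The idea of Coquand and Lombardi: in a relation between the \<open>f i\<close> modulo \<open>P 0\<close>, the lowest
  power of \<open>f 1\<close> can be cancelled since \<open>f 1 \<notin> P 0\<close>; the terms that still contain \<open>f 1\<close> vanish
  modulo \<open>P 1\<close>, which leaves a nontrivial relation between the remaining elements modulo \<open>P 1\<close>.
  At the end of the chain a nonzero constant remains.
\<close>

lemma no_relation_along_prime_chain:
  fixes f :: "nat \<Rightarrow> 'k::field mpoly"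
  assumes P: "\<And>i. i \<le> k \<Longrightarrow> primeideal (P i) (mpoly_ring n)" "\<And>i. i < k \<Longrightarrow> P i \<subseteq> P (Suc i)"
    and f: "\<And>i. i < k \<Longrightarrow> f (Suc i) \<in> P (Suc i) - P i"
    and X: "finite X" "X \<subseteq> ({1..k} \<rightarrow>\<^sub>E UNIV)" "\<exists>e\<in>X. a e \<noteq> 0"
  shows "(\<Sum>e\<in>X. single 0 (a e) * (\<Prod>i=1..k. f i ^ e i)) \<notin> P 0"
proof
  assume rel: "(\<Sum>e\<in>X. single 0 (a e) * (\<Prod>i=1..k. f i ^ e i)) \<in> P 0"
  have Pi: "ideal (P i) (mpoly_ring n)" if "i \<le> k" for i using primeidealD(1)[OF P(1)[OF that]] .
  have fp: "f l \<in> polys {1..n}" if l: "l \<in> {1..k}" for l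
  proof -
    obtain i where "l = Suc i" "i < k" using l by (cases l) auto
    then show ?thesis using f[of i] ideal_mpoly_ringD(1)[OF Pi[of l]] by auto
  qed
  have "\<exists>Y. Y \<subseteq> X \<and> Y \<noteq> {} \<and> (\<forall>e\<in>Y. a e \<noteq> 0) \<and> (\<forall>e\<in>Y. \<forall>e'\<in>Y. \<forall>l\<in>{1..i}. e l = e' l) \<and>
      (\<Sum>e\<in>Y. single 0 (a e) * (\<Prod>l\<in>{i<..k}. f l ^ e l)) \<in> P i" if "i \<le> k" for i
    using that
  proof (induction i)
    case 0
    have "(\<Sum>e\<in>{e\<in>X. a e \<noteq> 0}. single 0 (a e) * (\<Prod>l\<in>{0<..k}. f l ^ e l)) =
        (\<Sum>e\<in>X. single 0 (a e) * (\<Prod>i=1..k. f i ^ e i))"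
      using X(1) by (intro sum.mono_neutral_cong_left)
        (auto simp: atLeastSucAtMost_greaterThanAtMost)
    then show ?case using rel X(3) by (intro exI[of _ "{e\<in>X. a e \<noteq> 0}"]) auto
  next
    case (Suc i)
    then have i: "i < k" by simp
    obtain Y where Y: "Y \<subseteq> X" "Y \<noteq> {}" "\<forall>e\<in>Y. a e \<noteq> 0"
        "\<forall>e\<in>Y. \<forall>e'\<in>Y. \<forall>l\<in>{1..i}. e l = e' l"
        "(\<Sum>e\<in>Y. single 0 (a e) * (\<Prod>l\<in>{i<..k}. f l ^ e l)) \<in> P i"
      using Suc.IH i by auto
    have finY: "finite Y" using finite_subset[OF Y(1) X(1)] .
    \<comment> \<open>The lowest power of the next element that occurs in the relation.\<close>
    define t where "t = Min ((\<lambda>e. e (Suc i)) ` Y)"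
    let ?Y = "{e \<in> Y. e (Suc i) = t}" and ?f = "f (Suc i)"
    let ?R = "\<lambda>e. single 0 (a e) * (\<Prod>l\<in>{Suc i<..k}. f l ^ e l)"
    have t_le: "t \<le> e (Suc i)" if "e \<in> Y" for e
      using that finY by (auto simp: t_def intro: Min_le)
    have "t \<in> (\<lambda>e. e (Suc i)) ` Y" unfolding t_def using finY Y(2) by (intro Min_in) auto
    then have ne: "?Y \<noteq> {}" by auto
    have Rp: "?R e \<in> polys {1..n}" for e
      by (intro polys_mult polys_const polys_prod polys_power fp) auto
    have fSp: "?f \<in> polys {1..n}" using fp[of "Suc i"] i by simp
    have split: "{i<..k} = insert (Suc i) {Suc i<..k}" using i by auto
    have factored: "single 0 (a e) * (\<Prod>l\<in>{i<..k}. f l ^ e l) =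
        ?f ^ t * (?f ^ (e (Suc i) - t) * ?R e)" if e: "e \<in> Y" for e
    proof -
      have "(\<Prod>l\<in>{i<..k}. f l ^ e l) = ?f ^ e (Suc i) * (\<Prod>l\<in>{Suc i<..k}. f l ^ e l)"
        unfolding split by simp
      also have "?f ^ e (Suc i) = ?f ^ t * ?f ^ (e (Suc i) - t)"
        using t_le[OF e] by (simp flip: power_add)
      finally show ?thesis by (simp add: mult_ac)
    qed
    let ?Q = "\<Sum>e\<in>Y. ?f ^ (e (Suc i) - t) * ?R e"
    have "?f ^ t * ?Q \<in> P i"
      using Y(5) by (simp add: sum_distrib_left factored cong: sum.cong)
    moreover have "?Q \<in> polys {1..n}"
      by (intro polys_sum polys_mult[OF polys_power[OF fSp] Rp])
    ultimately have "?Q \<in> P i"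
      using prime_power_cancel[OF P(1) fSp] f[OF i] i by auto
    then have Q: "?Q \<in> P (Suc i)" using P(2)[OF i] by blast
    have id: "ideal (P (Suc i)) (mpoly_ring n)" using Pi Suc.prems by blast
    have "?Q = (\<Sum>e\<in>?Y. ?f ^ (e (Suc i) - t) * ?R e) +
        (\<Sum>e\<in>Y - ?Y. ?f ^ (e (Suc i) - t) * ?R e)"
      using finY by (subst sum.subset_diff[of ?Y Y]) (auto simp: add.commute)
    also have "(\<Sum>e\<in>?Y. ?f ^ (e (Suc i) - t) * ?R e) = (\<Sum>e\<in>?Y. ?R e)"
      by (rule sum.cong) auto
    finally have Qsum: "?Q = (\<Sum>e\<in>?Y. ?R e) + (\<Sum>e\<in>Y - ?Y. ?f ^ (e (Suc i) - t) * ?R e)" .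
    have "(\<Sum>e\<in>Y - ?Y. ?f ^ (e (Suc i) - t) * ?R e) \<in> P (Suc i)"
    proof (rule ideal_sum_closed[OF id])
      fix e assume e: "e \<in> Y - ?Y"
      then obtain r where r: "e (Suc i) - t = Suc r"
        using t_le[of e] by (cases "e (Suc i) - t") auto
      have "?f ^ r * ?R e \<in> polys {1..n}" by (intro polys_mult[OF polys_power[OF fSp] Rp])
      moreover have "?f \<in> P (Suc i)" using f[OF i] by simp
      ultimately have "(?f ^ r * ?R e) * ?f \<in> P (Suc i)" using ideal_mpoly_ringD(4)[OF id] by blast
      then show "?f ^ (e (Suc i) - t) * ?R e \<in> P (Suc i)" unfolding r by (simp add: mult_ac)
    qed
    then have "(\<Sum>e\<in>?Y. ?R e) \<in> P (Suc i)"
      using ideal_mpoly_ringD(5)[OF id Q] unfolding Qsum by force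
    moreover have "e l = e' l" if "e \<in> ?Y" "e' \<in> ?Y" "l \<in> {1..Suc i}" for e e' l
      using that Y(4) by (cases "l = Suc i") (auto simp: le_Suc_eq)
    moreover have "?Y \<subseteq> X" "\<forall>e\<in>?Y. a e \<noteq> 0" using Y(1,3) by auto
    ultimately show ?case using ne by (intro exI[of _ ?Y] conjI) blast+
  qed
  from this[of k] obtain Y where Y: "Y \<subseteq> X" "Y \<noteq> {}" "\<forall>e\<in>Y. a e \<noteq> 0"
      "\<forall>e\<in>Y. \<forall>e'\<in>Y. \<forall>l\<in>{1..k}. e l = e' l" "(\<Sum>e\<in>Y. single 0 (a e)) \<in> P k"
    by auto
  then obtain e where e: "e \<in> Y" by auto
  have "e' = e" if e': "e' \<in> Y" for e'
  proof
    fix l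
    show "e' l = e l"
    proof (cases "l \<in> {1..k}")
      case False
      then show ?thesis using e e' Y(1) X(2) by (metis PiE_arb subsetD)
    qed (use Y(4) e e' in blast)
  qed
  then have "Y = {e}" using e by blast
  then have "single 0 (a e) \<in> P k" using Y(5) by simp
  then have "single 0 (inverse (a e)) * single 0 (a e) \<in> P k"
    by (intro ideal_mpoly_ringD(4)[OF Pi]) simp_all
  moreover have "single 0 (inverse (a e)) * single 0 (a e) = (1 :: 'k mpoly)"
    using Y(3) e by (simp add: mult_single)
  ultimately show False using primeidealD(2)[OF P(1)[of k]] by simp
qed

text \<open>
  Modulo the variables in \<open>J\<close>, witnesses for the strict inclusions can be taken in the
  remaining variables, where too many of them would be algebraically dependent.
\<close>

theorem prime_chain_length:
  fixes P :: "nat \<Rightarrow> 'k::field mpoly set"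
  assumes P: "\<And>i. i \<le> k \<Longrightarrow> primeideal (P i) (mpoly_ring n)" "\<And>i. i < k \<Longrightarrow> P i \<subset> P (Suc i)"
    and J: "J \<subseteq> {1..n}" "\<And>j. j \<in> J \<Longrightarrow> var j \<in> P 0"
  shows "k \<le> n - card J"
proof (rule ccontr)
  assume "\<not> ?thesis"
  moreover have "card ({1..n} - J) = n - card J"
    using J(1) finite_subset[OF J(1)] by (simp add: card_Diff_subset)
  ultimately have k: "card ({1..n} - J) < k" by simp
  have chain: "P 0 \<subseteq> P i" if "i \<le> k" for i
    using that
  proof (induction i)
    case (Suc i)
    then show ?case using P(2)[of i] by auto
  qed simp
  have Pi: "ideal (P i) (mpoly_ring n)" if "i \<le> k" for i using primeidealD(1)[OF P(1)[OF that]] .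
  have "\<exists>f. f \<in> P (Suc i) - P i" if "i < k" for i using P(2)[OF that] by blast
  then obtain g where g: "\<And>i. i < k \<Longrightarrow> g i \<in> P (Suc i) - P i" by metis
  let ?M = "mons ({1..n} - J)"
  define f where "f i = restr ?M (g (i - 1))" for i
  have diff: "g i - f (Suc i) \<in> P 0" if i: "i < k" for i
  proof -
    have "g i \<in> polys {1..n}" using g[OF i] ideal_mpoly_ringD(1)[OF Pi[of "Suc i"]] i by auto
    then have "g i - f (Suc i) \<in> mspan (mons {1..n} - ?M)"
      unfolding f_def polys_eq_mspan using diff_restr by simp
    then have "g i - f (Suc i) \<in> mspan {m \<in> mons {1..n}. \<exists>j\<in>J. lookup m j > 0}"
      by (rule subsetD[OF mspan_mono, rotated]) (auto simp: mons_iff)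
    then have q: "subst (kill_vars J) (g i - f (Suc i)) = 0" "g i - f (Suc i) \<in> polys {1..n}"
      unfolding kernel_kill_vars[symmetric] by auto
    have "(g i - f (Suc i)) - subst (kill_vars J) (g i - f (Suc i)) \<in> P 0"
      by (rule diff_subst_in_ideal[OF Pi _ _ q(2)])
        (use J ideal_mpoly_ringD(2)[OF Pi] in \<open>auto simp: kill_vars_def intro: polys_var\<close>)
    then show ?thesis using q(1) by simp
  qed
  have f: "f (Suc i) \<in> P (Suc i) - P i" if i: "i < k" for i
  proof
    have "g i - (g i - f (Suc i)) \<in> P (Suc i)"
    proof (rule ideal_mpoly_ringD(5)[OF Pi])
      show "Suc i \<le> k" using i by simp
      show "g i \<in> P (Suc i)" using g[OF i] by simp
      show "g i - f (Suc i) \<in> P (Suc i)" using diff[OF i] chain[of "Suc i"] i by auto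
    qed
    then show "f (Suc i) \<in> P (Suc i)" by simp
    show "f (Suc i) \<notin> P i"
    proof
      assume fPi: "f (Suc i) \<in> P i"
      have "g i - f (Suc i) \<in> P i" using diff[OF i] chain[of i] i by auto
      from ideal_mpoly_ringD(3)[OF Pi this fPi] i
      have "(g i - f (Suc i)) + f (Suc i) \<in> P i" by simp
      then show False using g[OF i] by simp
    qed
  qed
  have fM: "f i \<in> polys ({1..n} - J)" for i
    unfolding f_def polys_eq_mspan by (rule restr_in_mspan)
  obtain X a where X: "finite X" "X \<subseteq> ({1..k} \<rightarrow>\<^sub>E UNIV)" "\<exists>e\<in>X. a e \<noteq> (0 :: 'k)"
      "(\<Sum>e\<in>X. single 0 (a e) * (\<Prod>i=1..k. f i ^ e i)) = 0"
    using algebraic_dependence[OF _ k, of f] fM by auto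
  have "(\<Sum>e\<in>X. single 0 (a e) * (\<Prod>i=1..k. f i ^ e i)) \<notin> P 0"
    using P(2) by (intro no_relation_along_prime_chain[where P = P and f = f, OF P(1) _ f X(1-3)]) auto
  then show False using X(4) ideal_mpoly_ringD(2)[OF Pi[of 0]] by simp
qed

lemma primeideal_vars: "primeideal {f \<in> polys {1..n}. subst (kill_vars T) f = (0 :: 'k::field mpoly)} (mpoly_ring n)"
proof (rule primeidealI[OF ideal_subst_kernel cring_mpoly_ring])
  have "subst (kill_vars T) 1 = (1 :: 'k mpoly)"
    using subst_single[of "kill_vars T" 0 1] by (simp add: subst_mon_def)
  then have "(1 :: 'k mpoly) \<notin> {f \<in> polys {1..n}. subst (kill_vars T) f = 0}" by simp
  moreover have "(1 :: 'k mpoly) \<in> carrier (mpoly_ring n)" by simp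
  ultimately show "carrier (mpoly_ring n) \<noteq> {f \<in> polys {1..n}. subst (kill_vars T) f = (0 :: 'k mpoly)}"
    by blast
qed (auto simp: subst_mult)

lemma primeideal_image:
  assumes P: "primeideal P (mpoly_ring n)" and I: "ideal I (mpoly_ring n)" "I \<subseteq> P"
  shows "primeideal ((\<lambda>f. I +>\<^bsub>mpoly_ring n\<^esub> f) ` P) (mpoly_ring n Quot I)"
proof -
  let ?c = "\<lambda>f. I +>\<^bsub>mpoly_ring n\<^esub> f"
  note Pd = primeidealD[OF P] and Pi = ideal_mpoly_ringD[OF primeidealD(1)[OF P]]
  interpret I: ideal I "mpoly_ring n" by (rule I(1))
  have carr: "carrier (mpoly_ring n Quot I) = ?c ` polys {1..n}"
    by (auto simp: FactRing_def A_RCOSETS_def')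
  have mem: "?c f \<in> ?c ` P \<longleftrightarrow> f \<in> P" if f: "f \<in> polys {1..n}" for f
  proof
    assume "?c f \<in> ?c ` P"
    then obtain p where p: "p \<in> P" "?c f = ?c p" by auto
    then have "f - p \<in> P" using coset_eq_iff[OF I(1) f, of p] Pi(1) I(2) by auto
    from Pi(3)[OF this p(1)] show "f \<in> P" by simp
  qed simp
  show ?thesis
  proof (rule primeidealI)
    show "ideal (?c ` P) (mpoly_ring n Quot I)"
      using ring.ring_ideal_imp_quot_ideal[OF ring_mpoly_ring I(1) Pd(1)] by simp
    show "cring (mpoly_ring n Quot I)" by (rule I.quotient_is_cring[OF cring_mpoly_ring])
    show "carrier (mpoly_ring n Quot I) \<noteq> ?c ` P"
      unfolding carr using mem[OF polys_one] Pd(2) polys_one by blast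
    fix X Y assume X: "X \<in> carrier (mpoly_ring n Quot I)" and Y: "Y \<in> carrier (mpoly_ring n Quot I)"
      and XY: "X \<otimes>\<^bsub>mpoly_ring n Quot I\<^esub> Y \<in> ?c ` P"
    obtain f where f: "f \<in> polys {1..n}" "X = ?c f" using X unfolding carr by auto
    obtain g where g: "g \<in> polys {1..n}" "Y = ?c g" using Y unfolding carr by auto
    have "X \<otimes>\<^bsub>mpoly_ring n Quot I\<^esub> Y = ?c (f * g)"
      using ring_hom_mult[OF I.rcos_ring_hom, of f g] f g by simp
    then have "f * g \<in> P" using XY mem[OF polys_mult[OF f(1) g(1)]] by simp
    then show "X \<in> ?c ` P \<or> Y \<in> ?c ` P" using Pd(3)[OF f(1) g(1)] f(2) g(2) by blast
  qed
qed

context private_variables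
begin

lemma prod_var_in_V:
  assumes "k \<in> {1..s}"
  shows "(\<Prod>j\<in>u k. var j) \<in> (mspan V :: 'k::field mpoly set)"
proof -
  have fin: "finite (u k)" using u_sub[OF assms] finite_subset by blast
  then have "k \<in> dividing s u (ind (u k))" using assms by (simp add: dividing_def lookup_ind)
  moreover have "ind (u k) \<in> mons {1..n}" using u_sub[OF assms] by (simp add: mons_def keys_ind fin)
  ultimately have "ind (u k) \<in> V" by (auto simp: V_def)
  then show ?thesis unfolding prod_var[OF fin] by (rule mspan_single)
qed

text \<open>
  A prime ideal over the ideal contains a variable from each generator, so its variables form a
  hitting set and \<open>prime_chain_length\<close> applies. Conversely the variables of \<open>H\<close> generate a prime
  ideal over the ideal, and adding the remaining variables one by one gives a chain.
\<close>

theorem krull_dim_quotient: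
  assumes H: "H \<subseteq> {1..n}" "\<And>k. k \<in> {1..s} \<Longrightarrow> u k \<inter> H \<noteq> {}"
    and min: "\<And>J. J \<subseteq> {1..n} \<Longrightarrow> (\<And>k. k \<in> {1..s} \<Longrightarrow> u k \<inter> J \<noteq> {}) \<Longrightarrow> card H \<le> card J"
  shows "krull_dim (mpoly_ring n Quot (mspan V :: 'k::field mpoly set)) = enat (n - card H)"
proof -
  let ?I = "mspan V :: 'k mpoly set" and ?R = "mpoly_ring n :: 'k mpoly ring"
  let ?c = "\<lambda>f. ?I +>\<^bsub>?R\<^esub> f"
  have I: "ideal ?I ?R" by (rule ideal_mspan[OF V_mons V_up])
  interpret I: ideal ?I ?R by (rule I)
  have upper: "k \<le> n - card H"
    if P: "\<forall>i\<le>k. primeideal (P i) (?R Quot ?I)" "\<forall>i<k. P i \<subset> P (Suc i)" for k P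
  proof -
    \<comment> \<open>The chain is pulled back to the polynomial ring.\<close>
    define Q where "Q i = {f \<in> polys {1..n}. ?c f \<in> P i}" for i
    have Qp: "primeideal (Q i) ?R" if i: "i \<le> k" for i
      using ring_hom_ring.primeideal_vimage[OF I.rcos_ring_hom_ring cring_mpoly_ring, of "P i"] P(1) i
      by (simp add: Q_def)
    have Qs: "Q i \<subset> Q (Suc i)" if i: "i < k" for i
    proof -
      have "P (Suc i) \<subseteq> carrier (?R Quot ?I)"
        using P(1) i additive_subgroup.a_subset[OF ideal.axioms(1)[OF primeideal.axioms(1)]]
        by (metis Suc_leI)
      then have carr: "P (Suc i) \<subseteq> ?c ` polys {1..n}"
        by (auto simp: FactRing_def A_RCOSETS_def')
      obtain X where X: "X \<in> P (Suc i)" "X \<notin> P i" using P(2) i by blast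
      then obtain f where "f \<in> polys {1..n}" "X = ?c f" using carr by auto
      then have "f \<in> Q (Suc i) - Q i" using X by (simp add: Q_def)
      moreover have "Q i \<subseteq> Q (Suc i)" using P(2) i by (auto simp: Q_def)
      ultimately show ?thesis by blast
    qed
    note Q0 = primeidealD[OF Qp[of 0]]
    have IQ: "?I \<subseteq> Q 0"
    proof
      fix f assume f: "f \<in> ?I"
      have fp: "f \<in> polys {1..n}" using f ideal_mpoly_ringD(1)[OF I] by blast
      have "?c f = ?c 0" using coset_eq_iff[OF I fp polys_zero] f by simp
      moreover have "?c 0 \<in> P 0"
        using ideal_mpoly_ringD(2)[OF Q0(1)] by (simp add: Q_def)
      ultimately show "f \<in> Q 0" using fp by (simp add: Q_def)
    qed
    let ?J = "{j \<in> {1..n}. var j \<in> Q 0}"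
    have "u l \<inter> ?J \<noteq> {}" if l: "l \<in> {1..s}" for l
    proof -
      have "\<exists>j\<in>A. var j \<in> Q 0" if "finite A" "A \<subseteq> {1..n}" "(\<Prod>j\<in>A. var j) \<in> Q 0" for A
        using that
      proof (induction A rule: finite_induct)
        case empty
        then show ?case using Q0(2) by simp
      next
        case (insert j A)
        have "var j \<in> polys {1..n}" "(\<Prod>j\<in>A. var j) \<in> (polys {1..n} :: 'k mpoly set)"
          using insert.prems(1) by (auto intro!: polys_var polys_prod)
        then have "var j \<in> Q 0 \<or> (\<Prod>j\<in>A. var j) \<in> Q 0"
          using insert.prems(2) insert.hyps by (intro Q0(3)) simp_all
        then show ?case using insert.IH insert.prems(1) by auto
      qed
      moreover have "finite (u l)" using u_sub[OF l] finite_subset by blast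
      ultimately show ?thesis using prod_var_in_V[OF l] IQ u_sub[OF l] by blast
    qed
    then have "card H \<le> card ?J" by (intro min) auto
    moreover have "k \<le> n - card ?J"
      by (rule prime_chain_length[where P = Q, OF Qp Qs]) auto
    ultimately show ?thesis by linarith
  qed
  have "\<exists>P. (\<forall>i\<le>n - card H. primeideal (P i) (?R Quot ?I)) \<and> (\<forall>i<n - card H. P i \<subset> P (Suc i))"
  proof -
    obtain xs where xs: "set xs = {1..n} - H" "distinct xs"
      using finite_distinct_list[of "{1..n} - H"] by auto
    have len: "length xs = n - card H"
      using distinct_card[OF xs(2)] xs(1) H(1) finite_subset[OF H(1)] by (simp add: card_Diff_subset)
    let ?T = "\<lambda>i. H \<union> set (take i xs)"
    define K where "K i = {f \<in> polys {1..n}. subst (kill_vars (?T i)) f = (0 :: 'k mpoly)}" for i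
    have Kp: "primeideal (K i) ?R" for i unfolding K_def by (rule primeideal_vars)
    have Km: "K i = mspan {m \<in> mons {1..n}. \<exists>j\<in>?T i. lookup m j > 0}" for i
      unfolding K_def by (rule kernel_kill_vars)
    have IK: "?I \<subseteq> K i" for i
      unfolding Km
    proof (rule mspan_mono, rule subsetI)
      fix m assume m: "m \<in> V"
      then obtain k where k: "k \<in> {1..s}" "\<forall>j\<in>u k. lookup m j > 0"
        by (auto simp: V_def dividing_def)
      then obtain j where "j \<in> H" "lookup m j > 0" using H(2)[OF k(1)] by blast
      then show "m \<in> {m \<in> mons {1..n}. \<exists>j\<in>?T i. lookup m j > 0}" using m V_mons by blast
    qed
    have strict: "?c ` K i \<subset> ?c ` K (Suc i)" if i: "i < length xs" for i
    proof
      have T: "?T (Suc i) = insert (xs ! i) (?T i)"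
        using i by (simp add: take_Suc_conv_app_nth)
      show "?c ` K i \<subseteq> ?c ` K (Suc i)"
        unfolding Km T by (intro image_mono mspan_mono) auto
      have x: "xs ! i \<in> {1..n} - H" using i xs(1) nth_mem by blast
      have "xs ! i \<notin> set (take i xs)"
        using xs(2) i by (auto simp: in_set_conv_nth nth_eq_iff_index_eq)
      then have notin: "xs ! i \<notin> ?T i" using x by blast
      have vp: "var (xs ! i) \<in> (polys {1..n} :: 'k mpoly set)" using x by (intro polys_var) blast
      have "var (xs ! i) \<in> K (Suc i)"
        unfolding K_def T using vp by (simp add: subst_var kill_vars_def)
      moreover have "?c (var (xs ! i)) \<notin> ?c ` K i"
      proof
        assume "?c (var (xs ! i)) \<in> ?c ` K i"
        then obtain p where p: "p \<in> K i" "?c (var (xs ! i)) = ?c p" by auto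
        then have "var (xs ! i) - p \<in> K i"
          using coset_eq_iff[OF I vp, of p] IK by (auto simp: K_def)
        then have "var (xs ! i) - p + p \<in> K i"
          using ideal_mpoly_ringD(3)[OF primeidealD(1)[OF Kp]] p(1) by blast
        then have "subst (kill_vars (?T i)) (var (xs ! i)) = (0 :: 'k mpoly)" by (simp add: K_def)
        then show False using notin var_nonzero[where ?'k = 'k] by (simp add: subst_var kill_vars_def)
      qed
      ultimately show "?c ` K i \<noteq> ?c ` K (Suc i)" by blast
    qed
    show ?thesis
      using primeideal_image[OF Kp I IK] strict len
      by (intro exI[of _ "\<lambda>i. ?c ` K i"]) auto
  qed
  then have "enat (n - card H) \<in> {enat k | k. \<exists>P. (\<forall>i\<le>k. primeideal (P i) (?R Quot ?I)) \<and>
      (\<forall>i<k. P i \<subset> P (Suc i))}" by blast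
  then show ?thesis
    unfolding krull_dim_def using upper by (intro antisym Sup_least Sup_upper) auto
qed

end

section \<open>Ideals generated by intervals of variables\<close>

lemma interval_ideal_eq:
  fixes a b :: "nat \<Rightarrow> nat"
  assumes "\<And>k. k \<in> {1..s} \<Longrightarrow> {a k..b k} \<subseteq> {1..n}"
  shows "interval_ideal n s a b =
    (mspan {m \<in> mons {1..n}. dividing s (\<lambda>k. {a k..b k}) m \<noteq> {}} :: 'k::field mpoly set)"
proof
  let ?V = "{m \<in> mons {1..n}. dividing s (\<lambda>k. {a k..b k}) m \<noteq> {}}"
  let ?g = "\<lambda>k. \<Prod>j\<in>{a k..b k}. var j :: 'k mpoly"
  have g: "?g k = single (ind {a k..b k}) 1" for k by (rule prod_var) simp
  have indm: "ind {a k..b k} \<in> mons {1..n}" if "k \<in> {1..s}" for k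
    using assms[OF that] by (simp add: mons_def keys_ind)
  have V: "ideal (mspan ?V :: 'k mpoly set) (mpoly_ring n)"
  proof (rule ideal_mspan)
    fix m t assume m: "m \<in> ?V" and t: "t \<in> mons {1..n}"
    have "dividing s (\<lambda>k. {a k..b k}) m \<subseteq> dividing s (\<lambda>k. {a k..b k}) (t + m)"
      by (auto simp: dividing_def lookup_add)
    then show "t + m \<in> ?V" using m mons_add[OF t] by blast
  qed auto
  show "interval_ideal n s a b \<subseteq> (mspan ?V :: 'k mpoly set)"
    unfolding interval_ideal_def
  proof (rule ring.genideal_minimal[OF ring_mpoly_ring V], rule image_subsetI)
    fix k assume k: "k \<in> {1..s}"
    then have "k \<in> dividing s (\<lambda>k. {a k..b k}) (ind {a k..b k})"
      by (simp add: dividing_def lookup_ind)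
    then have "ind {a k..b k} \<in> ?V" using indm[OF k] by blast
    then show "?g k \<in> mspan ?V" unfolding g by (rule mspan_single)
  qed
  have gen: "?g ` {1..s} \<subseteq> carrier (mpoly_ring n)"
  proof (rule image_subsetI)
    fix k assume "k \<in> {1..s}"
    then have "var j \<in> (polys {1..n} :: 'k mpoly set)" if "j \<in> {a k..b k}" for j
      using assms that by (intro polys_var) blast
    then show "?g k \<in> carrier (mpoly_ring n)"
      unfolding mpoly_ring_simps by (rule polys_prod)
  qed
  have Id: "ideal (interval_ideal n s a b :: 'k mpoly set) (mpoly_ring n)"
    unfolding interval_ideal_def by (rule ring.genideal_ideal[OF ring_mpoly_ring gen])
  show "(mspan ?V :: 'k mpoly set) \<subseteq> interval_ideal n s a b"
  proof
    fix f :: "'k mpoly" assume f: "f \<in> mspan ?V"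
    have "(\<Sum>m\<in>keys f. single m (lookup f m)) \<in> interval_ideal n s a b"
    proof (rule ideal_sum_closed[OF Id])
      fix m assume "m \<in> keys f"
      then have "m \<in> ?V" using f by (auto simp: mspan_def)
      then obtain k where m: "m \<in> mons {1..n}" and k: "k \<in> {1..s}"
          "\<And>j. j \<in> {a k..b k} \<Longrightarrow> lookup m j > 0" by (auto simp: dividing_def)
      let ?e = "ind {a k..b k}"
      have "?g k \<in> interval_ideal n s a b"
        unfolding interval_ideal_def
        using ring.genideal_self[OF ring_mpoly_ring gen] k(1) by blast
      moreover have "m - ?e \<in> mons {1..n}"
        using m by (auto simp: mons_iff lookup_minus)
      then have "single (m - ?e) (lookup f m) \<in> polys {1..n}"
        unfolding polys_eq_mspan by (rule mspan_single)
      ultimately have "single (m - ?e) (lookup f m) * ?g k \<in> interval_ideal n s a b"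
        using ideal_mpoly_ringD(4)[OF Id] by blast
      moreover have "m - ?e + ?e = m"
      proof (rule poly_mapping_eqI)
        fix j
        show "lookup (m - ?e + ?e) j = lookup m j"
          using k(2)[of j] by (auto simp: lookup_add lookup_minus lookup_ind)
      qed
      ultimately show "single m (lookup f m) \<in> interval_ideal n s a b"
        unfolding g by (simp add: mult_single)
    qed
    then show "f \<in> interval_ideal n s a b" using poly_eq_sum_monomials[of f] by argo
  qed
qed

locale interval_family =
  fixes n s :: nat and a b :: "nat \<Rightarrow> nat"
  assumes a_mono: "strict_mono_on {1..s} a" and b_mono: "strict_mono_on {1..s} b"
    and a1: "s \<ge> 1 \<Longrightarrow> 1 \<le> a 1" and bs: "s \<ge> 1 \<Longrightarrow> b s \<le> n"
    and ab: "k \<in> {1..s} \<Longrightarrow> a k \<le> b k"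
    and gap: "1 \<le> k \<Longrightarrow> k + 2 \<le> s \<Longrightarrow> b k + 1 < a (k + 2)"
begin

abbreviation u :: "nat \<Rightarrow> nat set" where
  "u k \<equiv> {a k..b k}"

text \<open>
  The first index of \<open>u k\<close> after the end of the previous interval. It comes before the next
  interval starts, since \<open>a k < a (k + 1)\<close> and \<open>b (k - 1) + 1 < a (k + 1)\<close>.
\<close>

definition own :: "nat \<Rightarrow> nat" where
  "own k = (if k = 1 then a 1 else max (a k) (b (k - 1) + 1))"

text \<open>
  The last interval that starts at or before a covered index \<open>j\<close>. It still contains \<open>j\<close> because
  right end points increase with \<open>k\<close>.
\<close>

definition color :: "nat \<Rightarrow> nat" where
  "color j = (if \<exists>k\<in>{1..s}. j \<in> u k then Max {k \<in> {1..s}. a k \<le> j} else 0)"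

lemma a_less: "k \<in> {1..s} \<Longrightarrow> l \<in> {1..s} \<Longrightarrow> k < l \<Longrightarrow> a k < a l"
  using a_mono by (auto simp: strict_mono_on_def)

lemma b_less: "k \<in> {1..s} \<Longrightarrow> l \<in> {1..s} \<Longrightarrow> k < l \<Longrightarrow> b k < b l"
  using b_mono by (auto simp: strict_mono_on_def)

lemma a_le: "k \<in> {1..s} \<Longrightarrow> l \<in> {1..s} \<Longrightarrow> k \<le> l \<Longrightarrow> a k \<le> a l"
  using a_less[of k l] by (cases "k = l") auto

lemma b_le: "k \<in> {1..s} \<Longrightarrow> l \<in> {1..s} \<Longrightarrow> k \<le> l \<Longrightarrow> b k \<le> b l"
  using b_less[of k l] by (cases "k = l") auto

lemma far: "k \<in> {1..s} \<Longrightarrow> l \<in> {1..s} \<Longrightarrow> k + 2 \<le> l \<Longrightarrow> b k + 1 < a l"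
  using gap[of k] a_le[of "k + 2" l] by auto

lemma u_sub: "k \<in> {1..s} \<Longrightarrow> u k \<subseteq> {1..n}"
  using a_le[of 1 k] b_le[of k s] a1 bs by auto

lemma pred_in: "k \<in> {1..s} \<Longrightarrow> k \<noteq> 1 \<Longrightarrow> k - 1 \<in> {1..s} \<and> k - 1 < k"
  by auto

lemma own_in: "k \<in> {1..s} \<Longrightarrow> own k \<in> u k"
  using ab[of k] b_less[of "k - 1" k] pred_in[of k] by (cases "k = 1") (simp_all add: own_def)

lemma own_above:
  assumes "k \<in> {1..s}" "l \<in> {1..s}" "l < k"
  shows "b l < own k"
proof -
  have "k \<noteq> 1" "l \<le> k - 1" using assms by auto
  then show ?thesis
    using b_le[OF assms(2), of "k - 1"] pred_in[OF assms(1)] by (simp add: own_def)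
qed

lemma own_below:
  assumes "k \<in> {1..s}" "l \<in> {1..s}" "k < l"
  shows "own k < a l"
proof (cases "k = 1")
  case False
  then have "k - 1 + 2 \<le> l" using assms by auto
  then show ?thesis
    using a_less[OF assms] far[OF _ assms(2), of "k - 1"] pred_in[OF assms(1) False] False
    by (simp add: own_def)
qed (use a_less[OF assms] in \<open>simp add: own_def\<close>)

lemma own_private: "k \<in> {1..s} \<Longrightarrow> l \<in> {1..s} \<Longrightarrow> own l \<in> u k \<longleftrightarrow> l = k"
  using own_in[of k] own_above[of l k] own_below[of l k] by (cases l k rule: linorder_cases) auto

lemma color_props:
  assumes k: "k \<in> {1..s}" "j \<in> u k"
  shows "color j \<in> {1..s}" "a (color j) \<le> j" "k \<le> color j" "j \<in> u (color j)"
    "\<And>l. l \<in> {1..s} \<Longrightarrow> a l \<le> j \<Longrightarrow> l \<le> color j"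
proof -
  let ?S = "{k \<in> {1..s}. a k \<le> j}"
  have c: "color j = Max ?S" using k by (auto simp: color_def)
  have S: "k \<in> ?S" using k by simp
  then have "Max ?S \<in> ?S" by (intro Max_in) auto
  then show 1: "color j \<in> {1..s}" "a (color j) \<le> j" unfolding c by auto
  show *: "\<And>l. l \<in> {1..s} \<Longrightarrow> a l \<le> j \<Longrightarrow> l \<le> color j" unfolding c by (intro Max_ge) auto
  then show "k \<le> color j" using k by auto
  then show "j \<in> u (color j)" using b_le[OF k(1) 1(1)] 1 k by auto
qed

lemma colored: "colored_private_variables n s u own color"
proof
  show "k \<in> {1..s} \<Longrightarrow> u k \<subseteq> {1..n}" for k by (rule u_sub)
  show "k \<in> {1..s} \<Longrightarrow> l \<in> {1..s} \<Longrightarrow> own l \<in> u k \<longleftrightarrow> l = k" for k l by (rule own_private)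
  show "k \<in> {1..s} \<Longrightarrow> j \<in> u k \<Longrightarrow> color j \<in> {1..s} \<and> j \<in> u (color j)" for k j
    using color_props[of k j] by blast
  show "color i \<le> color j" if "k \<in> {1..s}" "l \<in> {1..s}" "i \<in> u k" "j \<in> u l" "i \<le> j" for k l i j
    using color_props(1,2)[OF that(1,3)] color_props(5)[OF that(2,4), of "color i"] that(5) by simp
  show "i \<in> u l" if "k \<in> {1..s}" "l \<in> {1..s}" "i \<in> u k" "j \<in> u l" "i < j" "color i = color j"
    for k l i j
  proof -
    have "l \<le> color i" using color_props(3)[OF that(2,4)] that(6) by simp
    then have "a l \<le> i"
      using a_le[OF that(2) color_props(1)[OF that(1,3)]] color_props(2)[OF that(1,3)] by simp
    then show ?thesis using that by simp
  qed
  show "color j = 0" if "\<And>k. k \<in> {1..s} \<Longrightarrow> j \<notin> u k" for j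
    unfolding color_def using that by (auto simp del: atLeastAtMost_iff)
qed

sublocale colored_private_variables n s u own color
  by (rule colored)

lemma interval_ideal_V: "interval_ideal n s a b = (mspan V :: 'k::field mpoly set)"
  unfolding V_def by (rule interval_ideal_eq) (rule u_sub)

text \<open>
  Intervals whose numbers differ by two or more are disjoint, so an index lies in at most two of
  them.
\<close>

lemma card_hitting_set:
  assumes "J \<subseteq> {1..n}" "\<And>k. k \<in> {1..s} \<Longrightarrow> u k \<inter> J \<noteq> {}"
  shows "s \<le> 2 * card J"
proof -
  have fin: "finite J" using assms(1) finite_subset by blast
  have "card {k \<in> {1..s}. j \<in> u k} \<le> 2" for j
  proof (cases "\<exists>k\<in>{1..s}. j \<in> u k")
    case True
    then have sub: "{k \<in> {1..s}. j \<in> u k} \<subseteq> {color j - 1, color j}"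
    proof (intro subsetI)
      fix k assume k: "k \<in> {k \<in> {1..s}. j \<in> u k}"
      then have c: "color j \<in> {1..s}" "a (color j) \<le> j" "k \<le> color j" using color_props[of k j] by auto
      have "\<not> k + 2 \<le> color j" using far[of k "color j"] k c by auto
      then show "k \<in> {color j - 1, color j}" using c(3) by auto
    qed
    have "card {color j - 1, color j} \<le> 2" by (cases "color j - 1 = color j") simp_all
    then show ?thesis using card_mono[OF _ sub] by simp
  next
    case False
    then have "{k \<in> {1..s}. j \<in> u k} = {}" by blast
    then show ?thesis by (metis card.empty zero_le)
  qed
  then have "(\<Sum>j\<in>J. card {k \<in> {1..s}. j \<in> u k}) \<le> of_nat (card J) * 2"
    by (intro sum_bounded_above) simp
  moreover have "{1..s} = (\<Union>j\<in>J. {k \<in> {1..s}. j \<in> u k})" using assms(2) by blast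
  then have "card {1..s} \<le> (\<Sum>j\<in>J. card {k \<in> {1..s}. j \<in> u k})"
    using card_UN_le[OF fin, of "\<lambda>j. {k \<in> {1..s}. j \<in> u k}"] by metis
  ultimately show ?thesis by simp
qed

text \<open>
  The right end point of an interval with odd number lies in the next interval as well.
\<close>

lemma exists_hitting_set:
  assumes overlap: "\<And>i. 1 \<le> i \<Longrightarrow> i + 1 \<le> s \<Longrightarrow> a (i + 1) \<le> b i"
  shows "\<exists>H. H \<subseteq> {1..n} \<and> (\<forall>k\<in>{1..s}. u k \<inter> H \<noteq> {}) \<and> card H = (s + 1) div 2"
proof (intro exI conjI ballI)
  let ?H = "b ` (\<lambda>i. 2 * i + 1) ` {..<(s + 1) div 2}"
  have odd_in: "2 * i + 1 \<in> {1..s}" if "i < (s + 1) div 2" for i using that by auto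
  have b_in: "b k \<in> u k" if "k \<in> {1..s}" for k using ab[OF that] by simp
  show "?H \<subseteq> {1..n}" using odd_in b_in u_sub by blast
  show "u k \<inter> ?H \<noteq> {}" if k: "k \<in> {1..s}" for k
  proof (cases "odd k")
    case True
    then obtain i where "k = 2 * i + 1" by (elim oddE)
    then have "b k \<in> ?H" using k by (intro imageI image_eqI[of _ _ i]) auto
    then show ?thesis using b_in[OF k] by blast
  next
    case False
    then obtain i where i: "k = 2 * i" by blast
    then have "k - 1 = 2 * (i - 1) + 1" "i - 1 < (s + 1) div 2" using k by auto
    then have "b (k - 1) \<in> ?H" by blast
    moreover have "b (k - 1) \<in> u k"
    proof -
      have p: "k - 1 \<in> {1..s}" "1 \<le> k - 1" "k - 1 + 1 = k" using k i by auto
      show ?thesis using overlap[of "k - 1"] b_le[OF p(1) k] p k by auto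
    qed
    ultimately show ?thesis by blast
  qed
  have "inj_on b {1..s}" using b_mono by (rule strict_mono_on_imp_inj_on)
  moreover have "(\<lambda>i. 2 * i + 1) ` {..<(s + 1) div 2} \<subseteq> {1..s}" using odd_in by blast
  ultimately have "inj_on b ((\<lambda>i. 2 * i + 1) ` {..<(s + 1) div 2})" by (rule inj_on_subset)
  then show "card ?H = (s + 1) div 2" by (simp add: card_image inj_on_def)
qed

end

theorem proposition1p9:
  fixes n s :: nat and a b :: "nat \<Rightarrow> nat"
    and S :: "'k::field mpoly ring" and I :: "'k mpoly set"
  assumes "n \<ge> 1" and "s \<le> n"
    and "strict_mono_on {1..s} a" and "strict_mono_on {1..s} b"
    and "s \<ge> 1 \<Longrightarrow> 1 \<le> a 1" and "s \<ge> 1 \<Longrightarrow> b s \<le> n"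
    and "\<forall>i\<in>{1..s}. a i \<le> b i"
    and "\<forall>k. 1 \<le> k \<and> k + 2 \<le> s \<longrightarrow> a (k + 2) > b k + 1"
    and "S = mpoly_ring n" and "I = interval_ideal n s a b"
  shows
    "(sdepth n (quot_module S I) (quot_component n I) = n - s \<and>
      depth (graded_max_ideal n) (quot_module S I) = enat (n - s)) \<and>
     (s \<ge> 1 \<longrightarrow>
      sdepth n (ideal_module S I) (ideal_component n I) = n - nat \<lfloor>real s / 2\<rfloor>) \<and>
     ((\<forall>i. 1 \<le> i \<and> i + 1 \<le> s \<longrightarrow> b i \<ge> a (i + 1)) \<longrightarrow>
      krull_dim (S Quot I) = enat (n - nat \<lceil>real s / 2\<rceil>))"
proof -
  interpret interval_family n s a b
    using assms(3-8) by unfold_locales auto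
  have I: "I = mspan V" unfolding assms(10) by (rule interval_ideal_V)
  have floor: "nat \<lfloor>real s / 2\<rfloor> = s div 2" by linarith
  have ceiling: "nat \<lceil>real s / 2\<rceil> = (s + 1) div 2" by linarith
  have "krull_dim (S Quot I) = enat (n - (s + 1) div 2)"
    if overlap: "\<forall>i. 1 \<le> i \<and> i + 1 \<le> s \<longrightarrow> b i \<ge> a (i + 1)"
  proof -
    obtain H where H: "H \<subseteq> {1..n}" "\<forall>k\<in>{1..s}. u k \<inter> H \<noteq> {}" "card H = (s + 1) div 2"
      using exists_hitting_set overlap by blast
    have "card H \<le> card J" if "J \<subseteq> {1..n}" "\<And>k. k \<in> {1..s} \<Longrightarrow> u k \<inter> J \<noteq> {}" for J
      using card_hitting_set[OF that] H(3) by linarith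
    then show ?thesis
      using krull_dim_quotient[where ?'k = 'k, OF H(1)] H(2,3) unfolding I assms(9) by auto
  qed
  then show ?thesis
    unfolding floor ceiling
    using sdepth_quotient[where ?'k = 'k] depth_quotient[where ?'k = 'k] sdepth_ideal[where ?'k = 'k]
    unfolding I assms(9) by blast
qed

end
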